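(* Let $\Omega\subset\mathbb{R}^3$ be open, bounded, connected and contain the origin, and let $\varepsilon\in(0,1)$. Then the point spectrum (set of eigenvalues) of $H(\varepsilon)$ is empty: $\sigma_p(H(\varepsilon))=\varnothing$.
   Context: $\Omega_\varepsilon=\{\varepsilon y: y\in\Omega\}$ and $H(\varepsilon):H^2(\mathbb{R}^3)\subset L^2(\mathbb{R}^3)\to L^2(\mathbb{R}^3)$, $H(\varepsilon)=-b_\varepsilon\Delta$, where $b_\varepsilon=\varepsilon^2\chi_{\Omega_\varepsilon}+\chi_{\Omega_\varepsilon^c}$. $H(\varepsilon)$ is closed in $L^2(\mathbb{R}^3)$ and is non-negative and self-adjoint in the weighted space $L^2(\mathbb{R}^3;b_\varepsilon^{-1}dx)$, which coincides with $L^2(\mathbb{R}^3)$ as a set with an equivalent norm. *)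

theory Defs
  imports "HOL-Analysis.Analysis"
begin

text \<open>
  Elements of \<open>L\<^sup>2(\<real>\<^sup>n)\<close> are represented by complex-valued Borel functions, identified when they
  agree almost everywhere; every class of Lebesgue measurable functions has a Borel
  representative, so this is the usual space.
\<close>

definition L2 :: "(real ^ 'n \<Rightarrow> complex) set" where
  "L2 = {u. u \<in> borel_measurable lborel \<and> integrable lborel (\<lambda>x. (norm (u x))\<^sup>2)}"

definition partial :: "'n::finite \<Rightarrow> (real ^ 'n \<Rightarrow> complex) \<Rightarrow> real ^ 'n \<Rightarrow> complex" where
  "partial i f = (\<lambda>x. frechet_derivative f (at x) (axis i 1))"

text \<open>
  A list of indices, rather than a multi-index, specifies an iterated partial derivative.
\<close>

primrec partials :: "'n::finite list \<Rightarrow> (real ^ 'n \<Rightarrow> complex) \<Rightarrow> real ^ 'n \<Rightarrow> complex" where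
  "partials [] f = f"
| "partials (i # is) f = partial i (partials is f)"

definition smooth :: "(real ^ 'n::finite \<Rightarrow> complex) \<Rightarrow> bool" where
  "smooth f \<longleftrightarrow> (\<forall>is x. partials is f differentiable (at x))"

definition test_functions :: "(real ^ 'n::finite \<Rightarrow> complex) set" where
  "test_functions = {\<phi>. smooth \<phi> \<and> compact (closure {x. \<phi> x \<noteq> 0})}"

definition has_weak_partials ::
    "'n::finite list \<Rightarrow> (real ^ 'n \<Rightarrow> complex) \<Rightarrow> (real ^ 'n \<Rightarrow> complex) \<Rightarrow> bool" where
  "has_weak_partials is u v \<longleftrightarrow>
     (\<forall>\<phi>\<in>test_functions. (LINT x|lborel. u x * partials is \<phi> x)
        = (- 1) ^ length is * (LINT x|lborel. v x * \<phi> x))"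

text \<open>The space \<open>H\<^sup>k(\<real>\<^sup>n)\<close>.\<close>

definition sobolev :: "nat \<Rightarrow> (real ^ 'n::finite \<Rightarrow> complex) set" where
  "sobolev k = {u \<in> L2. \<forall>is. length is \<le> k \<longrightarrow> (\<exists>v\<in>L2. has_weak_partials is u v)}"

text \<open>
  The weak derivative is determined only up to a null set; this picks a representative.
\<close>

definition weak_partials ::
    "'n::finite list \<Rightarrow> (real ^ 'n \<Rightarrow> complex) \<Rightarrow> real ^ 'n \<Rightarrow> complex" where
  "weak_partials is u = (SOME v. v \<in> L2 \<and> has_weak_partials is u v)"

definition laplacian :: "(real ^ 'n::finite \<Rightarrow> complex) \<Rightarrow> real ^ 'n \<Rightarrow> complex" where
  "laplacian u = (\<lambda>x. \<Sum>i\<in>UNIV. weak_partials [i, i] u x)"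

text \<open>
  An unbounded operator on \<open>L\<^sup>2(\<real>\<^sup>n)\<close> is given by its domain and its action there, both up to
  almost everywhere equality.
\<close>

type_synonym 'n L2_operator =
  "(real ^ 'n \<Rightarrow> complex) set \<times> ((real ^ 'n \<Rightarrow> complex) \<Rightarrow> (real ^ 'n \<Rightarrow> complex))"

definition point_spectrum :: "'n::finite L2_operator \<Rightarrow> complex set" where
  "point_spectrum T = {\<mu>. \<exists>u\<in>fst T. \<not> (AE x in lborel. u x = 0) \<and>
                               (AE x in lborel. snd T u x = \<mu> * u x)}"

definition scaled_domain :: "(real ^ 3) set \<Rightarrow> real \<Rightarrow> (real ^ 3) set" where
  "scaled_domain \<Omega> \<epsilon> = {\<epsilon> *\<^sub>R y |y. y \<in> \<Omega>}"

definition coeff_b :: "(real ^ 3) set \<Rightarrow> real \<Rightarrow> real ^ 3 \<Rightarrow> real" where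
  "coeff_b \<Omega> \<epsilon> x = \<epsilon>\<^sup>2 * indicator (scaled_domain \<Omega> \<epsilon>) x + indicator (- scaled_domain \<Omega> \<epsilon>) x"

definition H_op :: "(real ^ 3) set \<Rightarrow> real \<Rightarrow> 3 L2_operator" where
  "H_op \<Omega> \<epsilon> = (sobolev 2, \<lambda>u x. - (complex_of_real (coeff_b \<Omega> \<epsilon> x) * laplacian u x))"

end

theory Submission
  imports Defs "HOL-Complex_Analysis.Complex_Analysis"
begin

text \<open>
  Let \<open>-b \<Delta> u = \<mu> u\<close> with \<open>u \<in> H\<^sup>2\<close>. Pairing \<open>\<Delta> u = -\<mu> u / b\<close> with \<open>u\<close> shows that \<open>\<mu> = k\<^sup>2\<close> is a nonnegative real. Since
  \<open>b = 1\<close> outside a ball, \<open>f = -(\<Delta> + k\<^sup>2) u\<close> is compactly supported, and because \<open>u \<in> L\<^sup>2\<close> decays too fast to contain a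
  radiating part, \<open>u\<close> is the convolution of \<open>f\<close> with either of the fundamental solutions \<open>exp (\<plusminus>\<i>k|x|) / (4\<pi>|x|)\<close>. At
  \<open>y = \<omega>/s\<close> these convolutions are \<open>s exp (\<plusminus>\<i>k/s)\<close> times functions of \<open>s\<close> holomorphic near the origin, and the essential
  singularity of \<open>exp (2\<i>k/s)\<close> forces both to vanish (for \<open>k = 0\<close> already \<open>f = 0\<close>). Hence \<open>u\<close> has compact support.
  For such functions a Carleman estimate with the linear weight \<open>exp (\<tau> x\<^sub>k)\<close> bounds \<open>\<tau>\<close> times the weighted norm of \<open>u\<close> by
  that of \<open>\<Delta> u\<close>; as \<open>|\<Delta> u| \<le> C |u|\<close>, letting \<open>\<tau>\<close> grow gives \<open>u = 0\<close>, whatever the regularity of the boundary of \<open>\<Omega>\<close>.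
\<close>

text \<open>\<open>u\<close> solves the equation only in the sense of distributions, so every
  identity is obtained either for mollifications of \<open>u\<close> or by moving derivatives onto a
  test function. The fundamental solution is neither smooth nor compactly supported. Replacing
  \<open>|x|\<close> by \<open>sqrt (d^2 + |x|^2)\<close> makes it smooth with an explicit error
  \<open>eta\<close>, and a dilated cutoff gives compact support. Removing the cutoff is where
  \<open>u \<in> L2\<close> acts as a radiation condition of both signs: the error is controlled by
  \<open>|u| / rho^2\<close>, and \<open>1 / rho^2\<close> is square integrable on
  \<open>real ^ 3\<close>. The coefficient \<open>b\<close> jumps across a boundary that may be very
  rough, which excludes arguments based on regularity of the coefficient. The Laplacian conjugated
  with a linear weight has constant coefficients, so its parts commute for free, and
  \<open>b\<close> enters only through \<open>1 / b \<le> 1 / \<epsilon>^2\<close>. Such a weight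
  grows exponentially, so compact support has to be established beforehand; this is the task of
  Rellich's theorem.\<close>

no_notation fps_nth (infixl \<open>$\<close> 75)

section \<open>Smooth functions and test functions\<close>

lemma partial_eqI:
  assumes "(f has_derivative f') (at x)"
  shows "partial i f x = f' (axis i 1)"
  using frechet_derivative_at[OF assms] by (simp add: partial_def)

text \<open>Iterated derivatives never leave a class that is closed under \<open>partial\<close>.
  Exhibiting such a class therefore replaces the quantifier over index lists in
  \<open>smooth\<close>.\<close>

lemma smooth_coinduct:
  assumes "f \<in> S" and "\<And>f x. f \<in> S \<Longrightarrow> f differentiable (at x)"
    and "\<And>f i. f \<in> S \<Longrightarrow> partial i f \<in> S"
  shows "smooth f"
proof -
  have "partials is f \<in> S" for "is" by (induction "is") (auto intro: assms)
  then show ?thesis by (auto simp: smooth_def intro: assms)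
qed

lemma smooth_differentiable: "smooth f \<Longrightarrow> f differentiable (at x)"
  unfolding smooth_def by (metis partials.simps(1))

lemma partials_append: "partials (is @ js) f = partials is (partials js f)"
  by (induction "is") auto

lemma smooth_partials: "smooth f \<Longrightarrow> smooth (partials is f)"
  unfolding smooth_def by (metis partials_append)

lemma smooth_partial: "smooth f \<Longrightarrow> smooth (partial i f)"
  using smooth_partials[of f "[i]"] by simp

lemma has_derivative_partials:
  fixes f :: "real ^ 'n \<Rightarrow> complex"
  assumes "f differentiable (at x)"
  shows "(f has_derivative (\<lambda>v. \<Sum>i\<in>UNIV. of_real (v $ i) * partial i f x)) (at x)"
proof -
  have d: "(f has_derivative frechet_derivative f (at x)) (at x)"
    using assms frechet_derivative_works by blast
  interpret linear "frechet_derivative f (at x)"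
    using d by (rule has_derivative_linear)
  have "frechet_derivative f (at x) v = (\<Sum>i\<in>UNIV. of_real (v $ i) * partial i f x)" for v
  proof -
    have "v = (\<Sum>i\<in>UNIV. (v $ i) *\<^sub>R axis i 1)"
      by (simp add: vec_eq_iff axis_def if_distrib if_distribR cong: if_cong)
    then have "frechet_derivative f (at x) v = frechet_derivative f (at x) (\<Sum>i\<in>UNIV. (v $ i) *\<^sub>R axis i 1)"
      by simp
    also have "\<dots> = (\<Sum>i\<in>UNIV. of_real (v $ i) * partial i f x)"
      unfolding sum scale partial_def by (simp add: scaleR_conv_of_real)
    finally show ?thesis .
  qed
  then have "frechet_derivative f (at x) = (\<lambda>v. \<Sum>i\<in>UNIV. of_real (v $ i) * partial i f x)"
    by blast
  then show ?thesis using d by simp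
qed

lemmas smooth_has_derivative = has_derivative_partials[OF smooth_differentiable]

lemma smooth_continuous: "smooth f \<Longrightarrow> continuous_on S f"
  by (meson differentiable_imp_continuous_on differentiable_on_subset smooth_differentiable
      differentiable_at_imp_differentiable_on subset_UNIV)

lemma smooth_measurable [measurable_dest]: "smooth f \<Longrightarrow> f \<in> borel_measurable borel"
  by (simp add: borel_measurable_continuous_onI smooth_continuous)

section \<open>Smoothness of sums, products and affine substitutions\<close>

inductive_set algebra_gen :: "('a \<Rightarrow> complex) set \<Rightarrow> ('a \<Rightarrow> complex) set" for G where
  gen: "g \<in> G \<Longrightarrow> g \<in> algebra_gen G"
| const: "(\<lambda>x. c) \<in> algebra_gen G"
| add: "f \<in> algebra_gen G \<Longrightarrow> g \<in> algebra_gen G \<Longrightarrow> (\<lambda>x. f x + g x) \<in> algebra_gen G"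
| mult: "f \<in> algebra_gen G \<Longrightarrow> g \<in> algebra_gen G \<Longrightarrow> (\<lambda>x. f x * g x) \<in> algebra_gen G"

lemma partial_const [simp]: "partial i (\<lambda>x. c) = (\<lambda>x. 0)"
  by (rule ext) (rule partial_eqI[OF has_derivative_const])

lemma partial_add:
  assumes "f differentiable (at x)" "g differentiable (at x)"
  shows "partial i (\<lambda>x. f x + g x) x = partial i f x + partial i g x"
proof -
  have "(f has_derivative frechet_derivative f (at x)) (at x)"
    "(g has_derivative frechet_derivative g (at x)) (at x)"
    using assms frechet_derivative_works by blast+
  from partial_eqI[OF has_derivative_add[OF this]] show ?thesis
    by (simp add: partial_def)
qed

lemma partial_mult:
  assumes "f differentiable (at x)" "g differentiable (at x)"
  shows "partial i (\<lambda>x. f x * g x) x = f x * partial i g x + partial i f x * g x"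
proof -
  have "(f has_derivative frechet_derivative f (at x)) (at x)"
    "(g has_derivative frechet_derivative g (at x)) (at x)"
    using assms frechet_derivative_works by blast+
  from has_derivative_mult[OF this] show ?thesis
    unfolding partial_def by (simp add: partial_eqI[unfolded partial_def])
qed

text \<open>By the Leibniz rule, the algebra generated by \<open>G\<close> is closed under
  \<open>partial\<close> as soon as it contains the derivatives of the generators. Checking the
  generators is thus enough for \<open>smooth_coinduct\<close>.\<close>

lemma smooth_algebra_gen:
  fixes G :: "(real ^ 'n \<Rightarrow> complex) set"
  assumes d: "\<And>g x. g \<in> G \<Longrightarrow> g differentiable (at x)"
    and p: "\<And>g i. g \<in> G \<Longrightarrow> partial i g \<in> algebra_gen G"
    and f: "f \<in> algebra_gen G"
  shows "smooth f"
proof -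
  have *: "(\<forall>x. f differentiable (at x)) \<and> (\<forall>i. partial i f \<in> algebra_gen G)"
    if "f \<in> algebra_gen G" for f
    using that
  proof induction
    case (add f g)
    then have "partial i (\<lambda>x. f x + g x) = (\<lambda>x. partial i f x + partial i g x)" for i
      by (auto simp: partial_add)
    with add show ?case by (auto intro: algebra_gen.add)
  next
    case (mult f g)
    then have "partial i (\<lambda>x. f x * g x) = (\<lambda>x. f x * partial i g x + partial i f x * g x)" for i
      by (auto simp: partial_mult)
    with mult show ?case by (auto intro!: algebra_gen.add algebra_gen.mult)
  qed (auto intro: algebra_gen.intros d p)
  show ?thesis
    by (rule smooth_coinduct[of f "algebra_gen G"]) (use * f in auto)
qed

lemma smooth_const [simp, intro]: "smooth (\<lambda>x. c)"
  by (rule smooth_algebra_gen[of "{}"]) (auto intro: algebra_gen.intros)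

lemma smooth_algebra_gen_smooth:
  fixes f :: "real ^ 'n \<Rightarrow> complex"
  assumes "f \<in> algebra_gen {f. smooth f}"
  shows "smooth f"
  by (rule smooth_algebra_gen[OF _ _ assms])
     (auto simp: smooth_differentiable intro: algebra_gen.gen smooth_partial)

lemma smooth_add [intro]: "smooth f \<Longrightarrow> smooth g \<Longrightarrow> smooth (\<lambda>x. f x + g x)"
  by (rule smooth_algebra_gen_smooth) (auto intro!: algebra_gen.add intro: algebra_gen.gen)

lemma smooth_mult [intro]: "smooth f \<Longrightarrow> smooth g \<Longrightarrow> smooth (\<lambda>x. f x * g x)"
  by (rule smooth_algebra_gen_smooth) (auto intro!: algebra_gen.mult intro: algebra_gen.gen)

lemma smooth_prod [intro]:
  "finite A \<Longrightarrow> (\<And>a. a \<in> A \<Longrightarrow> smooth (f a)) \<Longrightarrow> smooth (\<lambda>x. \<Prod>a\<in>A. f a x)"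
  by (induction A rule: finite_induct) auto

lemma partial_affine:
  fixes f :: "real ^ 'n \<Rightarrow> complex"
  assumes "f differentiable (at (c *\<^sub>R x + d))"
  shows "partial i (\<lambda>x. f (c *\<^sub>R x + d)) x = of_real c * partial i f (c *\<^sub>R x + d)"
    and "(\<lambda>x. f (c *\<^sub>R x + d)) differentiable (at x)"
proof -
  let ?D = "frechet_derivative f (at (c *\<^sub>R x + d))"
  have d: "(f has_derivative ?D) (at (c *\<^sub>R x + d))"
    using assms frechet_derivative_works by blast
  interpret linear "?D" using d by (rule has_derivative_linear)
  have "((\<lambda>x. f (c *\<^sub>R x + d)) has_derivative (\<lambda>v. ?D (c *\<^sub>R v))) (at x)"
    by (rule has_derivative_compose[where g=f and f="\<lambda>x. c *\<^sub>R x + d" and g'="?D", OF _ d]) (auto intro!: derivative_eq_intros)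
  note d' = this
  then show "(\<lambda>x. f (c *\<^sub>R x + d)) differentiable (at x)"
    by (rule differentiableI)
  show "partial i (\<lambda>x. f (c *\<^sub>R x + d)) x = of_real c * partial i f (c *\<^sub>R x + d)"
    unfolding partial_eqI[OF d'] scale unfolding partial_def by (rule scaleR_conv_of_real)
qed

lemma partial_cmult: 
  "f differentiable (at x) \<Longrightarrow> partial i (\<lambda>x. c * f x) x = c * partial i f x"
  using partial_mult[of "\<lambda>_. c" x f i] by simp

lemma smooth_affine:
  fixes f :: "real ^ 'n \<Rightarrow> complex" and d :: "real ^ 'n"
  assumes "smooth f"
  shows "smooth (\<lambda>x. f (c *\<^sub>R x + d))"
proof -
  \<comment> \<open>The scalar \<open>a\<close> collects the powers of \<open>c\<close> produced by
    the chain rule.\<close>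
  let ?S = "{\<lambda>x. a * g (c *\<^sub>R x + d) |a (g :: real ^ 'n \<Rightarrow> complex). smooth g}"
  show ?thesis
  proof (rule smooth_coinduct[of _ ?S])
    show "(\<lambda>x. f (c *\<^sub>R x + d)) \<in> ?S" using assms by (intro CollectI exI[of _ 1] exI[of _ f]) auto
    fix h assume "h \<in> ?S"
    then obtain a and g :: "real ^ 'n \<Rightarrow> complex" where h: "h = (\<lambda>x. a * g (c *\<^sub>R x + d))" "smooth g"
      by auto
    note D = partial_affine[OF smooth_differentiable[OF h(2)], where c=c and d=d]
    show "h differentiable (at x)" for x
      unfolding h(1) by (rule differentiable_mult[OF differentiable_const D(2)])
    have "partial i h x = a * of_real c * partial i g (c *\<^sub>R x + d)" for i x
      unfolding h(1) partial_cmult[OF D(2)] D(1) by simp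
    then show "partial i h \<in> ?S" for i
      using smooth_partial[OF h(2)] by (intro CollectI exI[of _ "a * of_real c"] exI[of _ "partial i g"]) auto
  qed
qed

lemma has_derivative_component:
  "((\<lambda>x. complex_of_real (x $ i)) has_derivative (\<lambda>v. of_real (v $ i))) (at x)"
  by (intro bounded_linear.has_derivative[OF bounded_linear_of_real]
      bounded_linear.has_derivative[OF bounded_linear_vec_nth] has_derivative_ident)

lemma smooth_component:
  fixes i :: "'n::finite"
  shows "smooth (\<lambda>x. of_real (x $ i))"
proof -
  have d: "((\<lambda>x. complex_of_real (x $ i)) has_derivative (\<lambda>x. of_real (x $ i))) (at x)" for x :: "real ^ 'n"
    by (rule has_derivative_component)
  have "partial j (\<lambda>x. complex_of_real (x $ i)) = (\<lambda>x. of_real (axis j 1 $ i))" for j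
    by (rule ext) (rule partial_eqI[OF d])
  then show ?thesis
    by (intro smooth_algebra_gen[of "{\<lambda>x. of_real (x $ i)}"])
       (use d in \<open>auto simp: differentiable_def intro: algebra_gen.intros\<close>)
qed

lemma partial_component: "partial j (\<lambda>x. complex_of_real (x $ i)) x = of_real (if i = j then 1 else 0)"
  by (subst partial_eqI[OF has_derivative_component]) (simp add: axis_def)

lemma smooth_cnj:
  assumes "smooth f" shows "smooth (\<lambda>x. cnj (f x))"
    and "partial i (\<lambda>x. cnj (f x)) x = cnj (partial i f x)"
proof -
  have d: "((\<lambda>x. cnj (g x)) has_derivative (\<lambda>v. cnj (frechet_derivative g (at x) v))) (at x)"
    if "smooth g" for x g
    by (rule bounded_linear.has_derivative[OF bounded_linear_cnj])
       (use that smooth_differentiable frechet_derivative_works in blast)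
  have p: "partial i (\<lambda>x. cnj (g x)) x = cnj (partial i g x)" if "smooth g" for g i x
    using partial_eqI[OF d[OF that]] by (simp add: partial_def)
  show "partial i (\<lambda>x. cnj (f x)) x = cnj (partial i f x)" using p assms by blast
  have "partial i (\<lambda>x. cnj (g x)) = (\<lambda>x. cnj (partial i g x))" if "smooth g" for g i
    using p[OF that] by auto
  then show "smooth (\<lambda>x. cnj (f x))"
    by (intro smooth_coinduct[of _ "{\<lambda>x. cnj (f x) |f. smooth f}"])
       (use assms d smooth_partial in \<open>auto simp: differentiable_def\<close>, blast+)
qed

text \<open>The family \<open>h\<close> is infinite, but each derivative combines finitely many
  members, so the generated algebra is stable under \<open>partial\<close>. The affine argument
  allows the edges of a bump to be placed.\<close>

lemma smooth_one_dim:
  fixes h :: "nat \<Rightarrow> real \<Rightarrow> real" and i :: "'n::finite"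
  assumes d: "\<And>j t. (h j has_real_derivative a j * h j t + b j * h (p j) t + c j * h (q j) t) (at t)"
  shows "smooth (\<lambda>x. of_real (h j (r * x $ i + s)) :: complex)"
proof -
  let ?G = "{\<lambda>x::real^'n. complex_of_real (h j (r * x $ i + s)) |j. True}"
  let ?D = "\<lambda>j t. a j * h j t + b j * h (p j) t + c j * h (q j) t"
  have D: "((\<lambda>x. complex_of_real (h j (r * x $ i + s))) has_derivative
     (\<lambda>v. of_real (r * v $ i * ?D j (r * x $ i + s)))) (at x)" for j and x :: "real ^ 'n"
  proof (rule bounded_linear.has_derivative[OF bounded_linear_of_real])
    have "((\<lambda>x. r * x $ i + s) has_derivative (\<lambda>v. r * v $ i)) (at x)"
      by (auto intro!: derivative_eq_intros bounded_linear_imp_has_derivative bounded_linear_vec_nth)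
    from has_derivative_compose[OF this d[unfolded has_field_derivative_def]]
    show "((\<lambda>x. h j (r * x $ i + s)) has_derivative (\<lambda>v. r * v $ i * ?D j (r * x $ i + s))) (at x)"
      by (simp add: mult.commute)
  qed
  have "partial k (\<lambda>x. complex_of_real (h j (r * x $ i + s))) =
     (\<lambda>x. of_real (r * axis k 1 $ i) * (of_real (a j) * of_real (h j (r * x $ i + s))
      + of_real (b j) * of_real (h (p j) (r * x $ i + s)) + of_real (c j) * of_real (h (q j) (r * x $ i + s))))" for j k
    by (rule ext, subst partial_eqI[OF D]) (simp only: of_real_mult of_real_add)
  note eq = this
  have g: "(\<lambda>x. complex_of_real (h j (r * x $ i + s))) \<in> algebra_gen ?G" for j
    by (rule algebra_gen.gen) blast
  have "partial k (\<lambda>x. complex_of_real (h j (r * x $ i + s))) \<in> algebra_gen ?G" for j k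
    unfolding eq by (intro g algebra_gen.const algebra_gen.mult algebra_gen.add)
  moreover have "(\<lambda>x. complex_of_real (h j (r * x $ i + s))) differentiable (at x)" for j and x :: "real ^ 'n"
    using D by (rule differentiableI)
  ultimately show ?thesis
    by (intro smooth_algebra_gen[of ?G]) (blast intro: g)+
qed

text \<open>The classical flat function \<open>exp (- 1 / t)\<close>, multiplied by powers of
  \<open>1 / t\<close> to make the family stable under differentiation.\<close>

definition flat_exp :: "nat \<Rightarrow> real \<Rightarrow> real" where
  "flat_exp j t = (if t > 0 then exp (- inverse t) * inverse t ^ j else 0)"

text \<open>A single term of the exponential series gives
  \<open>x ^ (j + 2) \<le> fact (j + 2) * exp x\<close> at \<open>x = 1 / t\<close>. The two extra
  powers become \<open>t^2\<close>, which makes the difference quotient at 0 vanish in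
  \<open>flat_exp_deriv\<close>.\<close>

lemma flat_exp_bound:
  assumes "t > 0" shows "flat_exp j t \<le> fact (j + 2) * t\<^sup>2"
proof -
  have e: "inverse t ^ n / fact n \<le> exp (inverse t)" for n
  proof -
    have "(\<Sum>k\<in>{n}. inverse t ^ k / fact k) \<le> (\<Sum>k. inverse t ^ k / fact k)"
      using assms by (intro sum_le_suminf) (use summable_exp_generic[of "inverse t"] in \<open>auto simp: divide_inverse mult.commute\<close>)
    then show ?thesis by (simp add: exp_def divide_inverse mult.commute)
  qed
  have "exp (- inverse t) * inverse t ^ (j + 2) \<le> fact (j + 2)"
  proof -
    have "inverse t ^ (j + 2) \<le> exp (inverse t) * fact (j + 2)"
      using e[of "j + 2"] by (subst (asm) pos_divide_le_eq) auto
    then have "exp (- inverse t) * inverse t ^ (j + 2) \<le> exp (- inverse t) * (exp (inverse t) * fact (j + 2))"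
      by (intro mult_left_mono) auto
    also have "\<dots> = fact (j + 2)" by (simp add: exp_minus)
    finally show ?thesis .
  qed
  then have "exp (- inverse t) * inverse t ^ (j + 2) * t\<^sup>2 \<le> fact (j + 2) * t\<^sup>2"
    by (intro mult_right_mono) auto
  moreover have "inverse t ^ (j + 2) * t\<^sup>2 = inverse t ^ j"
    using assms by (simp add: power_add field_simps power2_eq_square)
  ultimately show ?thesis using assms
    by (simp only: flat_exp_def if_True mult.assoc)
qed

lemma flat_exp_nonneg: "0 \<le> flat_exp j t"
  by (simp add: flat_exp_def)

lemma flat_exp_deriv:
  "(flat_exp j has_real_derivative 0 * flat_exp j t + (- real j) * flat_exp (j + 1) t + 1 * flat_exp (j + 2) t) (at t)"
proof -
  consider "t > 0" | "t < 0" | "t = 0" by linarith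
  then show ?thesis
  proof cases
    case 1
    have "((\<lambda>t. exp (- inverse t) * inverse t ^ j) has_real_derivative
        exp (- inverse t) * (real j * (- (inverse t * 1 * inverse t)) * inverse t ^ (j - 1))
          + exp (- inverse t) * (inverse t * inverse t) * inverse t ^ j) (at t)"
      using 1 by (auto intro!: derivative_eq_intros simp: algebra_simps)
    also have "exp (- inverse t) * (real j * (- (inverse t * 1 * inverse t)) * inverse t ^ (j - 1))
          + exp (- inverse t) * (inverse t * inverse t) * inverse t ^ j
        = 0 * flat_exp j t + (- real j) * flat_exp (j + 1) t + 1 * flat_exp (j + 2) t"
      using 1 by (cases j) (auto simp: flat_exp_def algebra_simps)
    finally show ?thesis
      by (rule has_field_derivative_transform_within_open[of _ _ _ "{0<..}"])
         (use 1 in \<open>auto simp: flat_exp_def\<close>)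
  next
    case 2
    have "((\<lambda>t. 0) has_real_derivative 0) (at t)" by simp
    then have "(flat_exp j has_real_derivative 0) (at t)"
      by (rule has_field_derivative_transform_within_open[of _ _ _ "{..<0}"])
         (use 2 in \<open>auto simp: flat_exp_def\<close>)
    with 2 show ?thesis by (simp add: flat_exp_def)
  next
    case 3
    have "(\<lambda>h. (flat_exp j h - flat_exp j 0) / h) \<midarrow>0\<rightarrow> 0"
    proof (rule Lim_null_comparison)
      have "norm ((flat_exp j h - flat_exp j 0) / h) \<le> fact (j + 2) * \<bar>h\<bar>" for h
      proof (cases "h > 0")
        case True
        then have "flat_exp j h / h \<le> fact (j + 2) * h"
          using flat_exp_bound[of h j] by (simp only: pos_divide_le_eq power2_eq_square mult.assoc)
        moreover have "flat_exp j 0 = 0" by (simp add: flat_exp_def)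
        ultimately show ?thesis using True flat_exp_nonneg[of j h] by simp
      next
        case False
        moreover have "0 \<le> fact (j + 2) * \<bar>h\<bar>" by simp
        ultimately show ?thesis by (simp only: flat_exp_def if_False) simp
      qed
      then show "\<forall>\<^sub>F h in at 0. norm ((flat_exp j h - flat_exp j 0) / h) \<le> fact (j + 2) * \<bar>h\<bar>"
        by simp
    qed (auto intro!: tendsto_eq_intros)
    then show ?thesis
      by (simp add: 3 DERIV_def flat_exp_def)
  qed
qed

lemma smooth_flat_exp: "smooth (\<lambda>x. of_real (flat_exp j (r * x $ i + s)))"
  by (rule smooth_one_dim[OF flat_exp_deriv])

section \<open>Test functions and a bump function\<close>

lemma test_functions_mult:
  assumes "f \<in> test_functions" "smooth g"
  shows "(\<lambda>x. f x * g x) \<in> test_functions"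
proof -
  have "bounded {x. f x \<noteq> 0}"
    using assms by (auto simp: test_functions_def compact_closure)
  then have "bounded {x. f x * g x \<noteq> 0}" by (rule bounded_subset) auto
  then show ?thesis using assms
    by (auto simp: test_functions_def compact_closure)
qed

lemma test_functionsI:
  fixes f :: "real ^ 'n \<Rightarrow> complex"
  assumes "smooth f" "\<And>x. norm x > R \<Longrightarrow> f x = 0"
  shows "f \<in> test_functions"
proof -
  have "{x. f x \<noteq> 0} \<subseteq> cball 0 R" using assms(2) by (auto simp: not_less[symmetric])
  then have "bounded {x. f x \<noteq> 0}" by (rule bounded_subset[OF bounded_cball])
  then show ?thesis using assms(1) by (simp add: test_functions_def compact_closure)
qed

lemma test_functions_smooth: "f \<in> test_functions \<Longrightarrow> smooth f"
  by (simp add: test_functions_def)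

lemma test_functions_support:
  assumes "f \<in> test_functions"
  obtains R where "R > 0" "\<And>x. norm x \<ge> R \<Longrightarrow> f x = 0"
proof -
  have "bounded {x. f x \<noteq> 0}"
    using assms by (auto simp: test_functions_def compact_closure)
  then obtain B where "B > 0" "\<And>x. f x \<noteq> 0 \<Longrightarrow> norm x \<le> B" by (auto simp: bounded_pos)
  then show thesis by (intro that[of "B + 1"]) force+
qed

lemma partial_eq_0:
  assumes "open U" "x \<in> U" "\<And>y. y \<in> U \<Longrightarrow> f y = 0"
  shows "partial i f x = 0"
proof -
  have "(f has_derivative (\<lambda>v. 0)) (at x)"
    by (rule has_derivative_transform_within_open[OF has_derivative_const assms(1,2)]) (use assms(3) in auto)
  then show ?thesis by (rule partial_eqI)
qed

lemma partial_eq_0_norm: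
  assumes "\<And>x. norm x > R \<Longrightarrow> f x = 0" "norm x > R"
  shows "partial i f x = 0"
  by (rule partial_eq_0[of "{x. norm x > R}"]) (use assms in \<open>auto intro!: open_Collect_less continuous_intros\<close>)

lemma test_functions_partial:
  assumes "f \<in> test_functions" shows "partial i f \<in> test_functions"
proof -
  obtain R where R: "R > 0" "\<And>x. norm x \<ge> R \<Longrightarrow> f x = 0" using test_functions_support[OF assms] by blast
  have "partial i f x = 0" if "norm x > R" for x
    by (rule partial_eq_0_norm[OF _ that]) (simp add: R)
  then show ?thesis
    by (rule test_functionsI[OF smooth_partial[OF test_functions_smooth[OF assms]]])
qed

lemma test_functions_affine:
  fixes f :: "real ^ 'n \<Rightarrow> complex"
  assumes "f \<in> test_functions" "c \<noteq> 0"
  shows "(\<lambda>x. f (c *\<^sub>R x + d)) \<in> test_functions"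
proof -
  obtain R where R: "R > 0" "\<And>x. norm x \<ge> R \<Longrightarrow> f x = 0" using test_functions_support[OF assms(1)] by blast
  show ?thesis
  proof (rule test_functionsI[of _ "(R + norm d) / \<bar>c\<bar>"])
    show "smooth (\<lambda>x. f (c *\<^sub>R x + d))" by (rule smooth_affine[OF test_functions_smooth[OF assms(1)]])
    fix x :: "real ^ 'n" assume "(R + norm d) / \<bar>c\<bar> < norm x"
    then have "R + norm d < norm (c *\<^sub>R x)" using assms(2) by (simp add: field_simps)
    then have "norm (c *\<^sub>R x + d) \<ge> R" using norm_diff_ineq[of "c *\<^sub>R x" d] by linarith
    then show "f (c *\<^sub>R x + d) = 0" by (rule R)
  qed
qed

lemma test_functions_bounded:
  assumes "f \<in> test_functions"
  obtains M where "M > 0" "\<And>x. norm (f x) \<le> M"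
proof -
  obtain R where R: "R > 0" "\<And>x. norm x \<ge> R \<Longrightarrow> f x = 0" using test_functions_support[OF assms(1)] by blast
  have "compact (f ` cball 0 R)"
    using assms by (intro compact_continuous_image smooth_continuous test_functions_smooth) auto
  then obtain M where M: "M > 0" "\<And>x. x \<in> cball 0 R \<Longrightarrow> norm (f x) \<le> M"
    by (auto dest!: compact_imp_bounded simp: bounded_pos)
  have "norm (f x) \<le> M" for x
    using M(2)[of x] R(2)[of x] M(1) by (cases "norm x \<le> R") auto
  with M(1) show thesis using that by blast
qed

lemma integrable_bounded_support:
  fixes f :: "'a::euclidean_space \<Rightarrow> 'b::{banach, second_countable_topology}"
  assumes [measurable]: "f \<in> borel_measurable borel"
    and "\<And>x. norm (f x) \<le> M" "\<And>x. norm x \<ge> R \<Longrightarrow> f x = 0"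
  shows "integrable lborel f"
proof (rule Bochner_Integration.integrable_bound[of _ "\<lambda>x. M * indicator (cball 0 R) x"])
  show "integrable lborel (\<lambda>x::'a. M * indicator (cball 0 R) x)"
    by (intro integrable_mult_right integrable_real_indicator emeasure_compact_finite) auto
  have "0 \<le> M" using assms(2)[of 0] norm_ge_zero order_trans by blast
  show "AE x in lborel. norm (f x) \<le> norm (M * indicator (cball 0 R) x :: real)"
  proof (rule AE_I2)
    fix x show "norm (f x) \<le> norm (M * indicator (cball 0 R) x :: real)"
      using assms(2)[of x] assms(3)[of x] \<open>0 \<le> M\<close> by (cases "norm x \<le> R") auto
  qed
qed simp

lemma test_functions_integrable: "f \<in> test_functions \<Longrightarrow> integrable lborel f"
proof -
  assume f: "f \<in> test_functions"
  obtain M where M: "\<And>x. norm (f x) \<le> M" using test_functions_bounded[OF f] by blast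
  obtain R where R: "\<And>x. norm x \<ge> R \<Longrightarrow> f x = 0" using test_functions_support[OF f] by blast
  show ?thesis
    by (rule integrable_bounded_support[OF smooth_measurable[OF test_functions_smooth[OF f]] M R])
qed

text \<open>A product of one-dimensional bumps in the coordinates, so that only
  \<open>flat_exp\<close> has to be differentiated. With \<open>N\<close> the dimension, the cube
  where all \<open>|x $ i| < 1 / N\<close> lies in the unit ball by comparison with the l1
  norm.\<close>

lemma exists_mollifier:
  obtains r :: "real ^ 'n \<Rightarrow> real"
  where "(\<lambda>x. complex_of_real (r x)) \<in> test_functions" "\<And>x. r x \<ge> 0" "\<And>x. norm x \<ge> 1 \<Longrightarrow> r x = 0"
    "r 0 > 0" "(LINT x|lborel. r x) = 1" "continuous_on UNIV r" "integrable lborel r"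
proof -
  define N where "N = real CARD('n)"
  have N: "N \<ge> 1" unfolding N_def by (simp add: Suc_leI)
  define b :: "real ^ 'n \<Rightarrow> real" where
    "b x = (\<Prod>i\<in>UNIV. flat_exp 0 (N * x $ i + 1) * flat_exp 0 ((-N) * x $ i + 1))" for x
  have sm: "smooth (\<lambda>x. complex_of_real (b x))"
    unfolding b_def of_real_prod of_real_mult by (intro smooth_prod smooth_mult smooth_flat_exp) auto
  have nn: "b x \<ge> 0" for x unfolding b_def by (intro prod_nonneg mult_nonneg_nonneg flat_exp_nonneg)
  have supp: "b x = 0" if "norm x \<ge> 1" for x
  proof -
    have "\<exists>i. \<bar>x $ i\<bar> \<ge> 1 / N"
    proof (rule ccontr)
      assume "\<not> ?thesis"
      then have "\<bar>x $ i\<bar> < 1 / N" for i by (simp add: not_le)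
      then have "(\<Sum>i\<in>UNIV. \<bar>x $ i\<bar>) < (\<Sum>i\<in>(UNIV::'n set). 1 / N)" by (intro sum_strict_mono) auto
      with norm_le_l1_cart[of x] that show False using N by (simp add: N_def)
    qed
    then obtain i where "\<bar>x $ i\<bar> \<ge> 1 / N" by blast
    then have "N * x $ i + 1 \<le> 0 \<or> (-N) * x $ i + 1 \<le> 0" using N by (auto simp: field_simps abs_if split: if_splits)
    then have "flat_exp 0 (N * x $ i + 1) * flat_exp 0 ((-N) * x $ i + 1) = 0"
      by (auto simp: flat_exp_def)
    then show ?thesis unfolding b_def by (intro prod_zero bexI[of _ i]) auto
  qed
  have tf: "(\<lambda>x. complex_of_real (b x)) \<in> test_functions"
    by (rule test_functionsI[OF sm, of 1]) (use supp in auto)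
  have cont: "continuous_on UNIV b"
  proof -
    have "continuous_on UNIV (\<lambda>x. Re (complex_of_real (b x)))"
      by (rule continuous_on_Re[OF smooth_continuous[OF sm]])
    then show ?thesis by simp
  qed
  have int: "integrable lborel b"
  proof -
    have "integrable lborel (\<lambda>x. Re (complex_of_real (b x)))"
      by (rule integrable_Re[OF test_functions_integrable[OF tf]])
    then show ?thesis by simp
  qed
  have b0: "b 0 > 0" unfolding b_def by (intro prod_pos) (auto simp: flat_exp_def)
  have pos: "(LINT x|lborel. b x) > 0"
  proof -
    have "(LINT x|lborel. b x) \<noteq> 0"
    proof
      assume "(LINT x|lborel. b x) = 0"
      then have ae: "AE x in lborel. b x = 0" using integral_nonneg_eq_0_iff_AE[OF int] nn by auto
      have op: "open {x. b x > 0}" by (intro open_Collect_less cont continuous_intros)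
      have "AE x in lborel. x \<notin> {x. b x > 0}" using ae by eventually_elim auto
      then have "{x. b x > 0} \<in> null_sets lborel" using op by (subst AE_iff_null_sets) auto
      then have "negligible {x. b x > 0}" by (simp add: negligible_iff_null_sets null_sets_completionI)
      with op b0 show False using open_not_negligible by blast
    qed
    moreover have "(LINT x|lborel. b x) \<ge> 0" using nn by (intro integral_nonneg_AE) auto
    ultimately show ?thesis by simp
  qed
  define c where "c = inverse (LINT x|lborel. b x)"
  have "c > 0" using pos by (simp add: c_def)
  show thesis
  proof (rule that[of "\<lambda>x. b x * c"])
    show "(\<lambda>x. complex_of_real (b x * c)) \<in> test_functions"
      unfolding of_real_mult by (rule test_functions_mult[OF tf]) auto
    show "(LINT x|lborel. b x * c) = 1" using pos int by (simp add: c_def)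
    show "continuous_on UNIV (\<lambda>x. b x * c)" by (intro continuous_intros cont)
    show "0 \<le> b x * c" for x using nn \<open>c > 0\<close> by simp
    show "b x * c = 0" if "norm x \<ge> 1" for x using supp[OF that] by simp
    show "0 < b 0 * c" using b0 \<open>c > 0\<close> by simp
    show "integrable lborel (\<lambda>x. b x * c)" using int by simp
  qed
qed

section \<open>Integration on Euclidean space\<close>

lemma nn_integral_affine:
  fixes t :: "'a::euclidean_space"
  assumes [measurable]: "f \<in> borel_measurable borel" and c: "c \<noteq> 0"
  shows "(\<integral>\<^sup>+x. f x \<partial>lborel) = \<bar>c\<bar> ^ DIM('a) * (\<integral>\<^sup>+x. f (t + c *\<^sub>R x) \<partial>lborel)"
  by (subst lborel_affine[OF c, of t])
     (simp add: nn_integral_density nn_integral_distr nn_integral_cmult ennreal_power)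

lemma integrable_affine:
  fixes f :: "'a::euclidean_space \<Rightarrow> 'b::{banach, second_countable_topology}"
  assumes f: "integrable lborel f" and c: "c \<noteq> 0"
  shows "integrable lborel (\<lambda>x. f (t + c *\<^sub>R x))"
  using f f[THEN borel_measurable_integrable] c unfolding integrable_iff_bounded
  by (subst (asm) nn_integral_affine[where c=c and t=t]) (auto simp: ennreal_mult_less_top)

lemma integral_affine:
  fixes f :: "'a::euclidean_space \<Rightarrow> 'b::{banach, second_countable_topology}"
  assumes c: "c \<noteq> 0" and f: "integrable lborel f"
  shows "(LINT x|lborel. f x) = \<bar>c\<bar> ^ DIM('a) *\<^sub>R (LINT x|lborel. f (t + c *\<^sub>R x))"
proof -
  note [measurable] = borel_measurable_integrable[OF f]
  show ?thesis
    using c f integrable_affine[OF f c, of t]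
    by (subst lborel_affine[OF c, of t]) (simp add: integral_density integral_distr)
qed

lemma integrable_translate:
  fixes f :: "'a::euclidean_space \<Rightarrow> 'b::{banach, second_countable_topology}"
  assumes "integrable lborel f"
  shows "integrable lborel (\<lambda>x. f (x + a))" "integrable lborel (\<lambda>x. f (a - x))"
  using integrable_affine[OF assms, of 1 a] integrable_affine[OF assms, of "-1" a]
  by (simp_all add: add.commute)

lemma integral_translate:
  fixes f :: "'a::euclidean_space \<Rightarrow> 'b::{banach, second_countable_topology}"
  assumes "integrable lborel f"
  shows "(LINT x|lborel. f (x + a)) = (LINT x|lborel. f x)" "(LINT x|lborel. f (a - x)) = (LINT x|lborel. f x)"
  using integral_affine[OF _ assms, of 1 a] integral_affine[OF _ assms, of "-1" a]
  by (simp_all add: add.commute)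

text \<open>The mean of \<open>F (x + e) - F x\<close> vanishes by translation invariance, and by Fubini it equals the mean of the
  derivative.\<close>

lemma integral_directional_derivative_eq_0:
  fixes F :: "'a::euclidean_space \<Rightarrow> 'b::euclidean_space"
  assumes d: "\<And>x. (F has_derivative D x) (at x)" and c: "continuous_on UNIV (\<lambda>x. D x e)"
    and F: "integrable lborel F" and G: "integrable lborel (\<lambda>x. D x e)"
  shows "(LINT x|lborel. D x e) = 0"
proof -
  define G where "G x = D x e" for x
  have [measurable]: "G \<in> borel_measurable borel"
    using c unfolding G_def by (rule borel_measurable_continuous_onI)
  have int: "integrable lborel G" using G by (simp add: G_def[abs_def])
  have ftc: "(LINT s|lborel. indicator {0..1} s *\<^sub>R G (x + s *\<^sub>R e)) = F (x + e) - F x" for x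
  proof -
    have "(LINT s|lborel. indicator {0..1} s *\<^sub>R G (x + s *\<^sub>R e)) = F (x + 1 *\<^sub>R e) - F (x + 0 *\<^sub>R e)"
    proof (rule integral_FTC_atLeastAtMost)
      fix s :: real
      have "((\<lambda>s. F (x + s *\<^sub>R e)) has_derivative (\<lambda>h. D (x + s *\<^sub>R e) (h *\<^sub>R e))) (at s within {0..1})"
        by (rule has_derivative_compose[where f="\<lambda>s. x + s *\<^sub>R e" and g=F and g'="D (x + s *\<^sub>R e)", OF _ d]) (auto intro!: derivative_eq_intros)
      moreover have "D (x + s *\<^sub>R e) (h *\<^sub>R e) = h *\<^sub>R D (x + s *\<^sub>R e) e" for h
        using d[of "x + s *\<^sub>R e"] by (meson has_derivative_linear linear_scale)
      ultimately show "((\<lambda>s. F (x + s *\<^sub>R e)) has_vector_derivative G (x + s *\<^sub>R e)) (at s within {0..1})"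
        by (simp add: has_vector_derivative_def G_def)
    next
      show "continuous_on {0..1} (\<lambda>s. G (x + s *\<^sub>R e))" unfolding G_def
        by (rule continuous_on_compose2[OF c]) (auto intro!: continuous_intros)
    qed simp
    then show ?thesis by simp
  qed
  have I: "integrable (lborel \<Otimes>\<^sub>M lborel) (\<lambda>(s, x). indicator {0..1::real} s *\<^sub>R G (x + s *\<^sub>R e))"
  proof (rule lborel_pair.Fubini_integrable)
    show "(\<lambda>(s, x). indicator {0..1::real} s *\<^sub>R G (x + s *\<^sub>R e)) \<in> borel_measurable (lborel \<Otimes>\<^sub>M lborel)"
      by measurable
    have "(LINT x|lborel. norm (case (s, x) of (s, x) \<Rightarrow> indicator {0..1::real} s *\<^sub>R G (x + s *\<^sub>R e)))
        = indicator {0..1} s *\<^sub>R (LINT x|lborel. norm (G x))" for s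
      using integral_translate(1)[OF integrable_norm[OF int], of "s *\<^sub>R e"] by simp
    then show "integrable lborel (\<lambda>s. LINT x|lborel. norm (case (s, x) of (s, x) \<Rightarrow> indicator {0..1::real} s *\<^sub>R G (x + s *\<^sub>R e)))"
      by (simp only:) (auto intro!: integrable_scaleR_left integrable_real_indicator)
    show "AE s in lborel. integrable lborel (\<lambda>x. case (s, x) of (s, x) \<Rightarrow> indicator {0..1::real} s *\<^sub>R G (x + s *\<^sub>R e))"
      using integrable_translate(1)[OF int] by auto
  qed
  have "(LINT x|lborel. G x) = (LINT s|lborel. indicator {0..1::real} s *\<^sub>R (LINT x|lborel. G x))"
    by simp
  also have "\<dots> = (LINT s|lborel. LINT x|lborel. indicator {0..1::real} s *\<^sub>R G (x + s *\<^sub>R e))"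
    using integral_translate(1)[OF int] by simp
  also have "\<dots> = (LINT x|lborel. LINT s|lborel. indicator {0..1::real} s *\<^sub>R G (x + s *\<^sub>R e))"
    using lborel_pair.Fubini_integral[OF I] by simp
  also have "\<dots> = (LINT x|lborel. F (x + e) - F x)" by (simp add: ftc)
  also have "\<dots> = 0" using F integrable_translate(1)[OF F, of e] integral_translate(1)[OF F, of e] by simp
  finally show ?thesis by (simp add: G_def)
qed

text \<open>Integrability takes the place of compact support, so that the lemma applies to products
  of mollified L2 functions in the energy identity.\<close>

lemma integral_partial_eq_0:
  assumes "smooth F" "integrable lborel F" "integrable lborel (partial i F)"
  shows "(LINT x|lborel. partial i F x) = 0"
proof -
  have e: "(\<Sum>j\<in>UNIV. complex_of_real (axis i 1 $ j) * partial j F x) = partial i F x" for x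
  proof -
    have "(\<Sum>j\<in>UNIV. complex_of_real (axis i 1 $ j) * partial j F x) = (\<Sum>j\<in>UNIV. if j = i then partial j F x else 0)"
      by (rule sum.cong) (auto simp: axis_def)
    then show ?thesis by simp
  qed
  show ?thesis
    using integral_directional_derivative_eq_0[OF smooth_has_derivative[OF assms(1)], of "axis i 1"]
      assms smooth_continuous[OF smooth_partial[OF assms(1)], of UNIV i]
    by (simp add: e)
qed

lemma integral_partial_test:
  assumes "F \<in> test_functions" shows "(LINT x|lborel. partial i F x) = 0"
  using assms by (intro integral_partial_eq_0 test_functions_smooth test_functions_integrable test_functions_partial)

text \<open>The exponent is above 1 in absolute value, and three such factors, one for each
  coordinate, make up a total decay of order 4.\<close>

lemma nn_integral_inverse_powr_finite:
  "(\<integral>\<^sup>+x. ennreal ((1 + \<bar>x::real\<bar>) powr (-4/3)) \<partial>lborel) < \<infinity>"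
proof -
  let ?f = "\<lambda>x::real. ennreal ((1 + \<bar>x\<bar>) powr (-4/3))"
  have "(\<integral>\<^sup>+x. ennreal ((1 + \<bar>x\<bar>) powr (-4/3)) * indicator {0::real..} x \<partial>lborel) = ennreal (0 - (-3) * (1 + 0) powr (-1/3))"
  proof -
    have "(\<integral>\<^sup>+x. ennreal ((1 + x) powr (-4/3) * indicator {0..} x) * indicator {0::real..} x \<partial>lborel) = ennreal (0 - (-3) * (1 + 0) powr (-1/3))"
    proof (rule nn_integral_FTC_atLeast)
      show "((\<lambda>x. - 3 * (1 + x) powr (- 1 / 3)) has_real_derivative (1 + x) powr (- 4 / 3) * indicator {0..} x) (at x)"
        if "0 \<le> x" for x :: real using that by (auto intro!: derivative_eq_intros)
      show "((\<lambda>x::real. - 3 * (1 + x) powr (- 1 / 3)) \<longlongrightarrow> 0) at_top" by real_asymp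
    qed auto
    moreover have "ennreal ((1 + x) powr (-4/3) * indicator {0..} x) * indicator {0::real..} x
      = ennreal ((1 + \<bar>x\<bar>) powr (-4/3)) * indicator {0::real..} x" for x :: real
      by (auto simp: indicator_def)
    ultimately show ?thesis by simp
  qed
  then have fin: "(\<integral>\<^sup>+x. ?f x * indicator {0..} x \<partial>lborel) < \<infinity>" by simp
  have "(\<integral>\<^sup>+x. ?f x * indicator {..0} x \<partial>lborel) = (\<integral>\<^sup>+x. ?f x * indicator {0..} x \<partial>lborel)"
    by (subst nn_integral_real_affine[of _ "-1" 0]) (auto simp: indicator_def intro!: nn_integral_cong)
  with fin have "(\<integral>\<^sup>+x. ?f x * indicator {0..} x \<partial>lborel) + (\<integral>\<^sup>+x. ?f x * indicator {..0} x \<partial>lborel) < \<infinity>"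
    by simp
  then have "(\<integral>\<^sup>+x. ?f x * indicator {0..} x + ?f x * indicator {..0} x \<partial>lborel) < \<infinity>"
    by (subst nn_integral_add) auto
  moreover have "(\<integral>\<^sup>+x. ?f x \<partial>lborel) \<le> (\<integral>\<^sup>+x. ?f x * indicator {0..} x + ?f x * indicator {..0} x \<partial>lborel)"
    by (intro nn_integral_mono) (auto simp: indicator_def)
  ultimately show ?thesis by (rule le_less_trans[rotated])
qed

text \<open>In dimension three \<open>\<langle>x\<rangle>\<^sup>4\<close> dominates the product of the \<open>(1 + |x\<^sub>i|) powr (4/3)\<close>.\<close>

lemma integrable_weight:
  "integrable lborel (\<lambda>x::real^3. 1 / (1 + (norm x)\<^sup>2)\<^sup>2)"
proof (rule integrableI_bounded)
  let ?f = "\<lambda>t::real. (1 + \<bar>t\<bar>) powr (-4/3)"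
  have le: "1 / (1 + (norm x)\<^sup>2)\<^sup>2 \<le> 4 * (\<Prod>b\<in>Basis. ?f (x \<bullet> b))" for x :: "real ^ 3"
  proof -
    let ?s = "1 + (norm x)\<^sup>2"
    have s: "?s > 0" by (simp add: add_pos_nonneg)
    have b: "(1 + \<bar>x \<bullet> b\<bar>) powr (4/3) \<le> (2 * ?s) powr (2/3)" if "b \<in> Basis" for b
    proof -
      have "(1 + \<bar>x \<bullet> b\<bar>)\<^sup>2 \<le> 2 * (1 + \<bar>x \<bullet> b\<bar>\<^sup>2)"
        using zero_le_power2[of "1 - \<bar>x \<bullet> b\<bar>"] by (simp add: power2_eq_square algebra_simps)
      also have "\<bar>x \<bullet> b\<bar>\<^sup>2 \<le> (norm x)\<^sup>2" using Basis_le_norm[OF that, of x] by (intro power_mono) auto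
      finally have "(1 + \<bar>x \<bullet> b\<bar>)\<^sup>2 \<le> 2 * ?s" by simp
      then have "((1 + \<bar>x \<bullet> b\<bar>)\<^sup>2) powr (2/3) \<le> (2 * ?s) powr (2/3)" by (intro powr_mono2) auto
      also have "((1 + \<bar>x \<bullet> b\<bar>)\<^sup>2) powr (2/3) = (1 + \<bar>x \<bullet> b\<bar>) powr (4/3)"
        by (simp add: powr_numeral[symmetric] powr_powr del: powr_numeral)
      finally show ?thesis .
    qed
    have "(\<Prod>b\<in>Basis. (1 + \<bar>x \<bullet> b\<bar>) powr (4/3)) \<le> (\<Prod>b\<in>(Basis :: (real^3) set). (2 * ?s) powr (2/3))"
      by (intro prod_mono) (use b in auto)
    also have "\<dots> = ((2 * ?s) powr (2/3)) powr 3" by (simp add: powr_numeral)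
    also have "\<dots> = (2 * ?s) powr 2" by (simp add: powr_powr)
    also have "\<dots> = 4 * ?s\<^sup>2" using s by (simp add: powr_numeral) (simp add: power2_eq_square algebra_simps)
    finally have le: "(\<Prod>b\<in>Basis. (1 + \<bar>x \<bullet> b\<bar>) powr (4/3)) \<le> 4 * ?s\<^sup>2" .
    have p: "(\<Prod>b\<in>Basis. (1 + \<bar>x \<bullet> b\<bar>) powr (4/3)) > 0" by (intro prod_pos) auto
    have "(\<Prod>b\<in>Basis. ?f (x \<bullet> b)) = inverse (\<Prod>b\<in>Basis. (1 + \<bar>x \<bullet> b\<bar>) powr (4/3))"
      by (subst prod_inversef[symmetric]) (simp add: powr_minus comp_def)
    moreover have "inverse (4 * ?s\<^sup>2) \<le> inverse (\<Prod>b\<in>Basis. (1 + \<bar>x \<bullet> b\<bar>) powr (4/3))"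
      using le p by (rule le_imp_inverse_le)
    ultimately have "inverse (4 * ?s\<^sup>2) \<le> (\<Prod>b\<in>Basis. ?f (x \<bullet> b))" by (simp only:)
    then have "4 * inverse (4 * ?s\<^sup>2) \<le> 4 * (\<Prod>b\<in>Basis. ?f (x \<bullet> b))" by (rule mult_left_mono) simp
    moreover have "4 * inverse (4 * ?s\<^sup>2) = 1 / ?s\<^sup>2" by (simp only: inverse_mult_distrib divide_inverse) simp
    ultimately show ?thesis by (simp only:)
  qed
  have "(\<integral>\<^sup>+x. ennreal (norm (1 / (1 + (norm (x::real^3))\<^sup>2)\<^sup>2)) \<partial>lborel) \<le> (\<integral>\<^sup>+x. 4 * (\<Prod>b\<in>Basis. ennreal (?f (x \<bullet> b))) \<partial>(lborel :: (real^3) measure))"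
  proof (rule nn_integral_mono)
    fix x :: "real ^ 3"
    have "ennreal (norm (1 / (1 + (norm x)\<^sup>2)\<^sup>2)) \<le> ennreal (4 * (\<Prod>b\<in>Basis. ?f (x \<bullet> b)))"
      using le[of x] by (intro ennreal_leI) simp
    also have "\<dots> = ennreal 4 * ennreal (\<Prod>b\<in>Basis. ?f (x \<bullet> b))" by (rule ennreal_mult) (auto intro: prod_nonneg)
    also have "ennreal (\<Prod>b\<in>Basis. ?f (x \<bullet> b)) = (\<Prod>b\<in>Basis. ennreal (?f (x \<bullet> b)))"
      by (rule prod_ennreal[symmetric]) auto
    finally show "ennreal (norm (1 / (1 + (norm x)\<^sup>2)\<^sup>2)) \<le> 4 * (\<Prod>b\<in>Basis. ennreal (?f (x \<bullet> b)))"
      by simp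
  qed
  also have "\<dots> = 4 * (\<Prod>b\<in>(Basis :: (real^3) set). \<integral>\<^sup>+x. ennreal (?f x) \<partial>lborel)"
  proof -
    have "(\<integral>\<^sup>+x. (\<Prod>b\<in>Basis. ennreal (?f (x \<bullet> b))) \<partial>(lborel :: (real^3) measure))
      = (\<Prod>b\<in>(Basis :: (real^3) set). \<integral>\<^sup>+x. ennreal (?f x) \<partial>lborel)"
      by (rule nn_integral_lborel_prod[where f="\<lambda>b x. ennreal (?f x)"]) auto
    then show ?thesis by (subst nn_integral_cmult) auto
  qed
  also have "\<dots> < \<infinity>" using nn_integral_inverse_powr_finite
    by (simp add: ennreal_mult_less_top power_less_top_ennreal)
  finally show "(\<integral>\<^sup>+x. ennreal (norm (1 / (1 + (norm (x::real^3))\<^sup>2)\<^sup>2)) \<partial>lborel) < \<infinity>" .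
qed simp

section \<open>Square integrable functions and mollification\<close>

lemma L2_measurable [measurable_dest]: "u \<in> L2 \<Longrightarrow> u \<in> borel_measurable borel"
  by (simp add: L2_def)

lemma L2_integrable: "u \<in> L2 \<Longrightarrow> integrable lborel (\<lambda>x. (norm (u x))\<^sup>2)"
  by (simp add: L2_def)

lemma L2I: "u \<in> borel_measurable borel \<Longrightarrow> integrable lborel (\<lambda>x. (norm (u x))\<^sup>2) \<Longrightarrow> u \<in> L2"
  by (simp add: L2_def)

lemma L2_bound:
  assumes [measurable]: "v \<in> borel_measurable borel" and f: "integrable lborel f"
    and le: "\<And>x. (norm (v x))\<^sup>2 \<le> f x"
  shows "v \<in> L2"
proof (rule L2I)
  show "integrable lborel (\<lambda>x. (norm (v x))\<^sup>2)"
    by (rule Bochner_Integration.integrable_bound[OF f]) (use le in \<open>auto intro!: AE_I2 order_trans[OF _ abs_ge_self]\<close>)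
qed simp

lemma norm_add_sq: "(norm (a + b :: complex))\<^sup>2 \<le> 2 * (norm a)\<^sup>2 + 2 * (norm b)\<^sup>2"
proof -
  have "(norm (a + b))\<^sup>2 \<le> (norm a + norm b)\<^sup>2" by (intro power_mono norm_triangle_ineq) auto
  also have "\<dots> \<le> 2 * (norm a)\<^sup>2 + 2 * (norm b)\<^sup>2"
    using zero_le_power2[of "norm a - norm b"] by (simp add: power2_eq_square algebra_simps)
  finally show ?thesis .
qed

lemma L2_add: assumes "u \<in> L2" "v \<in> L2" shows "(\<lambda>x. u x + v x) \<in> L2"
proof (rule L2_bound)
  note [measurable] = L2_measurable[OF assms(1)] L2_measurable[OF assms(2)]
  show "(\<lambda>x. u x + v x) \<in> borel_measurable borel" by measurable
  show "integrable lborel (\<lambda>x. 2 * (norm (u x))\<^sup>2 + 2 * (norm (v x))\<^sup>2)"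
    using assms[THEN L2_integrable] by auto
qed (rule norm_add_sq)

lemma L2_bounded_mult:
  assumes "u \<in> L2" and [measurable]: "b \<in> borel_measurable borel" and B: "\<And>x. norm (b x :: complex) \<le> B"
  shows "(\<lambda>x. b x * u x) \<in> L2"
proof (rule L2_bound)
  note [measurable] = L2_measurable[OF assms(1)]
  show "(\<lambda>x. b x * u x) \<in> borel_measurable borel" by measurable
  show "integrable lborel (\<lambda>x. B\<^sup>2 * (norm (u x))\<^sup>2)"
    using assms(1)[THEN L2_integrable] by auto
  show "(norm (b x * u x))\<^sup>2 \<le> B\<^sup>2 * (norm (u x))\<^sup>2" for x
    using B[of x] by (auto simp: norm_mult power_mult_distrib intro!: mult_right_mono power_mono)
qed

lemma L2_cmult: "u \<in> L2 \<Longrightarrow> (\<lambda>x. c * u x) \<in> L2"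
  by (rule L2_bounded_mult[of _ "\<lambda>_. c" "norm c"]) auto

lemma L2_diff: "u \<in> L2 \<Longrightarrow> v \<in> L2 \<Longrightarrow> (\<lambda>x. u x - v x) \<in> L2"
  using L2_add[OF _ L2_cmult[of v "-1"]] by simp

lemma L2_cnj: assumes "u \<in> L2" shows "(\<lambda>x. cnj (u x)) \<in> L2"
proof (rule L2I)
  have "continuous_on UNIV cnj" by (intro continuous_intros)
  then have "cnj \<in> borel_measurable borel" by (rule borel_measurable_continuous_onI)
  then show "(\<lambda>x. cnj (u x)) \<in> borel_measurable borel"
    using L2_measurable[OF assms] by (rule measurable_compose[rotated])
qed (use assms[THEN L2_integrable] in simp)

lemma L2_translate: assumes "u \<in> L2" shows "(\<lambda>x. u (x + a)) \<in> L2" "(\<lambda>x. u (a - x)) \<in> L2"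
proof -
  note [measurable] = L2_measurable[OF assms]
  show "(\<lambda>x. u (x + a)) \<in> L2" "(\<lambda>x. u (a - x)) \<in> L2"
    using integrable_translate[OF L2_integrable[OF assms], of a] by (auto intro!: L2I)
qed

lemma L2_mult_integrable:
  assumes "u \<in> L2" "v \<in> L2" shows "integrable lborel (\<lambda>x. u x * v x)"
proof (rule Bochner_Integration.integrable_bound)
  note [measurable] = L2_measurable[OF assms(1)] L2_measurable[OF assms(2)]
  show "(\<lambda>x. u x * v x) \<in> borel_measurable lborel" by measurable
  show "integrable lborel (\<lambda>x. (norm (u x))\<^sup>2 + (norm (v x))\<^sup>2)"
    using assms[THEN L2_integrable] by auto
  have "norm (a * b) \<le> (norm a)\<^sup>2 + (norm b)\<^sup>2" for a b :: complex
  proof -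
    have "0 \<le> (norm a - norm b)\<^sup>2 + (norm a)\<^sup>2 + (norm b)\<^sup>2" by simp
    then show ?thesis by (simp add: norm_mult power2_eq_square algebra_simps)
  qed
  then show "AE x in lborel. norm (u x * v x) \<le> norm ((norm (u x))\<^sup>2 + (norm (v x))\<^sup>2)"
    by (auto intro!: AE_I2)
qed

lemma L2_bounded_support:
  assumes "f \<in> borel_measurable borel" "\<And>x. norm (f x :: complex) \<le> M" "\<And>x. norm x \<ge> R \<Longrightarrow> f x = 0"
  shows "f \<in> L2"
proof (rule L2I)
  show "integrable lborel (\<lambda>x. (norm (f x))\<^sup>2)"
    by (rule integrable_bounded_support[of _ "M\<^sup>2" R]) (use assms in \<open>auto intro!: power_mono\<close>)
qed fact

lemma test_functions_L2: assumes "f \<in> test_functions" shows "f \<in> L2"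
proof -
  obtain M where M: "\<And>x. norm (f x) \<le> M" using test_functions_bounded[OF assms] by blast
  obtain R where R: "\<And>x. norm x \<ge> R \<Longrightarrow> f x = 0" using test_functions_support[OF assms] by blast
  show ?thesis by (rule L2_bounded_support[OF smooth_measurable[OF test_functions_smooth[OF assms]] M R])
qed

section \<open>Squared norm, convergence in L2 and continuity of translations\<close>

definition sqn :: "(real ^ 'n \<Rightarrow> complex) \<Rightarrow> real" where
  "sqn u = (LINT x|lborel. (norm (u x))\<^sup>2)"

lemma sqn_nonneg: "0 \<le> sqn u"
  unfolding sqn_def by (intro integral_nonneg_AE) auto

lemma nn_sqn: "u \<in> L2 \<Longrightarrow> (\<integral>\<^sup>+x. ennreal ((norm (u x))\<^sup>2) \<partial>lborel) = ennreal (sqn u)"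
  unfolding sqn_def by (rule nn_integral_eq_integral[OF L2_integrable]) auto

lemma sqn_eq_0: "u \<in> L2 \<Longrightarrow> sqn u = 0 \<Longrightarrow> AE x in lborel. u x = 0"
  unfolding sqn_def using integral_nonneg_eq_0_iff_AE[OF L2_integrable] by auto

lemma sqn_add: assumes "u \<in> L2" "v \<in> L2" shows "sqn (\<lambda>x. u x + v x) \<le> 2 * sqn u + 2 * sqn v"
proof -
  have "sqn (\<lambda>x. u x + v x) \<le> (LINT x|lborel. 2 * (norm (u x))\<^sup>2 + 2 * (norm (v x))\<^sup>2)"
    unfolding sqn_def
    by (intro integral_mono norm_add_sq L2_integrable L2_add assms) (use assms[THEN L2_integrable] in auto)
  also have "\<dots> = 2 * sqn u + 2 * sqn v"
    unfolding sqn_def using assms[THEN L2_integrable] by simp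
  finally show ?thesis .
qed

lemma sqn_minus_commute: "sqn (\<lambda>x. u x - v x) = sqn (\<lambda>x. v x - u x)"
  unfolding sqn_def by (simp add: norm_minus_commute)

lemma sqn_translate: assumes "u \<in> L2" shows "sqn (\<lambda>x. u (x + a)) = sqn u"
  using integral_translate(1)[OF L2_integrable[OF assms], of a] by (simp add: sqn_def)

lemma L2_Cauchy_Schwarz:
  assumes "u \<in> L2" "v \<in> L2"
  shows "norm (LINT x|lborel. u x * v x) \<le> sqrt (sqn u) * sqrt (sqn v)"
proof -
  note [measurable] = L2_measurable[OF assms(1)] L2_measurable[OF assms(2)]
  let ?I = "LINT x|lborel. norm (u x * v x)"
  have int: "integrable lborel (\<lambda>x. norm (u x * v x))"
    using L2_mult_integrable[OF assms] by (rule integrable_norm)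
  have I: "?I \<ge> 0" by (intro integral_nonneg_AE) auto
  have "ennreal (?I\<^sup>2) = (\<integral>\<^sup>+x. ennreal (norm (u x)) * ennreal (norm (v x)) \<partial>lborel)\<^sup>2"
    using nn_integral_eq_integral[OF int] I by (simp add: ennreal_power ennreal_mult norm_mult)
  also have "\<dots> \<le> (\<integral>\<^sup>+x. ennreal (norm (u x)) ^ 2 \<partial>lborel) * (\<integral>\<^sup>+x. ennreal (norm (v x)) ^ 2 \<partial>lborel)"
    by (rule Cauchy_Schwarz_nn_integral) auto
  also have "\<dots> = ennreal (sqn u * sqn v)"
    using nn_sqn[OF assms(1)] nn_sqn[OF assms(2)] by (simp add: ennreal_power ennreal_mult sqn_nonneg)
  finally have "?I\<^sup>2 \<le> sqn u * sqn v" by (simp add: sqn_nonneg)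
  then have "?I \<le> sqrt (sqn u) * sqrt (sqn v)"
    by (simp add: real_le_rsqrt real_sqrt_mult[symmetric])
  then show ?thesis using integral_norm_bound[of lborel "\<lambda>x. u x * v x"] by linarith
qed

lemma L2_pairing_tendsto:
  assumes a: "\<And>n. a n \<in> L2" "a' \<in> L2" "(\<lambda>n. sqn (\<lambda>x. a n x - a' x)) \<longlonglongrightarrow> 0"
    and b: "\<And>n. b n \<in> L2" "b' \<in> L2" "(\<lambda>n. sqn (\<lambda>x. b n x - b' x)) \<longlonglongrightarrow> 0"
  shows "(\<lambda>n. LINT x|lborel. a n x * b n x) \<longlonglongrightarrow> (LINT x|lborel. a' x * b' x)"
proof -
  let ?A = "\<lambda>n x. a n x - a' x" and ?B = "\<lambda>n x. b n x - b' x"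
  have A: "?A n \<in> L2" for n by (rule L2_diff[OF a(1,2)])
  have B: "?B n \<in> L2" for n by (rule L2_diff[OF b(1,2)])
  have "(\<lambda>n. (LINT x|lborel. a n x * b n x) - (LINT x|lborel. a' x * b' x)) \<longlonglongrightarrow> 0"
  proof (rule Lim_null_comparison)
    have "norm ((LINT x|lborel. a n x * b n x) - (LINT x|lborel. a' x * b' x))
      \<le> sqrt (sqn (?A n)) * sqrt (sqn (?B n)) + sqrt (sqn (?A n)) * sqrt (sqn b') + sqrt (sqn a') * sqrt (sqn (?B n))" for n
    proof -
      have "(LINT x|lborel. a n x * b n x) - (LINT x|lborel. a' x * b' x)
         = (LINT x|lborel. a n x * b n x - a' x * b' x)"
        by (rule Bochner_Integration.integral_diff[symmetric]) (intro L2_mult_integrable a b)+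
      \<comment> \<open>Expanding around the limits leaves only the fixed norms of \<open>a'\<close>
        and \<open>b'\<close> as factors, so the two convergence hypotheses are all that the limit
        requires.\<close>
      also have "\<dots> = (LINT x|lborel. ?A n x * ?B n x + ?A n x * b' x + a' x * ?B n x)"
        by (simp add: algebra_simps)
      also have "\<dots> = (LINT x|lborel. ?A n x * ?B n x) + (LINT x|lborel. ?A n x * b' x) + (LINT x|lborel. a' x * ?B n x)"
        using L2_mult_integrable[OF A[of n] B[of n]] L2_mult_integrable[OF A[of n] b(2)]
          L2_mult_integrable[OF a(2) B[of n]]
        by (simp only: Bochner_Integration.integral_add Bochner_Integration.integrable_add)
      finally have eq: "(LINT x|lborel. a n x * b n x) - (LINT x|lborel. a' x * b' x) = \<dots>" .
      have "norm ((LINT x|lborel. ?A n x * ?B n x) + (LINT x|lborel. ?A n x * b' x) + (LINT x|lborel. a' x * ?B n x)) \<le> norm (LINT x|lborel. ?A n x * ?B n x) + norm (LINT x|lborel. ?A n x * b' x) + norm (LINT x|lborel. a' x * ?B n x)"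
        by (rule order_trans[OF norm_triangle_ineq add_right_mono[OF norm_triangle_ineq]])
      also have "\<dots> \<le> sqrt (sqn (?A n)) * sqrt (sqn (?B n)) + sqrt (sqn (?A n)) * sqrt (sqn b') + sqrt (sqn a') * sqrt (sqn (?B n))"
        by (rule add_mono[OF add_mono[OF L2_Cauchy_Schwarz[OF A B] L2_Cauchy_Schwarz[OF A b(2)]] L2_Cauchy_Schwarz[OF a(2) B]])
      finally show ?thesis unfolding eq .
    qed
    then show "\<forall>\<^sub>F n in sequentially. norm ((LINT x|lborel. a n x * b n x) - (LINT x|lborel. a' x * b' x))
      \<le> sqrt (sqn (?A n)) * sqrt (sqn (?B n)) + sqrt (sqn (?A n)) * sqrt (sqn b') + sqrt (sqn a') * sqrt (sqn (?B n))"
      by simp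
    have "(\<lambda>n. sqrt (sqn (?A n))) \<longlonglongrightarrow> 0" "(\<lambda>n. sqrt (sqn (?B n))) \<longlonglongrightarrow> 0"
      using tendsto_real_sqrt[OF a(3)] tendsto_real_sqrt[OF b(3)] by simp_all
    then show "(\<lambda>n. sqrt (sqn (?A n)) * sqrt (sqn (?B n)) + sqrt (sqn (?A n)) * sqrt (sqn b') + sqrt (sqn a') * sqrt (sqn (?B n))) \<longlonglongrightarrow> 0"
      by (intro tendsto_add_zero tendsto_mult_zero tendsto_mult_left_zero tendsto_mult_right_zero)
  qed
  then show ?thesis by (simp add: LIM_zero_iff)
qed

lemma sqn_eq_inner: "of_real (sqn u) = (LINT x|lborel. u x * cnj (u x))"
  unfolding sqn_def complex_norm_square[symmetric] of_real_power[symmetric] integral_complex_of_real[symmetric] ..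

lemma sqn_tendsto:
  assumes "\<And>n. a n \<in> L2" "a' \<in> L2" "(\<lambda>n. sqn (\<lambda>x. a n x - a' x)) \<longlonglongrightarrow> 0"
  shows "(\<lambda>n. sqn (a n)) \<longlonglongrightarrow> sqn a'"
proof -
  have "(\<lambda>n. complex_of_real (sqn (a n))) \<longlonglongrightarrow> of_real (sqn a')"
    unfolding sqn_eq_inner
  proof (rule L2_pairing_tendsto)
    show "(\<lambda>n. sqn (\<lambda>x. cnj (a n x) - cnj (a' x))) \<longlonglongrightarrow> 0"
      using assms(3) unfolding sqn_def complex_cnj_diff[symmetric] complex_mod_cnj .
  qed (use assms L2_cnj in auto)
  then show ?thesis by (simp add: tendsto_of_real_iff)
qed

text \<open>The radial retraction onto the disc of radius \<open>M\<close>; the form with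
  \<open>max\<close> makes its continuity evident.\<close>

definition clip :: "real \<Rightarrow> complex \<Rightarrow> complex" where
  "clip M z = of_real (M / max M (norm z)) * z"

lemma clip_bound: "M > 0 \<Longrightarrow> norm (clip M z) \<le> M" "M > 0 \<Longrightarrow> norm (clip M z) \<le> norm z"
  by (auto simp: clip_def norm_mult norm_divide field_simps max_def)

lemma clip_eq: "M > 0 \<Longrightarrow> norm z \<le> M \<Longrightarrow> clip M z = z"
  by (simp add: clip_def max_def)

lemma continuous_clip: "M > 0 \<Longrightarrow> continuous_on UNIV (clip M)"
  unfolding clip_def by (intro continuous_intros) auto

definition cutoff :: "real \<Rightarrow> real ^ 'n \<Rightarrow> complex" where
  "cutoff R x = of_real (max 0 (min 1 (R + 1 - norm x)))"

lemma cutoff_bound: "norm (cutoff R x) \<le> 1" "norm x \<le> R \<Longrightarrow> cutoff R x = 1" "norm x \<ge> R + 1 \<Longrightarrow> cutoff R x = 0"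
  by (auto simp: cutoff_def)

lemma continuous_cutoff: "continuous_on UNIV (cutoff R)"
  unfolding cutoff_def by (intro continuous_intros)

lemma clip_cutoff_bound: "M > 0 \<Longrightarrow> norm (cutoff R x * clip M z) \<le> M" "M > 0 \<Longrightarrow> norm (cutoff R x * clip M z) \<le> norm z"
  using mult_mono[OF cutoff_bound(1)[of R x] clip_bound(1)[of M z]] mult_mono[OF cutoff_bound(1)[of R x] clip_bound(2)[of M z]]
  by (auto simp: norm_mult)

lemma norm_diff_sq_bound: "norm a \<le> B \<Longrightarrow> norm b \<le> B \<Longrightarrow> (norm (a - b :: complex))\<^sup>2 \<le> 4 * B\<^sup>2"
proof -
  assume "norm a \<le> B" "norm b \<le> B"
  then have "norm (a - b) \<le> 2 * B" using norm_triangle_ineq4[of a b] by linarith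
  then have "(norm (a - b))\<^sup>2 \<le> (2 * B)\<^sup>2" by (intro power_mono) auto
  then show ?thesis by (simp add: power2_eq_square)
qed

text \<open>Truncate in range and in space, then use that a measurable function is an almost everywhere limit of
  continuous functions.\<close>

lemma L2_approx_continuous:
  assumes u: "u \<in> L2" and e: "e > 0"
  obtains g R M where "continuous_on UNIV g" "\<And>x. norm x \<ge> R \<Longrightarrow> g x = 0" "\<And>x. norm (g x) \<le> M"
    "sqn (\<lambda>x. u x - g x) < e"
proof -
  note [measurable] = L2_measurable[OF u]
  have [measurable]: "clip M \<in> borel_measurable borel" if "M > 0" for M
    using continuous_clip[OF that] by (rule borel_measurable_continuous_onI)
  have cutm[measurable]: "cutoff R \<in> borel_measurable borel" for R :: real
    using continuous_cutoff by (rule borel_measurable_continuous_onI)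
  define v where "v M x = cutoff M x * clip M (u x)" for M x
  have vm[measurable]: "v M \<in> borel_measurable borel" if "M > 0" for M
    unfolding v_def using that by measurable
  have "(\<lambda>n. sqn (\<lambda>x. u x - v (real (Suc n)) x)) \<longlonglongrightarrow> (LINT x::real^'a|lborel. 0)"
    unfolding sqn_def
  proof (rule integral_dominated_convergence[where w="\<lambda>x. 4 * (norm (u x))\<^sup>2"])
    show "AE x in lborel. (\<lambda>n. (norm (u x - v (real (Suc n)) x))\<^sup>2) \<longlonglongrightarrow> 0"
    proof (rule AE_I2)
      fix x
      obtain N :: nat where N: "norm x + norm (u x) \<le> real N" using real_arch_simple by blast
      have "(norm (u x - v (real (Suc n)) x))\<^sup>2 = 0" if "n \<ge> N" for n
      proof -
        have "norm x \<le> real (Suc n)" "norm (u x) \<le> real (Suc n)"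
          using N that norm_ge_zero[of x] norm_ge_zero[of "u x"] by linarith+
        then show ?thesis by (simp add: v_def cutoff_bound clip_eq)
      qed
      then show "(\<lambda>n. (norm (u x - v (real (Suc n)) x))\<^sup>2) \<longlonglongrightarrow> 0"
        by (intro tendsto_eventually eventually_sequentiallyI[of N])
    qed
    show "AE x in lborel. norm ((norm (u x - v (real (Suc n)) x))\<^sup>2) \<le> 4 * (norm (u x))\<^sup>2" for n
    proof (rule AE_I2)
      fix x
      have "norm (v (real (Suc n)) x) \<le> norm (u x)" unfolding v_def by (rule clip_cutoff_bound(2)) simp
      from norm_diff_sq_bound[OF order_refl this]
      show "norm ((norm (u x - v (real (Suc n)) x))\<^sup>2) \<le> 4 * (norm (u x))\<^sup>2" by simp
    qed
    show "(\<lambda>x. (norm (u x - v (real (Suc n)) x))\<^sup>2) \<in> borel_measurable lborel" for n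
      using vm[of "real (Suc n)"] by simp
  qed (use u[THEN L2_integrable] in auto)
  then have "\<forall>\<^sub>F n in sequentially. sqn (\<lambda>x. u x - v (real (Suc n)) x) < e / 4"
    using e by (intro order_tendstoD(2)[of _ 0]) auto
  then obtain n where "sqn (\<lambda>x. u x - v (real (Suc n)) x) < e / 4"
    by (auto simp: eventually_sequentially)
  then obtain M where M: "M > 0" and Mu: "sqn (\<lambda>x. u x - v M x) < e / 4"
    by (metis of_nat_0_less_iff zero_less_Suc)
  have "u \<in> borel_measurable lebesgue"
    by (rule measurable_completion) simp
  then have "u measurable_on UNIV" by (rule lebesgue_measurable_imp_measurable_on) simp
  then obtain N g where N: "negligible N" and g: "\<And>n. continuous_on UNIV (g n)"
    and lim: "\<And>x. x \<notin> N \<Longrightarrow> (\<lambda>n. g n x) \<longlonglongrightarrow> u x"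
    unfolding measurable_on_def by auto
  have "AE x in lebesgue. x \<notin> N"
    using N by (intro AE_not_in) (simp add: negligible_iff_null_sets)
  then have AE: "AE x in lborel. x \<notin> N" by (simp add: AE_completion_iff)
  \<comment> \<open>The approximants receive the same truncation as \<open>u\<close>. The limit is
    then \<open>v M\<close>, and a common bound and a common support supply the dominating
    function.\<close>
  define w where "w n x = cutoff M x * clip M (g n x)" for n x
  have wc: "continuous_on UNIV (w n)" for n
    unfolding w_def by (intro continuous_intros continuous_cutoff continuous_on_compose2[OF continuous_clip[OF M] g]) auto
  then have [measurable]: "w n \<in> borel_measurable borel" for n by (rule borel_measurable_continuous_onI)
  have bs: "norm (w n x) \<le> M" "norm (v M x) \<le> M" for n x
    using clip_cutoff_bound(1)[OF M] by (auto simp: w_def v_def)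
  have supp: "w n x = 0" "v M x = 0" if "norm x \<ge> M + 1" for n x
    using cutoff_bound(3)[OF that] by (auto simp: w_def v_def)
  have "(\<lambda>n. sqn (\<lambda>x. v M x - w n x)) \<longlonglongrightarrow> (LINT x::real^'a|lborel. 0)"
    unfolding sqn_def
  proof (rule integral_dominated_convergence[where w="\<lambda>x. 4 * M\<^sup>2 * indicator (cball 0 (M + 1)) x"])
    show "integrable lborel (\<lambda>x::real^'a. 4 * M\<^sup>2 * indicator (cball 0 (M + 1)) x)"
      by (intro integrable_mult_right integrable_real_indicator emeasure_compact_finite) auto
    show "AE x in lborel. (\<lambda>n. (norm (v M x - w n x))\<^sup>2) \<longlonglongrightarrow> 0"
      using AE
    proof eventually_elim
      case (elim x)
      have "(\<lambda>n. w n x) \<longlonglongrightarrow> v M x"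
        unfolding w_def v_def
        using continuous_on_tendsto_compose[OF continuous_clip[OF M] lim[OF elim]]
        by (intro tendsto_intros) auto
      then have "(\<lambda>n. (norm (v M x - w n x))\<^sup>2) \<longlonglongrightarrow> (norm (v M x - v M x))\<^sup>2"
        by (intro tendsto_intros)
      then show ?case by simp
    qed
    show "AE x in lborel. norm ((norm (v M x - w n x))\<^sup>2) \<le> 4 * M\<^sup>2 * indicator (cball 0 (M + 1)) x" for n
    proof (rule AE_I2)
      fix x show "norm ((norm (v M x - w n x))\<^sup>2) \<le> 4 * M\<^sup>2 * indicator (cball 0 (M + 1)) x"
        using norm_diff_sq_bound[OF bs(2,1)] supp[of x] by (cases "norm x \<le> M + 1") auto
    qed
    show "(\<lambda>x. (norm (v M x - w n x))\<^sup>2) \<in> borel_measurable lborel" for n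
      using vm[OF M] by simp
  qed auto
  then have "\<forall>\<^sub>F n in sequentially. sqn (\<lambda>x. v M x - w n x) < e / 4"
    using e by (intro order_tendstoD(2)[of _ 0]) auto
  then obtain n where n: "sqn (\<lambda>x. v M x - w n x) < e / 4"
    by (auto simp: eventually_sequentially)
  have vL: "v M \<in> L2" by (rule L2_bounded_support[OF vm[OF M] bs(2) supp(2)])
  have wL: "w n \<in> L2" by (rule L2_bounded_support[OF _ bs(1) supp(1)]) measurable
  have "sqn (\<lambda>x. u x - w n x) = sqn (\<lambda>x. (u x - v M x) + (v M x - w n x))" by simp
  also have "\<dots> \<le> 2 * sqn (\<lambda>x. u x - v M x) + 2 * sqn (\<lambda>x. v M x - w n x)"
    by (intro sqn_add L2_diff u vL wL)
  also have "\<dots> < e" using Mu n by simp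
  finally show thesis using that[OF wc supp(1) bs(1)] by blast
qed

text \<open>For a bounded continuous function of bounded support this is dominated convergence. The
  general case follows by approximation, because translations are isometries and the approximation
  error stays uniform in the shift.\<close>

lemma L2_translation_continuous:
  assumes u: "u \<in> L2" and h: "h \<longlonglongrightarrow> 0"
  shows "(\<lambda>n. sqn (\<lambda>x. u (x + h n) - u x)) \<longlonglongrightarrow> 0"
proof (rule LIMSEQ_I)
  fix e :: real assume e: "e > 0"
  \<comment> \<open>Two uses of \<open>sqn_add\<close> give the three differences the weights 2, 4
    and 4. The outer two contribute \<open>6 * (e / 12)\<close> and the middle one
    \<open>4 * (e / 8)\<close>, in total \<open>e\<close>.\<close>
  obtain g R M where g: "continuous_on UNIV g" and R: "\<And>x. norm x \<ge> R \<Longrightarrow> g x = 0" and M: "\<And>x. norm (g x) \<le> M"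
    and ug: "sqn (\<lambda>x. u x - g x) < e / 12"
    using L2_approx_continuous[OF u, of "e / 12"] e by auto
  have [measurable]: "g \<in> borel_measurable borel" using g by (rule borel_measurable_continuous_onI)
  have gL: "g \<in> L2" by (rule L2_bounded_support[OF _ M R]) measurable
  obtain N0 where N0: "\<And>n. n \<ge> N0 \<Longrightarrow> norm (h n) < 1" using LIMSEQ_D[OF h, of 1] by auto
  have "(\<lambda>n. sqn (\<lambda>x. g (x + h (n + N0)) - g x)) \<longlonglongrightarrow> (LINT x::real^'a|lborel. 0)"
    unfolding sqn_def
  proof (rule integral_dominated_convergence[where w="\<lambda>x. 4 * M\<^sup>2 * indicator (cball 0 (R + 1)) x"])
    show "integrable lborel (\<lambda>x::real^'a. 4 * M\<^sup>2 * indicator (cball 0 (R + 1)) x)"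
      by (intro integrable_mult_right integrable_real_indicator emeasure_compact_finite) auto
    have h': "(\<lambda>n. h (n + N0)) \<longlonglongrightarrow> 0" using LIMSEQ_ignore_initial_segment[OF h] .
    have "(\<lambda>n. (norm (g (x + h (n + N0)) - g x))\<^sup>2) \<longlonglongrightarrow> (norm (g (x + 0) - g x))\<^sup>2" for x
      by (intro tendsto_intros continuous_on_tendsto_compose[OF g] h') auto
    then show "AE x in lborel. (\<lambda>n. (norm (g (x + h (n + N0)) - g x))\<^sup>2) \<longlonglongrightarrow> 0" by simp
    show "AE x in lborel. norm ((norm (g (x + h (n + N0)) - g x))\<^sup>2) \<le> 4 * M\<^sup>2 * indicator (cball 0 (R + 1)) x" for n
    proof (rule AE_I2)
      fix x
      have "g (x + h (n + N0)) = 0 \<and> g x = 0" if "\<not> norm x \<le> R + 1"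
        using that N0[of "n + N0"] norm_diff_ineq[of x "h (n + N0)"] by (intro conjI R) auto
      then show "norm ((norm (g (x + h (n + N0)) - g x))\<^sup>2) \<le> 4 * M\<^sup>2 * indicator (cball 0 (R + 1)) x"
        using norm_diff_sq_bound[OF M M, of "x + h (n + N0)" x] by (cases "norm x \<le> R + 1") auto
    qed
  qed auto
  then have "(\<lambda>n. sqn (\<lambda>x. g (x + h (n + N0)) - g x)) \<longlonglongrightarrow> 0" by simp
  then have "(\<lambda>n. sqn (\<lambda>x. g (x + h n) - g x)) \<longlonglongrightarrow> 0" by (rule LIMSEQ_offset)
  then obtain N where N: "\<And>n. n \<ge> N \<Longrightarrow> sqn (\<lambda>x. g (x + h n) - g x) < e / 8"
    using LIMSEQ_D[of _ 0 "e / 8"] e by fastforce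
  have "norm (sqn (\<lambda>x. u (x + h n) - u x) - 0) < e" if "n \<ge> N" for n
  proof -
    have L: "(\<lambda>x. u (x + h n) - g (x + h n)) \<in> L2" "(\<lambda>x. g (x + h n) - g x) \<in> L2" "(\<lambda>x. g x - u x) \<in> L2"
      by (intro L2_diff L2_translate u gL)+
    have "sqn (\<lambda>x. u (x + h n) - u x) = sqn (\<lambda>x. (u (x + h n) - g (x + h n)) + ((g (x + h n) - g x) + (g x - u x)))"
      by simp
    also have "\<dots> \<le> 2 * sqn (\<lambda>x. u (x + h n) - g (x + h n)) + 2 * sqn (\<lambda>x. (g (x + h n) - g x) + (g x - u x))"
      by (rule sqn_add[OF L(1) L2_add[OF L(2,3)]])
    also have "\<dots> \<le> 2 * sqn (\<lambda>x. u (x + h n) - g (x + h n)) + 2 * (2 * sqn (\<lambda>x. g (x + h n) - g x) + 2 * sqn (\<lambda>x. g x - u x))"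
      by (intro add_left_mono mult_left_mono sqn_add L) auto
    also have "sqn (\<lambda>x. u (x + h n) - g (x + h n)) = sqn (\<lambda>x. u x - g x)"
      by (rule sqn_translate[OF L2_diff[OF u gL]])
    also have "sqn (\<lambda>x. g x - u x) = sqn (\<lambda>x. u x - g x)" by (rule sqn_minus_commute)
    finally show ?thesis using ug N[OF that] sqn_nonneg[of "\<lambda>x. u (x + h n) - u x"] by simp
  qed
  then show "\<exists>N. \<forall>n\<ge>N. norm (sqn (\<lambda>x. u (x + h n) - u x) - 0) < e" by blast
qed

section \<open>Convolution with test functions and mollification\<close>

definition conv :: "(real ^ 'n \<Rightarrow> complex) \<Rightarrow> (real ^ 'n \<Rightarrow> complex) \<Rightarrow> real ^ 'n \<Rightarrow> complex" where
  "conv u m t = (LINT x|lborel. u x * m (t - x))"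

lemma test_functions_reflect: "m \<in> test_functions \<Longrightarrow> (\<lambda>x. m (t - x)) \<in> test_functions"
  for m :: "real ^ 'n \<Rightarrow> complex"
  using test_functions_affine[of m "-1" t] by (simp add: uminus_add_conv_diff)

lemma conv_integrable: "u \<in> L2 \<Longrightarrow> m \<in> test_functions \<Longrightarrow> integrable lborel (\<lambda>x. u x * m (t - x))"
  by (rule L2_mult_integrable[OF _ test_functions_L2[OF test_functions_reflect]])

lemma test_functions_lipschitz:
  fixes m :: "real ^ 'n \<Rightarrow> complex"
  assumes "m \<in> test_functions"
  obtains L where "L > 0" "\<And>x y. norm (m x - m y) \<le> L * norm (x - y)"
    "\<And>x v. norm (\<Sum>i\<in>UNIV. of_real (v $ i) * partial i m x) \<le> L * norm v"
proof -
  have "\<forall>i. \<exists>M>0. \<forall>x. norm (partial i m x) \<le> M"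
    using test_functions_bounded[OF test_functions_partial[OF assms]] by metis
  then obtain M where M: "\<And>i. M i > 0" "\<And>i x. norm (partial i m x) \<le> M i" by metis
  define L where "L = (\<Sum>i\<in>UNIV. M i) + 1"
  have L0: "L > 0" using M(1) by (simp add: L_def add_nonneg_pos sum_nonneg less_imp_le)
  have b: "norm (\<Sum>i\<in>UNIV. of_real (v $ i) * partial i m x) \<le> L * norm v" for x v
  proof -
    have "norm (\<Sum>i\<in>UNIV. of_real (v $ i) * partial i m x) \<le> (\<Sum>i\<in>UNIV. norm v * M i)"
      using M component_le_norm_cart[of v]
      by (intro sum_norm_le) (auto simp: norm_mult intro!: mult_mono)
    also have "\<dots> = norm v * (\<Sum>i\<in>UNIV. M i)" by (simp add: sum_distrib_left)
    also have "\<dots> \<le> L * norm v" by (simp add: L_def algebra_simps)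
    finally show ?thesis .
  qed
  have "norm (m x - m y) \<le> L * norm (x - y)" for x y
  proof (rule differentiable_bound[where S=UNIV])
    fix z :: "real ^ 'n"
    show "(m has_derivative (\<lambda>v. \<Sum>i\<in>UNIV. of_real (v $ i) * partial i m z)) (at z within UNIV)"
      using smooth_has_derivative[OF test_functions_smooth[OF assms]] by simp
    show "onorm (\<lambda>v. \<Sum>i\<in>UNIV. of_real (v $ i) * partial i m z) \<le> L"
      using L0 b by (intro onorm_bound) auto
  qed auto
  then show thesis using that L0 b by blast
qed

lemma L2_indicator_cball_integrable:
  assumes "u \<in> L2" shows "integrable lborel (\<lambda>x. norm (u x) * indicator (cball 0 R) x)"
proof -
  have "(\<lambda>x. complex_of_real (indicator (cball 0 R) x)) \<in> L2"
    by (rule L2_bounded_support[of _ 1 "R + 1"]) (auto simp: indicator_def)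
  from integrable_norm[OF L2_mult_integrable[OF assms this]] show ?thesis
    by (simp add: norm_mult)
qed

text \<open>Differentiation under the integral sign. The first-order remainder of \<open>m\<close>,
  divided by \<open>norm h\<close>, tends to 0 pointwise; by the Lipschitz bound it is at most
  \<open>2 * L\<close>, and for \<open>norm h < 1\<close> it is supported in a fixed ball, on which
  \<open>u\<close> is integrable.\<close>

lemma conv_has_derivative:
  fixes u :: "real ^ 'n \<Rightarrow> complex"
  assumes u: "u \<in> L2" and m: "m \<in> test_functions"
  shows "(conv u m has_derivative (\<lambda>v. \<Sum>i\<in>UNIV. of_real (v $ i) * conv u (partial i m) t)) (at t)"
proof -
  note [measurable] = L2_measurable[OF u] smooth_measurable[OF test_functions_smooth[OF m]]
    smooth_measurable[OF smooth_partial[OF test_functions_smooth[OF m]]]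
  obtain L where L: "L > 0" "\<And>x y. norm (m x - m y) \<le> L * norm (x - y)"
    "\<And>x v. norm (\<Sum>i\<in>UNIV. of_real (v $ i) * partial i m x) \<le> L * norm v"
    using test_functions_lipschitz[OF m] by blast
  obtain R where R: "R > 0" "\<And>x. norm x \<ge> R \<Longrightarrow> m x = 0" using test_functions_support[OF m] by blast
  have R': "partial i m x = 0" if "norm x > R" for i x
    by (rule partial_eq_0_norm[OF _ that]) (simp add: R)
  let ?D = "\<lambda>x v. \<Sum>i\<in>UNIV. of_real (v $ i) * partial i m x"
  let ?q = "\<lambda>h x. inverse (norm h) *\<^sub>R (u x * (m (t + h - x) - m (t - x) - ?D (t - x) h))"
  have q: "inverse (norm h) *\<^sub>R (conv u m (t + h) - conv u m t - (\<Sum>i\<in>UNIV. of_real (h $ i) * conv u (partial i m) t))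
      = (LINT x|lborel. ?q h x)" for h
  proof -
    note [simp] = conv_integrable[OF u m] conv_integrable[OF u test_functions_partial[OF m]]
    have i: "integrable lborel (\<lambda>x. \<Sum>i\<in>UNIV. of_real (h $ i) * (u x * partial i m (t - x)))"
      by (intro Bochner_Integration.integrable_sum integrable_mult_right) simp
    have "(\<Sum>i\<in>UNIV. of_real (h $ i) * conv u (partial i m) t)
      = (LINT x|lborel. (\<Sum>i\<in>UNIV. of_real (h $ i) * (u x * partial i m (t - x))))"
      unfolding conv_def by (subst Bochner_Integration.integral_sum) auto
    then have "conv u m (t + h) - conv u m t - (\<Sum>i\<in>UNIV. of_real (h $ i) * conv u (partial i m) t)
      = (LINT x|lborel. u x * m (t + h - x) - u x * m (t - x) - (\<Sum>i\<in>UNIV. of_real (h $ i) * (u x * partial i m (t - x))))"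
      using i by (simp add: conv_def)
    also have "\<dots> = (LINT x|lborel. u x * (m (t + h - x) - m (t - x) - ?D (t - x) h))"
      by (simp add: right_diff_distrib sum_distrib_left mult.left_commute)
    finally show ?thesis by simp
  qed
  have lim: "(\<lambda>h. LINT x|lborel. ?q h x) \<midarrow>0\<rightarrow> 0"
  proof (rule iffD2[OF tendsto_at_iff_sequentially], intro allI impI, unfold comp_def)
    fix h :: "nat \<Rightarrow> real ^ 'n" assume h0: "\<forall>n. h n \<in> UNIV - {0}" and h: "h \<longlonglongrightarrow> 0"
    have hat: "filterlim h (at 0) sequentially" using h h0 by (simp add: filterlim_at)
    obtain N where N: "\<And>n. n \<ge> N \<Longrightarrow> norm (h n) < 1" using LIMSEQ_D[OF h, of 1] by auto
    have "(\<lambda>n. LINT x|lborel. ?q (h (n + N)) x) \<longlonglongrightarrow> (LINT x::real^'n|lborel. 0)"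
    proof (rule integral_dominated_convergence[where w="\<lambda>x. 2 * L * (norm (u x) * indicator (cball 0 (R + norm t + 1)) x)"])
      show "integrable lborel (\<lambda>x. 2 * L * (norm (u x) * indicator (cball 0 (R + norm t + 1)) x))"
        by (intro integrable_mult_right L2_indicator_cball_integrable u)
      show "AE x in lborel. (\<lambda>n. ?q (h (n + N)) x) \<longlonglongrightarrow> 0"
      proof (rule AE_I2)
        fix x
        have "((\<lambda>k. norm (m (t - x + k) - m (t - x) - ?D (t - x) k) / norm k) \<longlongrightarrow> 0) (at 0)"
          using smooth_has_derivative[OF test_functions_smooth[OF m], of "t - x"] unfolding has_derivative_at by blast
        moreover have "norm (z /\<^sub>R norm k) = norm z / norm k" for z :: complex and k :: "real ^ 'n"
          by (simp add: divide_inverse_commute)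
        ultimately have "((\<lambda>k. (m (t - x + k) - m (t - x) - ?D (t - x) k) /\<^sub>R norm k) \<longlongrightarrow> 0) (at 0)"
          by (rule_tac tendsto_norm_zero_cancel) simp
        then have "(\<lambda>n. (m (t - x + h n) - m (t - x) - ?D (t - x) (h n)) /\<^sub>R norm (h n)) \<longlonglongrightarrow> 0"
          by (rule filterlim_compose[OF _ hat])
        then have "(\<lambda>n. u x * ((m (t - x + h (n + N)) - m (t - x) - ?D (t - x) (h (n + N))) /\<^sub>R norm (h (n + N)))) \<longlonglongrightarrow> u x * 0"
          by (intro tendsto_mult tendsto_const LIMSEQ_ignore_initial_segment)
        then show "(\<lambda>n. ?q (h (n + N)) x) \<longlonglongrightarrow> 0" by (simp add: algebra_simps)
      qed
      show "AE x in lborel. norm (?q (h (n + N)) x) \<le> 2 * L * (norm (u x) * indicator (cball 0 (R + norm t + 1)) x)" for n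
      proof (rule AE_I2)
        fix x
        let ?h = "h (n + N)"
        have hn: "norm ?h < 1" "norm ?h > 0" using N[of "n + N"] h0 by auto
        have "norm (m (t + ?h - x) - m (t - x) - ?D (t - x) ?h) \<le> norm (m (t + ?h - x) - m (t - x)) + norm (?D (t - x) ?h)"
          by (rule norm_triangle_ineq4)
        also have "\<dots> \<le> L * norm ?h + L * norm ?h"
          using L(2)[of "t + ?h - x" "t - x"] by (intro add_mono L(3)) simp
        finally have b: "norm (m (t + ?h - x) - m (t - x) - ?D (t - x) ?h) \<le> 2 * L * norm ?h" by simp
        show "norm (?q ?h x) \<le> 2 * L * (norm (u x) * indicator (cball 0 (R + norm t + 1)) x)"
        proof (cases "norm x \<le> R + norm t + 1")
          case True
          have "norm (?q ?h x) = inverse (norm ?h) * (norm (u x) * norm (m (t + ?h - x) - m (t - x) - ?D (t - x) ?h))"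
            by (simp add: norm_mult)
          also have "\<dots> \<le> inverse (norm ?h) * (norm (u x) * (2 * L * norm ?h))"
            by (intro mult_left_mono b) auto
          also have "\<dots> = 2 * L * norm (u x)" using hn by (simp add: field_simps)
          finally show ?thesis using True by simp
        next
          case False
          have "norm (t - x) > R" "norm (t + ?h - x) > R"
            using False norm_triangle_ineq2[of x t] norm_triangle_ineq2[of x "t + ?h"] norm_triangle_ineq[of t ?h] hn
            by (auto simp: norm_minus_commute)
          then show ?thesis using False L(1) R R' by simp
        qed
      qed
    qed auto
    then have "(\<lambda>n. LINT x|lborel. ?q (h (n + N)) x) \<longlonglongrightarrow> 0" by simp
    then show "(\<lambda>n. LINT x|lborel. ?q (h n) x) \<longlonglongrightarrow> 0" by (rule LIMSEQ_offset)
  qed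
  have bl: "bounded_linear (\<lambda>v. \<Sum>i\<in>UNIV. complex_of_real (v $ i) * conv u (partial i m) t)"
    by (intro bounded_linear_sum bounded_linear_mult_const bounded_linear_compose[OF bounded_linear_of_real bounded_linear_vec_nth])
  have "norm (conv u m (t + h) - conv u m t - (\<Sum>i\<in>UNIV. of_real (h $ i) * conv u (partial i m) t)) / norm h
      = norm (LINT x|lborel. ?q h x)" for h
    unfolding q[symmetric] by (simp add: divide_inverse_commute)
  then show ?thesis
    unfolding has_derivative_at using bl tendsto_norm_zero[OF lim] by simp
qed

lemma conv_partial:
  assumes "u \<in> L2" "m \<in> test_functions"
  shows "partial i (conv u m) = conv u (partial i m)"
proof
  fix t
  have "(\<Sum>j\<in>UNIV. complex_of_real (axis i 1 $ j) * conv u (partial j m) t) = (\<Sum>j\<in>UNIV. if j = i then conv u (partial j m) t else 0)"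
    by (rule sum.cong) (auto simp: axis_def)
  then show "partial i (conv u m) t = conv u (partial i m) t"
    by (simp add: partial_eqI[OF conv_has_derivative[OF assms]])
qed

lemma smooth_conv:
  assumes "u \<in> L2" "m \<in> test_functions" shows "smooth (conv u m)"
proof (rule smooth_coinduct[of _ "{conv u m |m. m \<in> test_functions}"])
  show "conv u m \<in> {conv u m |m. m \<in> test_functions}" using assms by blast
  show "f differentiable (at x)" if "f \<in> {conv u m |m. m \<in> test_functions}" for f x
    using that conv_has_derivative[OF assms(1)] by (auto simp: differentiable_def)
  show "partial i f \<in> {conv u m |m. m \<in> test_functions}" if "f \<in> {conv u m |m. m \<in> test_functions}" for f i
    using that conv_partial[OF assms(1)] test_functions_partial by blast
qed

lemma conv_support:
  assumes u: "AE x in lborel. norm x \<ge> A \<longrightarrow> u x = 0" and m: "\<And>x. norm x \<ge> B \<Longrightarrow> m x = 0"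
    and t: "norm t \<ge> A + B"
  shows "conv u m t = 0"
proof -
  have "AE x in lborel. u x * m (t - x) = 0"
    using u
  proof eventually_elim
    case (elim x)
    have "norm x \<ge> A \<or> norm (t - x) \<ge> B" using t norm_triangle_ineq2[of t x] by linarith
    with elim m show ?case by auto
  qed
  then show ?thesis unfolding conv_def by (rule integral_eq_zero_AE)
qed

lemma test_functions_conv:
  assumes "u \<in> L2" "m \<in> test_functions" "AE x in lborel. norm x \<ge> A \<longrightarrow> u x = 0"
  shows "conv u m \<in> test_functions"
proof -
  obtain B where B: "\<And>x. norm x \<ge> B \<Longrightarrow> m x = 0" using test_functions_support[OF assms(2)] by blast
  show ?thesis
    by (rule test_functionsI[OF smooth_conv[OF assms(1,2)], of "A + B"]) (rule conv_support[OF assms(3) B], auto)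
qed

text \<open>Cauchy-Schwarz after splitting \<open>w\<close> into two square roots. The formulation
  in \<open>ennreal\<close> also covers an infinite right-hand side and a non-integrable product,
  whose integral is 0 by convention.\<close>

lemma weighted_Cauchy_Schwarz:
  assumes [measurable]: "f \<in> borel_measurable M" "w \<in> borel_measurable M" and w: "\<And>x. w x \<ge> 0"
  shows "ennreal ((norm (LINT x|M. f x * complex_of_real (w x)))\<^sup>2)
    \<le> (\<integral>\<^sup>+x. ennreal ((norm (f x))\<^sup>2 * w x) \<partial>M) * (\<integral>\<^sup>+x. ennreal (w x) \<partial>M)"
proof -
  have "ennreal (norm (LINT x|M. f x * complex_of_real (w x))) \<le> (\<integral>\<^sup>+x. ennreal (norm (f x * complex_of_real (w x))) \<partial>M)"
    by (cases "integrable M (\<lambda>x. f x * complex_of_real (w x))")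
       (auto intro: integral_norm_bound_ennreal simp: not_integrable_integral_eq)
  also have "\<dots> = (\<integral>\<^sup>+x. ennreal (norm (f x) * sqrt (w x)) * ennreal (sqrt (w x)) \<partial>M)"
    using w by (intro nn_integral_cong) (auto simp: norm_mult ennreal_mult[symmetric] mult.assoc)
  finally have "ennreal (norm (LINT x|M. f x * complex_of_real (w x))) ^ 2
      \<le> (\<integral>\<^sup>+x. ennreal (norm (f x) * sqrt (w x)) * ennreal (sqrt (w x)) \<partial>M)\<^sup>2"
    by (rule power_mono) simp
  also have "\<dots> \<le> (\<integral>\<^sup>+x. ennreal (norm (f x) * sqrt (w x)) ^ 2 \<partial>M) * (\<integral>\<^sup>+x. ennreal (sqrt (w x)) ^ 2 \<partial>M)"
    by (rule Cauchy_Schwarz_nn_integral) auto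
  also have "\<dots> = (\<integral>\<^sup>+x. ennreal ((norm (f x))\<^sup>2 * w x) \<partial>M) * (\<integral>\<^sup>+x. ennreal (w x) \<partial>M)"
    using w by (simp add: ennreal_power power_mult_distrib)
  finally show ?thesis by (simp add: ennreal_power)
qed

text \<open>Young's inequality for an L1 kernel: \<open>weighted_Cauchy_Schwarz\<close> with weight
  \<open>norm m\<close> at each point, then Tonelli and translation invariance.\<close>

lemma conv_L2:
  fixes u :: "real ^ 'n \<Rightarrow> complex"
  assumes u: "u \<in> L2" and m: "m \<in> test_functions"
  shows "conv u m \<in> L2"
proof (rule L2I)
  note [measurable] = L2_measurable[OF u] smooth_measurable[OF test_functions_smooth[OF m]]
  show [measurable]: "conv u m \<in> borel_measurable borel"
    by (rule smooth_measurable[OF smooth_conv[OF u m]])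
  have im: "integrable lborel (\<lambda>x. norm (m x))" by (rule integrable_norm[OF test_functions_integrable[OF m]])
  define W where "W = (LINT x|lborel. norm (m x))"
  have W: "(\<integral>\<^sup>+x. ennreal (norm (m (t - x))) \<partial>lborel) = ennreal W" for t
    using nn_integral_eq_integral[OF integrable_translate(2)[OF im, of t]] integral_translate(2)[OF im, of t]
    by (simp add: W_def)
  have W': "(\<integral>\<^sup>+t. ennreal (norm (m (t - x))) \<partial>lborel) = ennreal W" for x
    using nn_integral_eq_integral[OF integrable_translate(1)[OF im, of "- x"]] integral_translate(1)[OF im, of "- x"]
    by (simp add: W_def)
  have W0: "W \<ge> 0" unfolding W_def by (intro integral_nonneg_AE) auto
  show "integrable lborel (\<lambda>t. (norm (conv u m t))\<^sup>2)"
  proof (rule integrableI_bounded)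
    have pt: "ennreal (norm ((norm (conv u m t))\<^sup>2)) \<le> (\<integral>\<^sup>+x. ennreal ((norm (u x))\<^sup>2) * ennreal (norm (m (t - x))) \<partial>lborel) * ennreal W" for t
    proof -
      \<comment> \<open>The phase of the complex kernel is moved into the first factor, which leaves
        the nonnegative weight \<open>norm m\<close>.\<close>
      let ?f = "\<lambda>x. u x * sgn (m (t - x))"
      have "conv u m t = (LINT x|lborel. ?f x * complex_of_real (norm (m (t - x))))"
      proof -
        have "sgn z * complex_of_real (norm z) = z" for z :: complex
          by (cases "z = 0") (simp_all add: sgn_div_norm scaleR_conv_of_real)
        then show ?thesis unfolding conv_def by (simp add: mult.assoc)
      qed
      moreover have "ennreal ((norm (LINT x|lborel. ?f x * complex_of_real (norm (m (t - x)))))\<^sup>2)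
         \<le> (\<integral>\<^sup>+x. ennreal ((norm (?f x))\<^sup>2 * norm (m (t - x))) \<partial>lborel) * (\<integral>\<^sup>+x. ennreal (norm (m (t - x))) \<partial>lborel)"
        by (rule weighted_Cauchy_Schwarz) (auto simp: sgn_div_norm)
      moreover have "(\<integral>\<^sup>+x. ennreal ((norm (?f x))\<^sup>2 * norm (m (t - x))) \<partial>lborel)
         = (\<integral>\<^sup>+x. ennreal ((norm (u x))\<^sup>2) * ennreal (norm (m (t - x))) \<partial>lborel)"
        by (intro nn_integral_cong) (auto simp: norm_mult norm_sgn ennreal_mult)
      ultimately show ?thesis by (simp add: W)
    qed
    have "(\<integral>\<^sup>+t. ennreal (norm ((norm (conv u m t))\<^sup>2)) \<partial>lborel)
      \<le> (\<integral>\<^sup>+t. (\<integral>\<^sup>+x. ennreal ((norm (u x))\<^sup>2) * ennreal (norm (m (t - x))) \<partial>lborel) * ennreal W \<partial>lborel)"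
      by (intro nn_integral_mono pt)
    also have "\<dots> = (\<integral>\<^sup>+t. (\<integral>\<^sup>+x. ennreal ((norm (u x))\<^sup>2) * ennreal (norm (m (t - x))) \<partial>lborel) \<partial>lborel) * ennreal W"
      by (rule nn_integral_multc) measurable
    also have "(\<integral>\<^sup>+t. (\<integral>\<^sup>+x. ennreal ((norm (u x))\<^sup>2) * ennreal (norm (m (t - x))) \<partial>lborel) \<partial>lborel)
      = (\<integral>\<^sup>+x. (\<integral>\<^sup>+t. ennreal ((norm (u x))\<^sup>2) * ennreal (norm (m (t - x))) \<partial>lborel) \<partial>lborel)"
      by (rule lborel_pair.Fubini') measurable
    also have "\<dots> = (\<integral>\<^sup>+x. ennreal ((norm (u x))\<^sup>2) * ennreal W \<partial>lborel)"
      by (simp add: nn_integral_cmult W')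
    also have "\<dots> = ennreal (sqn u) * ennreal W"
      by (simp add: nn_integral_multc nn_sqn[OF u])
    finally show "(\<integral>\<^sup>+t. ennreal (norm ((norm (conv u m t))\<^sup>2)) \<partial>lborel) < \<infinity>"
      by (rule le_less_trans) (simp add: ennreal_mult_less_top)
  qed simp
qed

definition moll :: "(real ^ 'n \<Rightarrow> real) \<Rightarrow> real \<Rightarrow> real ^ 'n \<Rightarrow> complex" where
  "moll r e x = of_real (r (inverse e *\<^sub>R x) / e ^ CARD('n))"

text \<open>After rescaling, the error at \<open>t\<close> is an \<open>r\<close>-average of
  differences of \<open>u\<close>. By \<open>weighted_Cauchy_Schwarz\<close> and Tonelli its squared
  norm is at most the \<open>r\<close>-average of \<open>\<omega> (- e n z)\<close>. This modulus of
  continuity is bounded by \<open>4 * sqn u\<close> and tends to 0 by continuity of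
  translations.\<close>

lemma conv_moll_tendsto:
  fixes r :: "real ^ 'n \<Rightarrow> real"
  assumes u: "u \<in> L2" and r: "integrable lborel r" "continuous_on UNIV r" "\<And>x. r x \<ge> 0" "(LINT x|lborel. r x) = 1"
    and m: "\<And>n. moll r (e n) \<in> test_functions" and e: "\<And>n. e n > 0" "e \<longlonglongrightarrow> 0"
  shows "(\<lambda>n. sqn (\<lambda>t. conv u (moll r (e n)) t - u t)) \<longlonglongrightarrow> 0"
proof -
  note [measurable] = L2_measurable[OF u] borel_measurable_continuous_onI[OF r(2)]
  define \<omega> where "\<omega> h = sqn (\<lambda>t. u (t + h) - u t)" for h
  have diffL: "(\<lambda>t. u (t + h) - u t) \<in> L2" for h by (intro L2_diff L2_translate u)
  have \<omega>0: "\<omega> h \<ge> 0" for h by (simp add: \<omega>_def sqn_nonneg)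
  have [measurable]: "\<omega> \<in> borel_measurable borel" unfolding \<omega>_def sqn_def by measurable
  have \<omega>4: "\<omega> h \<le> 4 * sqn u" for h
  proof -
    have "\<omega> h \<le> 2 * sqn (\<lambda>t. u (t + h)) + 2 * sqn (\<lambda>t. - u t)"
      unfolding \<omega>_def using sqn_add[OF L2_translate(1)[OF u, of h] L2_cmult[OF u, of "-1"]] by simp
    then show ?thesis by (simp add: sqn_translate[OF u]) (simp add: sqn_def)
  qed
  have r1: "(\<integral>\<^sup>+x. ennreal (r x) \<partial>lborel) = 1"
    using nn_integral_eq_integral[OF r(1)] r(3,4) by simp
  have iw: "integrable lborel (\<lambda>z. 4 * sqn u * r z)" using r(1) by simp
  have io: "integrable lborel (\<lambda>z. \<omega> (- (e n *\<^sub>R z)) * r z)" for n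
    by (rule Bochner_Integration.integrable_bound[OF iw])
       (use \<omega>0 \<omega>4 r(3) in \<open>auto intro!: AE_I2 mult_right_mono simp: abs_mult sqn_nonneg\<close>)
  have le: "sqn (\<lambda>t. conv u (moll r (e n)) t - u t) \<le> (LINT z|lborel. \<omega> (- (e n *\<^sub>R z)) * r z)" for n
  proof -
    let ?c = "conv u (moll r (e n))"
    have pt: "ennreal ((norm (?c t - u t))\<^sup>2) \<le> (\<integral>\<^sup>+z. ennreal ((norm (u (t + - (e n *\<^sub>R z)) - u t))\<^sup>2 * r z) \<partial>lborel)" for t
    proof -
      let ?f = "\<lambda>x. u x * moll r (e n) (t - x)"
      have if': "integrable lborel ?f" by (rule conv_integrable[OF u m])
      have eq: "?f (t + - e n *\<^sub>R z) = u (t + - (e n *\<^sub>R z)) * of_real (r z) / of_real (e n ^ CARD('n))" for z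
        using e(1)[of n] by (simp add: moll_def)
      have i1: "integrable lborel (\<lambda>z. u (t + - (e n *\<^sub>R z)) * of_real (r z))"
      proof -
        have "integrable lborel (\<lambda>z. of_real (e n ^ CARD('n)) * ?f (t + - e n *\<^sub>R z))"
          by (intro integrable_mult_right integrable_affine[OF if']) (use e(1)[of n] in auto)
        then show ?thesis unfolding eq using e(1)[of n] by simp
      qed
      have "?c t = of_real (e n ^ CARD('n)) * (LINT z|lborel. ?f (t + - e n *\<^sub>R z))"
        unfolding conv_def using e(1)[of n] by (subst integral_affine[OF _ if', of "- e n" t]) (auto simp: scaleR_conv_of_real)
      also have "\<dots> = (LINT z|lborel. u (t + - (e n *\<^sub>R z)) * of_real (r z))"
        unfolding eq using e(1)[of n] by simp
      finally have c: "?c t = (LINT z|lborel. u (t + - (e n *\<^sub>R z)) * of_real (r z))" .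
      have i2: "integrable lborel (\<lambda>z. u t * of_real (r z))" using r(1) by simp
      have "u t = (LINT z|lborel. u t * of_real (r z))" using r(1,4) by simp
      then have "?c t - u t = (LINT z|lborel. (u (t + - (e n *\<^sub>R z)) - u t) * of_real (r z))"
        using i1 i2 c by (simp add: left_diff_distrib)
      with weighted_Cauchy_Schwarz[of "\<lambda>z. u (t + - (e n *\<^sub>R z)) - u t" lborel r] r(3) show ?thesis
        by (simp add: r1)
    qed
    have "ennreal (sqn (\<lambda>t. ?c t - u t)) = (\<integral>\<^sup>+t. ennreal ((norm (?c t - u t))\<^sup>2) \<partial>lborel)"
      by (rule nn_sqn[symmetric]) (intro L2_diff conv_L2 u m)
    also have "\<dots> \<le> (\<integral>\<^sup>+t. (\<integral>\<^sup>+z. ennreal ((norm (u (t + - (e n *\<^sub>R z)) - u t))\<^sup>2 * r z) \<partial>lborel) \<partial>lborel)"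
      by (intro nn_integral_mono pt)
    also have "\<dots> = (\<integral>\<^sup>+z. (\<integral>\<^sup>+t. ennreal ((norm (u (t + - (e n *\<^sub>R z)) - u t))\<^sup>2 * r z) \<partial>lborel) \<partial>lborel)"
      by (rule lborel_pair.Fubini') measurable
    also have "\<dots> = (\<integral>\<^sup>+z. ennreal (\<omega> (- (e n *\<^sub>R z)) * r z) \<partial>lborel)"
    proof (rule nn_integral_cong)
      fix z
      have "(\<integral>\<^sup>+t. ennreal ((norm (u (t + - (e n *\<^sub>R z)) - u t))\<^sup>2 * r z) \<partial>lborel)
        = (\<integral>\<^sup>+t. ennreal ((norm (u (t + - (e n *\<^sub>R z)) - u t))\<^sup>2) \<partial>lborel) * ennreal (r z)"
        using r(3)[of z] by (subst nn_integral_multc[symmetric]) (auto simp: ennreal_mult)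
      also have "\<dots> = ennreal (\<omega> (- (e n *\<^sub>R z))) * ennreal (r z)"
        unfolding \<omega>_def by (subst nn_sqn[OF diffL]) simp
      finally show "(\<integral>\<^sup>+t. ennreal ((norm (u (t + - (e n *\<^sub>R z)) - u t))\<^sup>2 * r z) \<partial>lborel) = ennreal (\<omega> (- (e n *\<^sub>R z)) * r z)"
        using r(3)[of z] \<omega>0 by (simp add: ennreal_mult)
    qed
    also have "\<dots> = ennreal (LINT z|lborel. \<omega> (- (e n *\<^sub>R z)) * r z)"
      by (rule nn_integral_eq_integral[OF io]) (use \<omega>0 r(3) in auto)
    finally show ?thesis
      by (subst (asm) ennreal_le_iff) (auto intro!: integral_nonneg_AE simp: \<omega>0 r(3))
  qed
  have "(\<lambda>n. LINT z|lborel. \<omega> (- (e n *\<^sub>R z)) * r z) \<longlonglongrightarrow> (LINT z::real^'n|lborel. 0)"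
  proof (rule integral_dominated_convergence[OF _ _ iw])
    show "AE z in lborel. norm (\<omega> (- (e n *\<^sub>R z)) * r z) \<le> 4 * sqn u * r z" for n
      using \<omega>0 \<omega>4 r(3) by (auto intro!: AE_I2 mult_right_mono simp: abs_mult)
    have "(\<lambda>n. \<omega> (- (e n *\<^sub>R z)) * r z) \<longlonglongrightarrow> 0 * r z" for z
    proof (intro tendsto_mult tendsto_const)
      have "(\<lambda>n. - (e n *\<^sub>R z)) \<longlonglongrightarrow> - (0 *\<^sub>R z)" by (intro tendsto_intros e)
      then show "(\<lambda>n. \<omega> (- (e n *\<^sub>R z))) \<longlonglongrightarrow> 0"
        unfolding \<omega>_def by (intro L2_translation_continuous u) simp
    qed
    then show "AE z in lborel. (\<lambda>n. \<omega> (- (e n *\<^sub>R z)) * r z) \<longlonglongrightarrow> 0" by simp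
  qed auto
  then have "(\<lambda>n. LINT z|lborel. \<omega> (- (e n *\<^sub>R z)) * r z) \<longlonglongrightarrow> 0" by simp
  then show ?thesis
    by (rule tendsto_sandwich[OF _ _ tendsto_const, rotated 2]) (use le in \<open>auto simp: sqn_nonneg\<close>)
qed

text \<open>The fixed support radius 1 controls supports of mollified functions, while the shrinking
  radii \<open>e n\<close> localise at a point. The equation with \<open>norm\<close> expresses that
  the complex-valued \<open>m n\<close> is real and nonnegative; together with unit mass it makes
  \<open>m n\<close> an averaging kernel.\<close>

lemma exists_mollifiers:
  obtains m :: "nat \<Rightarrow> real ^ 'n \<Rightarrow> complex" and e :: "nat \<Rightarrow> real"
  where "\<And>n. m n \<in> test_functions" "\<And>n x. norm x \<ge> 1 \<Longrightarrow> m n x = 0"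
    "\<And>n x. norm x \<ge> e n \<Longrightarrow> m n x = 0" "e \<longlonglongrightarrow> 0"
    "\<And>n x. m n x = of_real (norm (m n x))" "\<And>n. (LINT x|lborel. m n x) = 1"
    "\<And>u. u \<in> L2 \<Longrightarrow> (\<lambda>n. sqn (\<lambda>t. conv u (m n) t - u t)) \<longlonglongrightarrow> 0"
proof -
  obtain r :: "real ^ 'n \<Rightarrow> real"
    where r: "(\<lambda>x. complex_of_real (r x)) \<in> test_functions" "\<And>x. r x \<ge> 0" "\<And>x. norm x \<ge> 1 \<Longrightarrow> r x = 0"
      "r 0 > 0" "(LINT x|lborel. r x) = 1" "continuous_on UNIV r" "integrable lborel r"
    using exists_mollifier by blast
  define e where "e n = inverse (real (Suc n))" for n
  have e: "e n > 0" "e n \<le> 1" for n by (auto simp: e_def field_simps)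
  have e0: "e \<longlonglongrightarrow> 0" unfolding e_def by (rule LIMSEQ_inverse_real_of_nat)
  have t: "moll r (e n) \<in> test_functions" for n
  proof -
    have "(\<lambda>x. complex_of_real (r (inverse (e n) *\<^sub>R x + 0)) * of_real (inverse (e n ^ CARD('n)))) \<in> test_functions"
      by (intro test_functions_mult test_functions_affine[OF r(1)]) (use e[of n] in auto)
    then show ?thesis by (simp add: moll_def[abs_def] divide_inverse)
  qed
  have s: "moll r (e n) x = 0" if "norm x \<ge> e n" for n x
    using that e[of n] by (simp add: moll_def r(3) field_simps)
  show thesis
  proof (rule that[of "\<lambda>n. moll r (e n)" e])
    show "moll r (e n) \<in> test_functions" for n by (rule t)
    show "moll r (e n) x = 0" if "norm x \<ge> e n" for n x using that by (rule s)
    show "moll r (e n) x = 0" if "norm x \<ge> 1" for n x using that e(2)[of n] by (intro s) linarith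
    show "e \<longlonglongrightarrow> 0" by (rule e0)
    show "moll r (e n) x = of_real (norm (moll r (e n) x))" for n x
      using e(1)[of n] r(2) by (simp add: moll_def norm_divide norm_power)
    show "(LINT x|lborel. moll r (e n) x) = 1" for n
    proof -
      have "(LINT x|lborel. moll r (e n) x) = of_real (e n ^ CARD('n)) * (LINT x|lborel. moll r (e n) (e n *\<^sub>R x))"
        using integral_affine[OF _ test_functions_integrable[OF t[of n]], of "e n" 0] e(1)[of n]
        by (simp add: scaleR_conv_of_real)
      also have "\<dots> = of_real (LINT x|lborel. r x)"
        unfolding integral_complex_of_real[symmetric] integral_mult_right_zero[symmetric]
        using e(1)[of n] by (simp add: moll_def)
      finally show ?thesis by (simp add: r)
    qed
    show "(\<lambda>n. sqn (\<lambda>ta. conv u (moll r (e n)) ta - u ta)) \<longlonglongrightarrow> 0" if "u \<in> L2" for u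
      by (rule conv_moll_tendsto[OF that r(7,6,2,5) t e(1) e0])
  qed
qed

lemma smooth_has_vector_derivative:
  assumes "smooth f"
  shows "((\<lambda>s. f (y + s *\<^sub>R axis i 1)) has_vector_derivative partial i f (y + s *\<^sub>R axis i 1)) (at s within S)"
proof -
  let ?z = "y + s *\<^sub>R axis i 1"
  have d: "(f has_derivative frechet_derivative f (at ?z)) (at ?z)"
    using smooth_differentiable[OF assms] frechet_derivative_works by blast
  have "((\<lambda>s. f (y + s *\<^sub>R axis i 1)) has_derivative (\<lambda>h. frechet_derivative f (at ?z) (h *\<^sub>R axis i 1))) (at s within S)"
    by (rule has_derivative_compose[where f="\<lambda>s. y + s *\<^sub>R axis i 1" and g=f and g'="frechet_derivative f (at ?z)", OF _ d])
       (auto intro!: derivative_eq_intros)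
  then show ?thesis
    using linear_scale[OF has_derivative_linear[OF d]] by (simp add: has_vector_derivative_def partial_def)
qed

text \<open>Write the increment of \<open>f\<close> along \<open>axis i\<close> as an integral of
  \<open>partial i f\<close>, differentiate under the integral in direction \<open>j\<close>, and
  finally in \<open>h\<close> at 0. The last derivative is one-sided because the formula is proved
  for \<open>h \<ge> 0\<close>.\<close>

lemma partial_commute:
  fixes f :: "real ^ 'n \<Rightarrow> complex"
  assumes f: "smooth f"
  shows "partial i (partial j f) x = partial j (partial i f) x"
proof -
  let ?i = "axis i 1 :: real ^ 'n" and ?j = "axis j 1 :: real ^ 'n"
  note si = smooth_partial[OF f, of i] and sj = smooth_partial[OF f, of j]
  have eq: "partial j f (x + h *\<^sub>R ?i) = partial j f x + integral {0..h} (\<lambda>s. partial j (partial i f) (x + s *\<^sub>R ?i))"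
    if h: "h \<ge> 0" for h
  proof -
    have ftc: "integral (cbox 0 h) (\<lambda>s. partial i f (x + t *\<^sub>R ?j + s *\<^sub>R ?i)) = f (x + t *\<^sub>R ?j + h *\<^sub>R ?i) - f (x + t *\<^sub>R ?j + 0 *\<^sub>R ?i)" for t
      using fundamental_theorem_of_calculus[OF h smooth_has_vector_derivative[OF f, of "x + t *\<^sub>R ?j" i]]
      by (simp add: integral_unique)
    have "((\<lambda>t. integral (cbox 0 h) (\<lambda>s. partial i f (x + s *\<^sub>R ?i + t *\<^sub>R ?j))) has_vector_derivative
        integral (cbox 0 h) (\<lambda>s. partial j (partial i f) (x + s *\<^sub>R ?i + 0 *\<^sub>R ?j))) (at 0 within UNIV)"
    proof (rule leibniz_rule_vector_derivative)
      show "((\<lambda>t. partial i f (x + s *\<^sub>R ?i + t *\<^sub>R ?j)) has_vector_derivative partial j (partial i f) (x + s *\<^sub>R ?i + t *\<^sub>R ?j)) (at t within UNIV)" for s t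
        by (rule smooth_has_vector_derivative[OF si])
      show "(\<lambda>s. partial i f (x + s *\<^sub>R ?i + t *\<^sub>R ?j)) integrable_on cbox 0 h" for t
        by (intro integrable_continuous continuous_on_compose2[OF smooth_continuous[OF si, of UNIV]] continuous_intros) auto
      show "continuous_on (UNIV \<times> cbox 0 h) (\<lambda>(t, s). partial j (partial i f) (x + s *\<^sub>R ?i + t *\<^sub>R ?j))"
        unfolding split_beta
        by (intro continuous_on_compose2[OF smooth_continuous[OF smooth_partial[OF si], of UNIV]] continuous_intros) auto
    qed auto
    then have 1: "((\<lambda>t. f (x + h *\<^sub>R ?i + t *\<^sub>R ?j) - f (x + t *\<^sub>R ?j)) has_vector_derivative
        integral (cbox 0 h) (\<lambda>s. partial j (partial i f) (x + s *\<^sub>R ?i))) (at 0)"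
      using ftc by (simp add: add_ac)
    have 2: "((\<lambda>t. f (x + h *\<^sub>R ?i + t *\<^sub>R ?j) - f (x + t *\<^sub>R ?j)) has_vector_derivative
        partial j f (x + h *\<^sub>R ?i + 0 *\<^sub>R ?j) - partial j f (x + 0 *\<^sub>R ?j)) (at 0)"
      by (intro has_vector_derivative_diff smooth_has_vector_derivative f)
    from vector_derivative_unique_at[OF 1 2] show ?thesis by (simp add: algebra_simps)
  qed
  have "((\<lambda>h. integral {0..h} (\<lambda>s. partial j (partial i f) (x + s *\<^sub>R ?i))) has_vector_derivative partial j (partial i f) (x + 0 *\<^sub>R ?i)) (at 0 within {0..1})"
    by (rule integral_has_vector_derivative)
       (auto intro!: continuous_on_compose2[OF smooth_continuous[OF smooth_partial[OF si], of UNIV]] continuous_intros)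
  then have "((\<lambda>h. partial j f x + integral {0..h} (\<lambda>s. partial j (partial i f) (x + s *\<^sub>R ?i))) has_vector_derivative 0 + partial j (partial i f) (x + 0 *\<^sub>R ?i)) (at 0 within {0..1})"
    by (intro has_vector_derivative_add has_vector_derivative_const)
  then have 1: "((\<lambda>h. partial j f (x + h *\<^sub>R ?i)) has_vector_derivative partial j (partial i f) x) (at 0 within {0..1})"
    by (rule has_vector_derivative_transform[rotated 2, THEN back_subst[where P="\<lambda>z. (_ has_vector_derivative z) _"]]) (auto simp: eq)
  have 2: "((\<lambda>h. partial j f (x + h *\<^sub>R ?i)) has_vector_derivative partial i (partial j f) (x + 0 *\<^sub>R ?i)) (at 0 within {0..1})"
    by (rule smooth_has_vector_derivative[OF sj])
  show ?thesis
    using vector_derivative_unique_within[OF _ 1 2] by (simp add: trivial_limit_within islimpt_Icc)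
qed

text \<open>The classical pointwise Laplacian, used for smooth functions; \<open>laplacian\<close>
  is the one built from weak derivatives.\<close>

definition lap :: "(real ^ 'n \<Rightarrow> complex) \<Rightarrow> real ^ 'n \<Rightarrow> complex" where
  "lap f x = (\<Sum>i\<in>UNIV. partial i (partial i f) x)"

text \<open>\<open>weak_lap u g\<close> means \<open>\<Delta> u = g\<close> in the sense of distributions.\<close>

definition weak_lap :: "(real ^ 'n \<Rightarrow> complex) \<Rightarrow> (real ^ 'n \<Rightarrow> complex) \<Rightarrow> bool" where
  "weak_lap u g \<longleftrightarrow> (\<forall>\<phi>\<in>test_functions. (LINT x|lborel. u x * lap \<phi> x) = (LINT x|lborel. g x * \<phi> x))"

text \<open>All derivatives of the convolution fall on \<open>m\<close>, and the reflected translate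
  \<open>m (t - x)\<close> is itself a test function. Its second derivatives carry two sign changes,
  which cancel, so the weak equation can be applied to it.\<close>

lemma lap_conv:
  fixes u :: "real ^ 'n \<Rightarrow> complex"
  assumes u: "u \<in> L2" and m: "m \<in> test_functions" and w: "weak_lap u g"
  shows "lap (conv u m) t = conv g m t"
proof -
  let ?\<phi> = "\<lambda>x. m (t - x)"
  have p: "partial i (\<lambda>x. f (t - x)) x = - partial i f (t - x)" if "smooth f" for f :: "real ^ 'n \<Rightarrow> complex" and i x
    using partial_affine(1)[OF smooth_differentiable[OF that], where i=i and c="-1" and d=t] by (simp add: uminus_add_conv_diff)
  have sm: "smooth m" "smooth (partial i m)" for i
    by (rule test_functions_smooth[OF m], rule smooth_partial[OF test_functions_smooth[OF m]])
  have "partial i ?\<phi> = (\<lambda>x. - partial i m (t - x))" for i using p[OF sm(1)] by auto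
  moreover have "partial i (\<lambda>x. - partial i m (t - x)) x = partial i (partial i m) (t - x)" for i x
  proof -
    have "(\<lambda>x. partial i m (t - x)) differentiable (at x)"
      using partial_affine(2)[OF smooth_differentiable[OF sm(2)], where c="-1" and d=t] by (simp add: uminus_add_conv_diff)
    from partial_cmult[OF this, of i "-1"] show ?thesis by (simp add: p[OF sm(2)])
  qed
  ultimately have l: "lap ?\<phi> x = (\<Sum>i\<in>UNIV. partial i (partial i m) (t - x))" for x by (simp add: lap_def)
  have m2: "partial i (partial i m) \<in> test_functions" for i by (intro test_functions_partial m)
  have "lap (conv u m) t = (\<Sum>i\<in>UNIV. conv u (partial i (partial i m)) t)"
    unfolding lap_def by (simp add: conv_partial u m test_functions_partial)
  also have "\<dots> = (LINT x|lborel. u x * lap ?\<phi> x)"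
    unfolding l sum_distrib_left conv_def
    by (rule Bochner_Integration.integral_sum[symmetric]) (rule conv_integrable[OF u m2])
  also have "\<dots> = conv g m t"
    using w test_functions_reflect[OF m] unfolding weak_lap_def conv_def by blast
  finally show ?thesis .
qed

lemma partial_smooth_mult:
  "smooth f \<Longrightarrow> smooth g \<Longrightarrow> partial i (\<lambda>x. f x * g x) = (\<lambda>x. f x * partial i g x + partial i f x * g x)"
  by (rule ext) (rule partial_mult[OF smooth_differentiable smooth_differentiable])

lemma partial_smooth_cnj: "smooth f \<Longrightarrow> partial i (\<lambda>x. cnj (f x)) = (\<lambda>x. cnj (partial i f x))"
  by (rule ext) (rule smooth_cnj(2))

lemma L2_sum:
  "finite A \<Longrightarrow> (\<And>a. a \<in> A \<Longrightarrow> f a \<in> L2) \<Longrightarrow> (\<lambda>x. \<Sum>a\<in>A. f a x) \<in> L2"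
proof (induction A rule: finite_induct)
  case empty
  show ?case by (rule L2_bounded_support[of _ 0 0]) auto
next
  case (insert a A)
  then show ?case using L2_add[of "f a" "\<lambda>x. \<Sum>a\<in>A. f a x"] by simp
qed

text \<open>For the mollified functions the pairing is minus the Dirichlet energy, and sign and reality survive the limit; no
  convergence of the gradients is needed.\<close>

lemma weak_lap_energy:
  fixes u g :: "real ^ 'n \<Rightarrow> complex"
  assumes u: "u \<in> L2" and g: "g \<in> L2" and w: "weak_lap u g"
  shows "Im (LINT x|lborel. g x * cnj (u x)) = 0" "Re (LINT x|lborel. g x * cnj (u x)) \<le> 0"
proof -
  obtain m :: "nat \<Rightarrow> real ^ 'n \<Rightarrow> complex"
    where m: "\<And>n. m n \<in> test_functions"
      and lim: "\<And>u. u \<in> L2 \<Longrightarrow> (\<lambda>n. sqn (\<lambda>t. conv u (m n) t - u t)) \<longlonglongrightarrow> 0"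
    by (rule exists_mollifiers) (rule that; assumption)
  let ?w = "\<lambda>n. conv u (m n)" and ?g = "\<lambda>n. conv g (m n)"
  have energy: "(LINT x|lborel. ?g n x * cnj (?w n x)) = of_real (- (\<Sum>i\<in>UNIV. sqn (partial i (?w n))))" for n
  proof -
    have sw: "smooth (?w n)" by (rule smooth_conv[OF u m])
    \<comment> \<open>Derivatives fall on the mollifier, so all of them are in L2 and integration by
      parts is available on the whole space.\<close>
    have L: "?w n \<in> L2" "partial i (?w n) \<in> L2" "partial i (partial i (?w n)) \<in> L2" for i
      by (simp_all add: conv_partial u m test_functions_partial conv_L2)
    have ibp: "(LINT x|lborel. partial i (partial i (?w n)) x * cnj (?w n x)) = - of_real (sqn (partial i (?w n)))" for i
    proof -
      let ?F = "\<lambda>x. partial i (?w n) x * cnj (?w n x)"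
      have I: "integrable lborel (\<lambda>x. partial i (?w n) x * cnj (partial i (?w n) x))"
        "integrable lborel (\<lambda>x. partial i (partial i (?w n)) x * cnj (?w n x))"
        by (intro L2_mult_integrable L2_cnj L)+
      have pF: "partial i ?F = (\<lambda>x. partial i (?w n) x * cnj (partial i (?w n) x) + partial i (partial i (?w n)) x * cnj (?w n x))"
        using partial_smooth_mult[OF smooth_partial[OF sw] smooth_cnj(1)[OF sw]] by (simp add: partial_smooth_cnj[OF sw])
      have "(LINT x|lborel. partial i ?F x) = 0"
      proof (rule integral_partial_eq_0)
        show "smooth ?F" by (intro smooth_mult smooth_partial smooth_cnj sw)
        show "integrable lborel ?F" by (intro L2_mult_integrable L2_cnj L)
        show "integrable lborel (partial i ?F)" unfolding pF by (intro Bochner_Integration.integrable_add I)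
      qed
      then have "(LINT x|lborel. partial i (?w n) x * cnj (partial i (?w n) x)) + (LINT x|lborel. partial i (partial i (?w n)) x * cnj (?w n x)) = 0"
        unfolding pF using I by simp
      then show ?thesis unfolding sqn_eq_inner[symmetric] by (simp add: add_eq_0_iff)
    qed
    have "(LINT x|lborel. ?g n x * cnj (?w n x)) = (LINT x|lborel. (\<Sum>i\<in>UNIV. partial i (partial i (?w n)) x * cnj (?w n x)))"
      by (simp add: lap_conv[OF u m w, symmetric] lap_def sum_distrib_right)
    also have "\<dots> = (\<Sum>i\<in>UNIV. LINT x|lborel. partial i (partial i (?w n)) x * cnj (?w n x))"
      by (rule Bochner_Integration.integral_sum) (intro L2_mult_integrable L2_cnj L)
    also have "\<dots> = of_real (- (\<Sum>i\<in>UNIV. sqn (partial i (?w n))))"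
      by (simp add: ibp sum_negf)
    finally show ?thesis .
  qed
  have "(\<lambda>n. LINT x|lborel. ?g n x * cnj (?w n x)) \<longlonglongrightarrow> (LINT x|lborel. g x * cnj (u x))"
  proof (rule L2_pairing_tendsto)
    show "(\<lambda>n. sqn (\<lambda>x. cnj (?w n x) - cnj (u x))) \<longlonglongrightarrow> 0"
      using lim[OF u] unfolding sqn_def complex_cnj_diff[symmetric] complex_mod_cnj .
  qed (intro conv_L2 g m lim L2_cnj u)+
  then have lim': "(\<lambda>n. complex_of_real (- (\<Sum>i\<in>UNIV. sqn (partial i (?w n))))) \<longlonglongrightarrow> (LINT x|lborel. g x * cnj (u x))"
    unfolding energy .
  from tendsto_Im[OF lim'] have "(\<lambda>n. 0) \<longlonglongrightarrow> Im (LINT x|lborel. g x * cnj (u x))" by simp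
  then show "Im (LINT x|lborel. g x * cnj (u x)) = 0" using LIMSEQ_unique tendsto_const by blast
  from tendsto_Re[OF lim'] have "(\<lambda>n. - (\<Sum>i\<in>UNIV. sqn (partial i (?w n)))) \<longlonglongrightarrow> Re (LINT x|lborel. g x * cnj (u x))" by simp
  then show "Re (LINT x|lborel. g x * cnj (u x)) \<le> 0"
    by (rule LIMSEQ_le_const2) (auto intro!: exI[of _ 0] sum_nonneg sqn_nonneg)
qed

section \<open>A Carleman estimate with linear weight\<close>

lemma integral_by_parts_test:
  assumes f: "f \<in> test_functions" and g: "smooth g"
  shows "(LINT x|lborel. f x * partial i g x) = - (LINT x|lborel. partial i f x * g x)"
proof -
  have t: "(\<lambda>x. f x * g x) \<in> test_functions" "(\<lambda>x. f x * partial i g x) \<in> test_functions" "(\<lambda>x. partial i f x * g x) \<in> test_functions"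
    by (intro test_functions_mult test_functions_partial f g smooth_partial)+
  have "(LINT x|lborel. f x * partial i g x + partial i f x * g x) = 0"
    using integral_partial_test[OF t(1), of i] by (simp add: partial_smooth_mult[OF test_functions_smooth[OF f] g])
  then show ?thesis using t(2,3)[THEN test_functions_integrable] by (simp add: add_eq_0_iff2)
qed

text \<open>\<open>partial i\<close> is antisymmetric for the L2 inner product, so the integral
  equals minus its own conjugate.\<close>

lemma Re_integral_partial_cnj:
  assumes v: "v \<in> test_functions"
  shows "Re (LINT x|lborel. v x * cnj (partial i v x)) = 0"
proof -
  note s = test_functions_smooth[OF v]
  have "(LINT x|lborel. v x * cnj (partial i v x)) = - (LINT x|lborel. partial i v x * cnj (v x))"
    using integral_by_parts_test[OF v smooth_cnj(1)[OF s], of i] by (simp add: partial_smooth_cnj[OF s])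
  also have "(LINT x|lborel. partial i v x * cnj (v x)) = (LINT x|lborel. cnj (v x * cnj (partial i v x)))"
    by (simp add: mult.commute)
  also have "\<dots> = cnj (LINT x|lborel. v x * cnj (partial i v x))" by (rule integral_bounded_linear[OF bounded_linear_cnj])
       (intro L2_mult_integrable L2_cnj test_functions_L2 test_functions_partial v)
  finally have "Re (LINT x|lborel. v x * cnj (partial i v x)) = Re (- cnj (LINT x|lborel. v x * cnj (partial i v x)))"
    by (rule arg_cong)
  then show ?thesis by simp
qed

text \<open>The conjugated operator \<open>\<Delta> - 2\<tau>\<partial>\<^sub>k + \<tau>\<^sup>2\<close> has commuting symmetric and antisymmetric parts, so the square of its
  norm dominates that of the antisymmetric part.\<close>

lemma carleman_conjugated:
  fixes v :: "real ^ 'n \<Rightarrow> complex"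
  assumes v: "v \<in> test_functions"
  shows "4 * \<tau>\<^sup>2 * sqn (partial k v) \<le> sqn (\<lambda>x. lap v x - 2 * of_real \<tau> * partial k v x + of_real (\<tau>\<^sup>2) * v x)"
proof -
  note s = test_functions_smooth[OF v]
  let ?P = "\<lambda>x. lap v x + of_real (\<tau>\<^sup>2) * v x" and ?Q = "partial k v"
  have vi: "partial i v \<in> test_functions" "partial i (partial i v) \<in> test_functions" for i
    by (intro test_functions_partial v)+
  \<comment> \<open>Moving one \<open>partial i\<close> to the other factor and commuting it with
    \<open>partial k\<close> reduces this to \<open>Re_integral_partial_cnj\<close> for
    \<open>partial i v\<close>. Summed over \<open>i\<close>, it says that the symmetric part
    \<open>?P\<close> and the antisymmetric part are orthogonal in the real inner product.\<close>
  have ortho: "Re (LINT x|lborel. partial i (partial i v) x * cnj (partial k v x)) = 0" for i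
  proof -
    have "(LINT x|lborel. cnj (partial k v x) * partial i (partial i v) x) = - (LINT x|lborel. partial i (\<lambda>x. cnj (partial k v x)) x * partial i v x)"
    proof (rule integral_by_parts_test)
      have "(\<lambda>x. cnj (partial k v x)) \<in> test_functions"
      proof -
        obtain R where "\<And>x. norm x \<ge> R \<Longrightarrow> partial k v x = 0" using test_functions_support[OF vi(1)[of k]] by blast
        then show ?thesis by (intro test_functionsI[OF smooth_cnj(1)[OF smooth_partial[OF s]], of R]) auto
      qed
      then show "(\<lambda>x. cnj (partial k v x)) \<in> test_functions" .
      show "smooth (partial i v)" by (rule smooth_partial[OF s])
    qed
    also have "partial i (\<lambda>x. cnj (partial k v x)) = (\<lambda>x. cnj (partial k (partial i v) x))"
      using partial_smooth_cnj[OF smooth_partial[OF s], of i k] partial_commute[OF s, of i k] by simp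
    finally show ?thesis using Re_integral_partial_cnj[OF vi(1)[of i], of k] by (simp add: mult.commute)
  qed
  have LP: "lap v \<in> L2"
    unfolding lap_def[abs_def] by (rule L2_sum) (auto intro: test_functions_L2 vi)
  have L: "?P \<in> L2" "?Q \<in> L2" "v \<in> L2"
    by (intro L2_add LP L2_cmult test_functions_L2 v vi)+
  have cross: "Re (LINT x|lborel. ?P x * cnj (?Q x)) = 0"
  proof -
    have I1: "integrable lborel (\<lambda>x. partial i (partial i v) x * cnj (?Q x))" for i
      by (intro L2_mult_integrable L2_cnj L test_functions_L2 vi)
    have I2: "integrable lborel (\<lambda>x. v x * cnj (?Q x))"
      by (intro L2_mult_integrable L2_cnj L)
    have "(LINT x|lborel. ?P x * cnj (?Q x)) = (LINT x|lborel. (\<Sum>i\<in>UNIV. partial i (partial i v) x * cnj (?Q x)) + of_real (\<tau>\<^sup>2) * (v x * cnj (?Q x)))"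
      by (simp only: lap_def sum_distrib_right distrib_right mult.assoc)
    also have "\<dots> = (\<Sum>i\<in>UNIV. LINT x|lborel. partial i (partial i v) x * cnj (?Q x)) + of_real (\<tau>\<^sup>2) * (LINT x|lborel. v x * cnj (?Q x))"
      using I1 I2 by (subst Bochner_Integration.integral_add) (auto simp: Bochner_Integration.integral_sum)
    finally show ?thesis using ortho Re_integral_partial_cnj[OF v, of k] by (simp add: Re_sum)
  qed
  have pw: "(norm (?P x - 2 * of_real \<tau> * ?Q x))\<^sup>2 = (norm (?P x))\<^sup>2 + 4 * \<tau>\<^sup>2 * (norm (?Q x))\<^sup>2 - 4 * \<tau> * Re (?P x * cnj (?Q x))" for x
    by (simp only: cmod_power2) (simp add: power2_eq_square algebra_simps)
  have "sqn (\<lambda>x. ?P x - 2 * of_real \<tau> * ?Q x) = sqn ?P + 4 * \<tau>\<^sup>2 * sqn ?Q - 4 * \<tau> * (LINT x|lborel. Re (?P x * cnj (?Q x)))"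
    unfolding sqn_def pw
    using L2_integrable[OF L(1)] L2_integrable[OF L(2)] integrable_Re[OF L2_mult_integrable[OF L(1) L2_cnj[OF L(2)]]]
    by simp
  also have "(LINT x|lborel. Re (?P x * cnj (?Q x))) = 0"
    using cross L2_mult_integrable[OF L(1) L2_cnj[OF L(2)]] by (simp only: integral_Re)
  finally have "4 * \<tau>\<^sup>2 * sqn ?Q \<le> sqn (\<lambda>x. ?P x - 2 * of_real \<tau> * ?Q x)"
    using sqn_nonneg[of ?P] by simp
  then show ?thesis by (simp add: algebra_simps)
qed

text \<open>The derivative of \<open>x $ k\<close> is 1, so integrating \<open>x $ k * v\<close> by
  parts against the conjugate of \<open>partial k v\<close> yields
  \<open>sqn v = - 2 Re \<langle>x $ k * v, partial k v\<rangle>\<close>. On the support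
  \<open>|x $ k| \<le> D\<close>; Cauchy-Schwarz and division by the norm of \<open>v\<close> finish
  the proof.\<close>

lemma poincare:
  fixes v :: "real ^ 'n \<Rightarrow> complex"
  assumes v: "v \<in> test_functions" and D: "\<And>x. norm x \<ge> D \<Longrightarrow> v x = 0" and D0: "D \<ge> 0"
  shows "sqn v \<le> 4 * D\<^sup>2 * sqn (partial k v)"
proof -
  note s = test_functions_smooth[OF v]
  let ?xv = "\<lambda>x. v x * of_real (x $ k)"
  have t: "?xv \<in> test_functions" by (intro test_functions_mult smooth_component v)
  have t': "(\<lambda>x. partial k v x * of_real (x $ k)) \<in> test_functions"
    by (intro test_functions_mult smooth_component test_functions_partial v)
  have p: "partial k ?xv = (\<lambda>x. v x + partial k v x * of_real (x $ k))"
    using partial_smooth_mult[OF s smooth_component, of k k] by (simp add: partial_component)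
  have le: "sqn ?xv \<le> D\<^sup>2 * sqn v"
  proof -
    have "sqn ?xv \<le> (LINT x|lborel. D\<^sup>2 * (norm (v x))\<^sup>2)"
      unfolding sqn_def
    proof (rule integral_mono)
      show "(norm (?xv x))\<^sup>2 \<le> D\<^sup>2 * (norm (v x))\<^sup>2" for x
      proof (cases "norm x \<ge> D")
        case True
        then show ?thesis by (simp add: D)
      next
        case False
        then have "\<bar>x $ k\<bar> \<le> D" using component_le_norm_cart[of x k] by linarith
        then have "\<bar>x $ k\<bar>\<^sup>2 \<le> D\<^sup>2" by (intro power_mono) auto
        then show ?thesis by (simp add: norm_mult power_mult_distrib mult.commute mult_right_mono)
      qed
    qed (use test_functions_L2[OF t, THEN L2_integrable] test_functions_L2[OF v, THEN L2_integrable] in auto)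
    then show ?thesis by (simp add: sqn_def)
  qed
  have I: "integrable lborel (\<lambda>x. v x * cnj (v x))" "integrable lborel (\<lambda>x. partial k v x * of_real (x $ k) * cnj (v x))"
    "integrable lborel (\<lambda>x. ?xv x * cnj (partial k v x))"
    by (intro L2_mult_integrable L2_cnj test_functions_L2 v t t' test_functions_partial)+
  have "(LINT x|lborel. ?xv x * cnj (partial k v x)) = - (LINT x|lborel. v x * cnj (v x) + partial k v x * of_real (x $ k) * cnj (v x))"
    using integral_by_parts_test[OF t smooth_cnj(1)[OF s], of k] by (simp add: partial_smooth_cnj[OF s] p distrib_right)
  also have "\<dots> = - (of_real (sqn v) + (LINT x|lborel. partial k v x * of_real (x $ k) * cnj (v x)))"
    using I by (simp add: sqn_eq_inner)
  also have "(LINT x|lborel. partial k v x * of_real (x $ k) * cnj (v x)) = (LINT x|lborel. cnj (?xv x * cnj (partial k v x)))"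
    by (simp add: mult_ac)
  also have "\<dots> = cnj (LINT x|lborel. ?xv x * cnj (partial k v x))"
    by (rule integral_bounded_linear[OF bounded_linear_cnj I(3)])
  finally have "sqn v = - 2 * Re (LINT x|lborel. ?xv x * cnj (partial k v x))"
    by (simp add: complex_eq_iff)
  also have "\<dots> \<le> 2 * norm (LINT x|lborel. ?xv x * cnj (partial k v x))"
    using abs_Re_le_cmod[of "LINT x|lborel. ?xv x * cnj (partial k v x)"] by linarith
  also have "\<dots> \<le> 2 * (sqrt (sqn ?xv) * sqrt (sqn (\<lambda>x. cnj (partial k v x))))"
    by (intro mult_left_mono L2_Cauchy_Schwarz L2_cnj test_functions_L2 t test_functions_partial v) auto
  also have "sqn (\<lambda>x. cnj (partial k v x)) = sqn (partial k v)" by (simp add: sqn_def)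
  also have "2 * (sqrt (sqn ?xv) * sqrt (sqn (partial k v))) \<le> 2 * (D * sqrt (sqn v) * sqrt (sqn (partial k v)))"
  proof -
    have "sqrt (sqn ?xv) \<le> D * sqrt (sqn v)"
      using real_sqrt_le_mono[OF le] D0 by (simp add: real_sqrt_mult)
    then show ?thesis by (intro mult_left_mono mult_right_mono) (auto simp: sqn_nonneg)
  qed
  finally have *: "sqrt (sqn v) * sqrt (sqn v) \<le> 2 * D * sqrt (sqn (partial k v)) * sqrt (sqn v)"
    by (simp add: sqn_nonneg mult_ac)
  have "sqrt (sqn v) \<le> 2 * D * sqrt (sqn (partial k v))"
  proof (cases "sqn v = 0")
    case False
    then have "sqrt (sqn v) > 0" using sqn_nonneg[of v] by simp
    with * show ?thesis by (rule mult_right_le_imp_le)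
  qed (use D0 sqn_nonneg[of "partial k v"] in simp)
  then have "(sqrt (sqn v))\<^sup>2 \<le> (2 * D * sqrt (sqn (partial k v)))\<^sup>2"
    by (intro power_mono) (auto simp: sqn_nonneg)
  then show ?thesis by (simp add: power_mult_distrib sqn_nonneg)
qed

definition expw :: "real \<Rightarrow> 'n \<Rightarrow> real ^ 'n \<Rightarrow> complex" where
  "expw \<tau> k x = of_real (exp (\<tau> * x $ k))"

lemma smooth_expw: "smooth (expw \<tau> k)"
  and partial_expw: "partial i (expw \<tau> k) = (\<lambda>x. of_real (if i = k then \<tau> else 0) * expw \<tau> k x)"
proof -
  have d: "(expw \<tau> k has_derivative (\<lambda>v. of_real (\<tau> * v $ k) * expw \<tau> k x)) (at x)" for x
  proof -
    have "((\<lambda>x. exp (\<tau> * x $ k)) has_derivative (\<lambda>v. exp (\<tau> * x $ k) * (\<tau> * v $ k))) (at x)"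
      by (auto intro!: derivative_eq_intros bounded_linear.has_derivative[OF bounded_linear_vec_nth])
    from bounded_linear.has_derivative[OF bounded_linear_of_real this]
    show ?thesis unfolding expw_def[abs_def] by (simp add: mult.commute)
  qed
  have p: "partial i (expw \<tau> k) = (\<lambda>x. of_real (if i = k then \<tau> else 0) * expw \<tau> k x)" for i
    by (rule ext) (auto simp: partial_eqI[OF d] axis_def)
  then show "partial i (expw \<tau> k) = (\<lambda>x. of_real (if i = k then \<tau> else 0) * expw \<tau> k x)" .
  show "smooth (expw \<tau> k)"
  proof (rule smooth_coinduct[of _ "{\<lambda>x. c * expw \<tau> k x |c. True}"])
    show "expw \<tau> k \<in> {\<lambda>x. c * expw \<tau> k x |c. True}" by (auto intro!: exI[of _ 1])
    fix f assume "f \<in> {\<lambda>x. c * expw \<tau> k x |c. True}"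
    then obtain c where f: "f = (\<lambda>x. c * expw \<tau> k x)" by auto
    show "f differentiable (at x)" for x
      unfolding f by (rule differentiable_mult[OF differentiable_const differentiableI[OF d]])
    have "partial i f = (\<lambda>x. (c * of_real (if i = k then \<tau> else 0)) * expw \<tau> k x)" for i
      unfolding f by (rule ext) (simp add: partial_cmult[OF differentiableI[OF d]] p)
    then show "partial i f \<in> {\<lambda>x. c * expw \<tau> k x |c. True}" for i by blast
  qed
qed

text \<open>With \<open>v = expw \<tau> k * w\<close>, the weighted Laplacian of \<open>w\<close> is
  the conjugated operator applied to \<open>v\<close>. \<open>carleman_conjugated\<close> bounds
  \<open>partial k v\<close> by it and \<open>poincare\<close> bounds \<open>v\<close> by
  \<open>partial k v\<close>; their factors 4 cancel. The remaining constant \<open>D\<close>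
  depends on the support only, so the gain \<open>\<tau>\<close> is genuine.\<close>

lemma carleman:
  fixes w :: "real ^ 'n \<Rightarrow> complex"
  assumes w: "w \<in> test_functions" and D: "\<And>x. norm x \<ge> D \<Longrightarrow> w x = 0" and D0: "D \<ge> 0"
  shows "\<tau>\<^sup>2 * sqn (\<lambda>x. expw \<tau> k x * w x) \<le> D\<^sup>2 * sqn (\<lambda>x. expw \<tau> k x * lap w x)"
proof -
  let ?e = "expw \<tau> k" and ?d = "\<lambda>i. complex_of_real (if i = k then \<tau> else 0)"
  note s = test_functions_smooth[OF w]
  note se = smooth_expw[of \<tau> k]
  define v where "v = (\<lambda>x. ?e x * w x)"
  have v: "v \<in> test_functions" using test_functions_mult[OF w se] by (simp add: v_def mult.commute)
  have p1: "partial i (\<lambda>x. ?e x * f x) = (\<lambda>x. ?e x * (partial i f x + ?d i * f x))" if "smooth f" for f i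
    using partial_smooth_mult[OF se that, of i] by (simp add: partial_expw algebra_simps)
  have p2: "partial i (\<lambda>x. partial i w x + ?d i * w x) = (\<lambda>x. partial i (partial i w) x + ?d i * partial i w x)" for i
  proof
    fix x
    have "(\<lambda>x. ?d i * w x) differentiable (at x)"
      by (rule smooth_differentiable[OF smooth_mult[OF smooth_const s]])
    then show "partial i (\<lambda>x. partial i w x + ?d i * w x) x = partial i (partial i w) x + ?d i * partial i w x"
      using smooth_differentiable[OF smooth_partial[OF s]] partial_cmult[OF smooth_differentiable[OF s]]
      by (simp add: partial_add)
  qed
  have "partial i v = (\<lambda>x. ?e x * (partial i w x + ?d i * w x))" for i
    unfolding v_def by (rule p1[OF s])
  then have d1: "partial i v x = ?e x * (partial i w x + ?d i * w x)" and
    d2: "partial i (partial i v) x = ?e x * (partial i (partial i w) x + ?d i * partial i w x + ?d i * (partial i w x + ?d i * w x))" for i x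
    by (simp_all add: p1 p2 smooth_add smooth_partial smooth_mult s)
  have "lap v x = ?e x * lap w x + (\<Sum>i\<in>UNIV. if i = k then ?e x * (2 * of_real \<tau> * partial k w x + of_real (\<tau>\<^sup>2) * w x) else 0)" for x
    unfolding lap_def d2 sum_distrib_left sum.distrib[symmetric]
    by (rule sum.cong) (auto simp: algebra_simps power2_eq_square)
  then have "lap v x - 2 * of_real \<tau> * partial k v x + of_real (\<tau>\<^sup>2) * v x = ?e x * lap w x" for x
    unfolding d1 by (simp add: v_def algebra_simps power2_eq_square)
  then have "4 * \<tau>\<^sup>2 * sqn (partial k v) \<le> sqn (\<lambda>x. ?e x * lap w x)"
    using carleman_conjugated[OF v, of \<tau> k] by simp
  then have "D\<^sup>2 * (4 * \<tau>\<^sup>2 * sqn (partial k v)) \<le> D\<^sup>2 * sqn (\<lambda>x. ?e x * lap w x)"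
    by (rule mult_left_mono) simp
  moreover have "\<tau>\<^sup>2 * sqn v \<le> \<tau>\<^sup>2 * (4 * D\<^sup>2 * sqn (partial k v))"
    by (intro mult_left_mono poincare v D0) (auto simp: v_def D)
  ultimately show ?thesis unfolding v_def by (simp add: mult_ac)
qed

text \<open>The estimate is applied to mollifications of \<open>u\<close>, whose Laplacians are the
  mollifications of \<open>g\<close>. Mollifying does not preserve the pointwise bound of
  \<open>g\<close> by \<open>u\<close>, so that bound is used only after the passage to the
  limit.\<close>

theorem compact_support_unique_continuation:
  fixes u g :: "real ^ 'n \<Rightarrow> complex"
  assumes u: "u \<in> L2" and g: "g \<in> L2" and w: "weak_lap u g"
    and le: "AE x in lborel. norm (g x) \<le> C * norm (u x)"
    and supp: "AE x in lborel. norm x \<ge> A \<longrightarrow> u x = 0" and A: "A \<ge> 0" and C: "C \<ge> 0"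
  shows "AE x in lborel. u x = 0"
proof -
  obtain k :: 'n where True by simp
  obtain m :: "nat \<Rightarrow> real ^ 'n \<Rightarrow> complex"
    where m: "\<And>n. m n \<in> test_functions" and m1: "\<And>n x. norm x \<ge> 1 \<Longrightarrow> m n x = 0"
      and lim: "\<And>u. u \<in> L2 \<Longrightarrow> (\<lambda>n. sqn (\<lambda>t. conv u (m n) t - u t)) \<longlonglongrightarrow> 0"
    by (rule exists_mollifiers) (rule that; assumption)
  \<comment> \<open>Chosen to exceed \<open>(A + 1) * C\<close>. Here \<open>A + 1\<close> is the
    support radius after mollification at scale at most 1, which is the \<open>D\<close> of
    \<open>carleman\<close>.\<close>
  define \<tau> where "\<tau> = (A + 1) * C + 1"
  \<comment> \<open>The exponential is unbounded. Restricting it to a ball that contains all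
    supports makes multiplication by \<open>E\<close> continuous on L2 and leaves the products with
    the mollified functions unchanged.\<close>
  define E where "E x = indicator (cball 0 (A + 1)) x * expw \<tau> k x" for x
  have Em: "E \<in> borel_measurable borel" unfolding E_def
    by (intro borel_measurable_times borel_measurable_indicator smooth_measurable[OF smooth_expw]) auto
  have Eb: "norm (E x) \<le> exp (\<bar>\<tau>\<bar> * (A + 1))" for x
  proof (cases "norm x \<le> A + 1")
    case True
    then have "\<bar>x $ k\<bar> \<le> A + 1" using component_le_norm_cart[of x k] by linarith
    then have "\<bar>\<tau>\<bar> * \<bar>x $ k\<bar> \<le> \<bar>\<tau>\<bar> * (A + 1)" by (intro mult_left_mono) auto
    then have "\<tau> * x $ k \<le> \<bar>\<tau>\<bar> * (A + 1)" by (metis abs_ge_self abs_mult order_trans)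
    then show ?thesis using True by (simp add: E_def expw_def)
  qed (simp add: E_def)
  have EL: "(\<lambda>x. E x * f x) \<in> L2" if "f \<in> L2" for f by (rule L2_bounded_mult[OF that Em Eb])
  have gsupp: "AE x in lborel. norm x \<ge> A \<longrightarrow> g x = 0"
    using le supp by eventually_elim auto
  have lim': "(\<lambda>n. sqn (\<lambda>x. E x * conv f (m n) x)) \<longlonglongrightarrow> sqn (\<lambda>x. E x * f x)" if f: "f \<in> L2" for f
  proof (rule sqn_tendsto)
    let ?B = "exp (\<bar>\<tau>\<bar> * (A + 1))"
    have le: "sqn (\<lambda>x. E x * conv f (m n) x - E x * f x) \<le> ?B\<^sup>2 * sqn (\<lambda>x. conv f (m n) x - f x)" for n
    proof -
      have L: "(\<lambda>x. conv f (m n) x - f x) \<in> L2" by (intro L2_diff conv_L2 f m)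
      have "sqn (\<lambda>x. E x * (conv f (m n) x - f x)) \<le> (LINT x|lborel. ?B\<^sup>2 * (norm (conv f (m n) x - f x))\<^sup>2)"
        unfolding sqn_def
        by (rule integral_mono)
           (use L2_integrable[OF EL[OF L]] L2_integrable[OF L] Eb in \<open>auto simp: norm_mult power_mult_distrib intro!: mult_right_mono power_mono\<close>)
      then show ?thesis by (simp add: sqn_def right_diff_distrib)
    qed
    have lim0: "(\<lambda>n. ?B\<^sup>2 * sqn (\<lambda>x. conv f (m n) x - f x)) \<longlonglongrightarrow> ?B\<^sup>2 * 0"
      by (intro tendsto_intros lim f)
    show "(\<lambda>n. sqn (\<lambda>x. E x * conv f (m n) x - E x * f x)) \<longlonglongrightarrow> 0"
    proof (rule Lim_null_comparison)
      show "\<forall>\<^sub>F n in sequentially. norm (sqn (\<lambda>x. E x * conv f (m n) x - E x * f x))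
        \<le> ?B\<^sup>2 * sqn (\<lambda>x. conv f (m n) x - f x)"
        using le by (simp only: real_norm_def abs_of_nonneg sqn_nonneg eventually_True)
    qed (use lim0 in simp)
  qed (intro EL conv_L2 f m)+
  have est: "\<tau>\<^sup>2 * sqn (\<lambda>x. E x * conv u (m n) x) \<le> (A + 1)\<^sup>2 * sqn (\<lambda>x. E x * conv g (m n) x)" for n
  proof -
    have s: "conv u (m n) x = 0" "conv g (m n) x = 0" if "norm x \<ge> A + 1" for x
      using conv_support[OF supp m1 that] conv_support[OF gsupp m1 that] by auto
    have e: "(\<lambda>x. E x * conv u (m n) x) = (\<lambda>x. expw \<tau> k x * conv u (m n) x)"
      "(\<lambda>x. E x * conv g (m n) x) = (\<lambda>x. expw \<tau> k x * conv g (m n) x)"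
      by (rule ext, rename_tac x, case_tac "norm x \<ge> A + 1", auto simp: E_def s)+
    show ?thesis
      unfolding e using carleman[OF test_functions_conv[OF u m supp] s(1), where \<tau>=\<tau> and k=k] A
      by (simp add: lap_conv[OF u m w])
  qed
  have "\<tau>\<^sup>2 * sqn (\<lambda>x. E x * u x) \<le> (A + 1)\<^sup>2 * sqn (\<lambda>x. E x * g x)"
    by (rule LIMSEQ_le[OF tendsto_mult_left[OF lim'[OF u]] tendsto_mult_left[OF lim'[OF g]]]) (use est in auto)
  also have "\<dots> \<le> (A + 1)\<^sup>2 * (C\<^sup>2 * sqn (\<lambda>x. E x * u x))"
  proof (rule mult_left_mono)
    have "sqn (\<lambda>x. E x * g x) \<le> (LINT x|lborel. C\<^sup>2 * (norm (E x * u x))\<^sup>2)"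
      unfolding sqn_def
    proof (rule integral_mono_AE)
      show "AE x in lborel. (norm (E x * g x))\<^sup>2 \<le> C\<^sup>2 * (norm (E x * u x))\<^sup>2"
        using le
      proof eventually_elim
        case (elim x)
        then have "norm (E x * g x) \<le> C * norm (E x * u x)"
          using mult_left_mono[OF elim, of "norm (E x)"] by (simp add: norm_mult mult_ac)
        then have "(norm (E x * g x))\<^sup>2 \<le> (C * norm (E x * u x))\<^sup>2" by (rule power_mono) simp
        then show ?case by (simp add: power_mult_distrib)
      qed
    qed (use L2_integrable[OF EL[OF g]] L2_integrable[OF EL[OF u]] in auto)
    then show "sqn (\<lambda>x. E x * g x) \<le> C\<^sup>2 * sqn (\<lambda>x. E x * u x)" by (simp add: sqn_def)
  qed simp
  finally have "\<tau>\<^sup>2 * sqn (\<lambda>x. E x * u x) \<le> ((A + 1) * C)\<^sup>2 * sqn (\<lambda>x. E x * u x)"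
    by (simp add: power_mult_distrib)
  note up = this
  have lt: "((A + 1) * C)\<^sup>2 < \<tau>\<^sup>2"
    unfolding \<tau>_def using A C by (intro power_strict_mono) auto
  have "sqn (\<lambda>x. E x * u x) = 0"
  proof (rule ccontr)
    assume "\<not> ?thesis"
    then have "0 < sqn (\<lambda>x. E x * u x)" using sqn_nonneg[of "\<lambda>x. E x * u x"] by linarith
    from mult_strict_right_mono[OF lt this] up show False by linarith
  qed
  then have "AE x in lborel. E x * u x = 0" by (rule sqn_eq_0[OF EL[OF u]])
  then show ?thesis using supp
  proof eventually_elim
    case (elim x)
    then show ?case by (cases "norm x \<le> A + 1") (auto simp: E_def expw_def)
  qed
qed

section \<open>Regularised fundamental solutions of the Helmholtz equation\<close>

definition rho :: "real \<Rightarrow> real ^ 'n \<Rightarrow> real" where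
  "rho d x = sqrt (d\<^sup>2 + (norm x)\<^sup>2)"

text \<open>\<open>hk k d 1\<close> regularises \<open>exp (\<i>k|x|) / |x|\<close> at the origin; the higher powers of \<open>1/\<rho>\<close> arise from differentiation.\<close>

definition hk :: "real \<Rightarrow> real \<Rightarrow> nat \<Rightarrow> real ^ 'n \<Rightarrow> complex" where
  "hk k d n x = exp (\<i> * of_real (k * rho d x)) * of_real (inverse (rho d x) ^ n)"

lemma rho_pos: "d > 0 \<Longrightarrow> rho d x > 0"
  by (simp add: rho_def add_pos_nonneg)

lemma rho_ge: "d > 0 \<Longrightarrow> rho d x \<ge> d" "d > 0 \<Longrightarrow> rho d x \<ge> norm x"
  by (auto simp: rho_def real_le_rsqrt)

lemma rho_sq: "(rho d x)\<^sup>2 = d\<^sup>2 + (norm x)\<^sup>2"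
  by (simp add: rho_def)

lemma rho_le: "d > 0 \<Longrightarrow> rho d x \<le> d + norm x"
  unfolding rho_def by (rule real_le_lsqrt) (auto simp: power2_eq_square algebra_simps)

lemma norm_hk: "d > 0 \<Longrightarrow> norm (hk k d n x) = inverse (rho d x) ^ n"
  using rho_pos[of d x] by (simp add: hk_def norm_mult norm_power norm_inverse)

lemma hk_rho_sq: "d > 0 \<Longrightarrow> hk k d (n + 2) x * of_real ((rho d x)\<^sup>2) = hk k d n x"
  using rho_pos[of d x] by (simp add: hk_def power_add power2_eq_square field_simps)

lemma has_derivative_hk:
  assumes d: "d > 0"
  shows "(hk k d n has_derivative (\<lambda>v. of_real (x \<bullet> v) * (\<i> * of_real k * hk k d (n + 1) x - of_nat n * hk k d (n + 2) x))) (at x)"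
proof -
  let ?r = "rho d x"
  note p = rho_pos[OF d, of x]
  have 1: "(rho d has_derivative (\<lambda>v. (x \<bullet> v) / ?r)) (at x)"
  proof -
    have "((\<lambda>x. d\<^sup>2 + x \<bullet> x) has_derivative (\<lambda>v. 2 * (x \<bullet> v))) (at x)"
      by (auto intro!: derivative_eq_intros simp: inner_commute)
    then have "((\<lambda>x. sqrt (d\<^sup>2 + x \<bullet> x)) has_derivative (\<lambda>v. (2 * (x \<bullet> v)) * (inverse (sqrt (d\<^sup>2 + x \<bullet> x)) / 2))) (at x)"
      using d by (intro has_derivative_real_sqrt) (auto simp: add_pos_nonneg)
    then show ?thesis by (simp add: rho_def[abs_def] dot_square_norm inverse_eq_divide)
  qed
  have 2: "((\<lambda>r. exp (\<i> * of_real (k * r)) * of_real (inverse r ^ n)) has_derivative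
     (\<lambda>h. of_real h * (\<i> * of_real k * (exp (\<i> * of_real (k * ?r)) * of_real (inverse ?r ^ n))
       - of_nat n * (exp (\<i> * of_real (k * ?r)) * of_real (inverse ?r ^ (n + 1)))))) (at ?r)"
  proof -
    have "((\<lambda>r. inverse r ^ n) has_real_derivative - (real n * inverse ?r ^ (n + 1))) (at ?r)"
    proof -
      have "((\<lambda>r. inverse r ^ n) has_real_derivative real n * - (inverse ?r * 1 * inverse ?r) * inverse ?r ^ (n - 1)) (at ?r)"
        using p by (auto intro!: derivative_eq_intros)
      moreover have "real n * - (inverse ?r * 1 * inverse ?r) * inverse ?r ^ (n - 1) = - (real n * inverse ?r ^ (n + 1))"
        by (cases n) auto
      ultimately show ?thesis by (rule DERIV_cong)
    qed
    then have a: "((\<lambda>r. of_real (inverse r ^ n)) has_derivative (\<lambda>h. complex_of_real (- (real n * inverse ?r ^ (n + 1)) * h))) (at ?r)"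
      by (intro bounded_linear.has_derivative[OF bounded_linear_of_real]) (simp only: has_field_derivative_def)
    have "((\<lambda>r. \<i> * of_real (k * r)) has_vector_derivative \<i> * of_real k) (at ?r)"
      by (auto intro!: derivative_eq_intros)
    then have "((\<lambda>r. exp (\<i> * of_real (k * r))) has_vector_derivative (\<i> * of_real k * exp (\<i> * of_real (k * ?r)))) (at ?r)"
      using field_vector_diff_chain_at[OF _ DERIV_exp, of "\<lambda>r. \<i> * of_real (k * r)" "\<i> * of_real k" ?r] by (simp add: comp_def)
    then have b: "((\<lambda>r. exp (\<i> * of_real (k * r))) has_derivative (\<lambda>h. of_real h * (\<i> * of_real k * exp (\<i> * of_real (k * ?r))))) (at ?r)"
      by (simp add: has_vector_derivative_def scaleR_conv_of_real)
    show ?thesis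
      by (rule has_derivative_eq_rhs[OF has_derivative_mult[OF b a]]) (auto simp: fun_eq_iff algebra_simps)
  qed
  have "((\<lambda>x. exp (\<i> * of_real (k * rho d x)) * of_real (inverse (rho d x) ^ n)) has_derivative
     (\<lambda>v. of_real ((x \<bullet> v) / ?r) * (\<i> * of_real k * (exp (\<i> * of_real (k * ?r)) * of_real (inverse ?r ^ n))
       - of_nat n * (exp (\<i> * of_real (k * ?r)) * of_real (inverse ?r ^ (n + 1)))))) (at x)"
    by (rule has_derivative_compose[OF 1 2])
  then show ?thesis
    unfolding hk_def[abs_def]
    by (rule has_derivative_eq_rhs) (auto simp: fun_eq_iff divide_inverse algebra_simps)
qed

lemma partial_hk:
  assumes d: "d > 0"
  shows "partial i (hk k d n) = (\<lambda>x. of_real (x $ i) * (\<i> * of_real k * hk k d (n + 1) x + (- of_nat n) * hk k d (n + 2) x))"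
  by (rule ext) (simp add: partial_eqI[OF has_derivative_hk[OF d]] inner_axis)

lemma smooth_hk:
  assumes d: "d > 0"
  shows "smooth (hk k d n :: real ^ 'n \<Rightarrow> complex)"
proof (rule smooth_algebra_gen)
  \<comment> \<open>Smooth functions join the generators because every derivative of
    \<open>hk\<close> brings a factor \<open>x $ i\<close>.\<close>
  let ?G = "{hk k d n |n. True} \<union> {f. smooth f} :: (real ^ 'n \<Rightarrow> complex) set"
  show "hk k d n \<in> algebra_gen ?G" by (rule algebra_gen.gen) blast
  fix g assume g: "g \<in> ?G"
  show "g differentiable (at x)" for x
    using g smooth_differentiable differentiableI[OF has_derivative_hk[OF d]] by blast
  have h: "hk k d n \<in> algebra_gen ?G" for n by (rule algebra_gen.gen) blast
  have c: "(\<lambda>x. of_real (x $ i)) \<in> algebra_gen ?G" for i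
    by (rule algebra_gen.gen) (auto intro: smooth_component)
  have "partial i (hk k d n) \<in> algebra_gen ?G" for i n
    unfolding partial_hk[OF d] by (intro algebra_gen.mult[OF c] algebra_gen.add algebra_gen.mult[OF algebra_gen.const] h)
  then show "partial i g \<in> algebra_gen ?G" for i
    using g by (auto intro: algebra_gen.gen smooth_partial)
qed

text \<open>The error \<open>-(\<Delta> + k\<^sup>2) (hk k d 1)\<close>, which concentrates at the origin as \<open>d \<rightarrow> 0\<close>.\<close>

definition eta :: "real \<Rightarrow> real \<Rightarrow> real ^ 'n \<Rightarrow> complex" where
  "eta k d x = of_real (d\<^sup>2) * (3 * hk k d 5 x - 3 * \<i> * of_real k * hk k d 4 x - of_real (k\<^sup>2) * hk k d 3 x)"

text \<open>The squares of the coordinates sum to \<open>rho^2 - d^2\<close>. The part with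
  \<open>rho^2\<close> lowers the index of \<open>hk\<close> by two and cancels against the sum of
  the three zeroth-order terms, up to \<open>- k^2 * hk k d 1\<close>, as for the exact solution in
  dimension three. The part with \<open>d^2\<close> is the error \<open>eta\<close>.\<close>

lemma lap_hk:
  assumes d: "d > 0"
  shows "lap (hk k d 1 :: real ^ 3 \<Rightarrow> complex) x + of_real (k\<^sup>2) * hk k d 1 x = - eta k d x"
proof -
  let ?h = "\<lambda>n. hk k d n x"
  have s: "smooth (hk k d n :: real ^ 3 \<Rightarrow> complex)" for n by (rule smooth_hk[OF d])
  have p: "partial i (\<lambda>x :: real ^ 3. of_real (x $ i) * (\<i> * of_real k * hk k d 2 x + (-1) * hk k d 3 x)) x
    = of_real (x $ i) * (\<i> * of_real k * (of_real (x $ i) * (\<i> * of_real k * ?h 3 - 2 * ?h 4)) - of_real (x $ i) * (\<i> * of_real k * ?h 4 - 3 * ?h 5))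
      + (\<i> * of_real k * ?h 2 - ?h 3)" for i
  proof -
    have e: "partial i (\<lambda>x :: real ^ 3. \<i> * of_real k * hk k d 2 x + (-1) * hk k d 3 x) x
      = \<i> * of_real k * partial i (hk k d 2) x + (-1) * partial i (hk k d 3) x"
      unfolding partial_add[OF smooth_differentiable[OF smooth_mult[OF smooth_const s]]
          smooth_differentiable[OF smooth_mult[OF smooth_const s]]] partial_cmult[OF smooth_differentiable[OF s]] ..
    have sm: "smooth (\<lambda>x :: real ^ 3. \<i> * of_real k * hk k d 2 x + (-1) * hk k d 3 x)"
      by (intro smooth_add smooth_mult smooth_const s)
    show ?thesis
      unfolding partial_mult[OF smooth_differentiable[OF smooth_component] smooth_differentiable[OF sm]] e
      by (simp add: partial_hk[OF d] partial_component)
  qed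
  have nx: "(\<Sum>i\<in>UNIV. (complex_of_real (x $ i))\<^sup>2) = of_real ((rho d x)\<^sup>2 - d\<^sup>2)"
  proof -
    have "(\<Sum>i\<in>UNIV. (x $ i)\<^sup>2) = (norm x)\<^sup>2"
      unfolding power2_norm_eq_inner inner_vec_def by (simp add: power2_eq_square)
    then show ?thesis by (simp only: rho_sq of_real_power[symmetric] of_real_sum[symmetric]) simp
  qed
  have "lap (hk k d 1) x = (\<Sum>i\<in>UNIV. (complex_of_real (x $ i))\<^sup>2 * (- of_real (k\<^sup>2) * ?h 3 - 3 * \<i> * of_real k * ?h 4 + 3 * ?h 5) + (\<i> * of_real k * ?h 2 - ?h 3))"
    unfolding lap_def
  proof (rule sum.cong[OF refl])
    fix i :: 3
    have p': "partial i (hk k d 1) = (\<lambda>x. of_real (x $ i) * (\<i> * of_real k * hk k d 2 x + (-1) * hk k d 3 x))"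
      using partial_hk[OF d, of i k 1] by (simp add: numeral_2_eq_2 numeral_3_eq_3)
    show "partial i (partial i (hk k d 1)) x = (complex_of_real (x $ i))\<^sup>2 * (- of_real (k\<^sup>2) * ?h 3 - 3 * \<i> * of_real k * ?h 4 + 3 * ?h 5) + (\<i> * of_real k * ?h 2 - ?h 3)"
      unfolding p' p by (simp add: algebra_simps power2_eq_square)
  qed
  also have "\<dots> = of_real ((rho d x)\<^sup>2 - d\<^sup>2) * (- of_real (k\<^sup>2) * ?h 3 - 3 * \<i> * of_real k * ?h 4 + 3 * ?h 5) + 3 * (\<i> * of_real k * ?h 2 - ?h 3)"
    unfolding nx[symmetric] sum.distrib sum_distrib_right by simp
  also have "\<dots> = - of_real (k\<^sup>2) * (?h 3 * of_real ((rho d x)\<^sup>2)) - 3 * \<i> * of_real k * (?h 4 * of_real ((rho d x)\<^sup>2)) + 3 * (?h 5 * of_real ((rho d x)\<^sup>2))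
     + 3 * (\<i> * of_real k * ?h 2 - ?h 3) - eta k d x"
    by (simp add: eta_def algebra_simps)
  also have "?h 3 * of_real ((rho d x)\<^sup>2) = ?h 1" using hk_rho_sq[OF d, of k 1 x] by (simp add: numeral_3_eq_3)
  also have "?h 4 * of_real ((rho d x)\<^sup>2) = ?h 2" using hk_rho_sq[OF d, of k 2 x] by simp
  also have "?h 5 * of_real ((rho d x)\<^sup>2) = ?h 3" using hk_rho_sq[OF d, of k 3 x] by simp
  finally have e: "lap (hk k d 1) x = - of_real (k\<^sup>2) * ?h 1 - 3 * \<i> * of_real k * ?h 2 + 3 * ?h 3
    + 3 * (\<i> * of_real k * ?h 2 - ?h 3) - eta k d x" .
  show ?thesis unfolding e by (simp add: algebra_simps)
qed

lemma lap_mult: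
  fixes f g :: "real ^ 'n \<Rightarrow> complex"
  assumes f: "smooth f" and g: "smooth g"
  shows "lap (\<lambda>x. f x * g x) x = f x * lap g x + 2 * (\<Sum>i\<in>UNIV. partial i f x * partial i g x) + lap f x * g x"
proof -
  have "partial i (\<lambda>x. f x * partial i g x + partial i f x * g x) x
    = (f x * partial i (partial i g) x + partial i f x * partial i g x) + (partial i f x * partial i g x + partial i (partial i f) x * g x)" for i
    by (subst partial_add) (auto intro!: smooth_differentiable smooth_mult f g smooth_partial simp: partial_smooth_mult f g smooth_partial)
  then show ?thesis
    by (simp add: lap_def partial_smooth_mult[OF f g] sum.distrib sum_distrib_left sum_distrib_right)
qed

lemma lap_affine:
  fixes f :: "real ^ 'n \<Rightarrow> complex"
  assumes f: "smooth f"
  shows "partial i (\<lambda>x. f (c *\<^sub>R x + d)) = (\<lambda>x. of_real c * partial i f (c *\<^sub>R x + d))"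
    and "lap (\<lambda>x. f (c *\<^sub>R x + d)) x = of_real (c\<^sup>2) * lap f (c *\<^sub>R x + d)"
proof -
  have p: "partial i (\<lambda>x. f (c *\<^sub>R x + d)) = (\<lambda>x. of_real c * partial i f (c *\<^sub>R x + d))" if "smooth f" for f :: "real ^ 'n \<Rightarrow> complex" and i
    by (rule ext) (rule partial_affine(1)[OF smooth_differentiable[OF that]])
  show "partial i (\<lambda>x. f (c *\<^sub>R x + d)) = (\<lambda>x. of_real c * partial i f (c *\<^sub>R x + d))" by (rule p[OF f])
  have "partial i (\<lambda>x. of_real c * partial i f (c *\<^sub>R x + d)) x = of_real c * (of_real c * partial i (partial i f) (c *\<^sub>R x + d))" for i
    using partial_cmult[OF partial_affine(2)[OF smooth_differentiable[OF smooth_partial[OF f]]]] p[OF smooth_partial[OF f]] by metis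
  then show "lap (\<lambda>x. f (c *\<^sub>R x + d)) x = of_real (c\<^sup>2) * lap f (c *\<^sub>R x + d)"
    by (simp add: lap_def p[OF f] sum_distrib_left power2_eq_square mult.assoc)
qed

lemma rho_measurable [measurable]: "rho d \<in> borel_measurable borel"
  unfolding rho_def by measurable

lemma hk_measurable [measurable]: "hk k d n \<in> borel_measurable borel"
  unfolding hk_def by measurable

lemma eta_measurable [measurable]: "eta k d \<in> borel_measurable borel"
  unfolding eta_def by measurable

section \<open>Integrable bounds for the regularised kernels\<close>

lemma inverse_rho_integrable:
  assumes d: "0 < d" "d \<le> 1" shows "integrable lborel (\<lambda>x::real^3. inverse (rho d x) ^ 4)"
proof (rule Bochner_Integration.integrable_bound)
  show "integrable lborel (\<lambda>x::real^3. inverse (d ^ 4) * (1 / (1 + (norm x)\<^sup>2)\<^sup>2))"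
    by (intro integrable_mult_right integrable_weight)
  have "inverse (rho d x) ^ 4 \<le> inverse (d ^ 4) * (1 / (1 + (norm x)\<^sup>2)\<^sup>2)" for x :: "real ^ 3"
  proof -
    have "d\<^sup>2 \<le> 1" using d by (simp add: power_le_one)
    then have "d\<^sup>2 * (norm x)\<^sup>2 \<le> (norm x)\<^sup>2" by (simp add: mult_left_le_one_le)
    then have "d\<^sup>2 * (1 + (norm x)\<^sup>2) \<le> (rho d x)\<^sup>2" unfolding rho_sq by (simp add: distrib_left)
    then have "(d\<^sup>2 * (1 + (norm x)\<^sup>2))\<^sup>2 \<le> ((rho d x)\<^sup>2)\<^sup>2" by (intro power_mono) auto
    then have "inverse (((rho d x)\<^sup>2)\<^sup>2) \<le> inverse ((d\<^sup>2 * (1 + (norm x)\<^sup>2))\<^sup>2)"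
      using d by (intro le_imp_inverse_le zero_less_power mult_pos_pos) (auto simp: add_pos_nonneg)
    then show ?thesis
      by (simp add: power_mult_distrib power_inverse divide_inverse flip: power_mult)
  qed
  then show "AE x in lborel. norm (inverse (rho d x) ^ 4) \<le> norm (inverse (d ^ 4) * (1 / (1 + (norm (x::real^3))\<^sup>2)\<^sup>2))"
    using rho_pos[OF d(1)] d by (auto intro!: AE_I2 simp: less_imp_le)
qed measurable

text \<open>Paired with an L2 function, this weight gives the integrable majorant
  \<open>|u| / rho^2\<close> on which the dominated convergence arguments for \<open>u\<close>
  rely.\<close>

lemma inverse_rho_L2:
  assumes d: "0 < d" "d \<le> 1" shows "(\<lambda>x::real^3. complex_of_real (inverse (rho d x) ^ 2)) \<in> L2"
proof (rule L2I)
  have "(norm (complex_of_real (inverse (rho d x) ^ 2)))\<^sup>2 = inverse (rho d x) ^ 4" for x :: "real^3"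
    by (simp only: norm_of_real power2_abs) (simp flip: power_mult)
  then show "integrable lborel (\<lambda>x::real^3. (norm (complex_of_real (inverse (rho d x) ^ 2)))\<^sup>2)"
    using inverse_rho_integrable[OF d] by simp
qed measurable

lemma integrable_le_bound:
  fixes f :: "'a \<Rightarrow> 'b::{banach, second_countable_topology}"
  assumes "integrable M g" "f \<in> borel_measurable M" "\<And>x. norm (f x) \<le> g x"
  shows "integrable M f"
  by (rule Bochner_Integration.integrable_bound[OF assms(1,2)])
     (rule AE_I2, unfold real_norm_def, rule order_trans[OF assms(3) abs_ge_self])

lemma smooth_sum:
  "finite A \<Longrightarrow> (\<And>a. a \<in> A \<Longrightarrow> smooth (f a)) \<Longrightarrow> smooth (\<lambda>x. \<Sum>a\<in>A. f a x)"
  by (induction A rule: finite_induct) auto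

lemma smooth_lap: "smooth f \<Longrightarrow> smooth (lap f)"
  unfolding lap_def[abs_def] by (intro smooth_sum smooth_partial) auto

lemma inverse_rho_shift:
  assumes d: "0 < d" "d \<le> 1" shows "(\<lambda>x::real^3. complex_of_real (inverse (rho d (x - y)) ^ 2)) \<in> L2"
  using L2_translate(1)[OF inverse_rho_L2[OF d], of "- y"] by simp

text \<open>Two regimes. For fixed \<open>d\<close> a constant that blows up with
  \<open>1 / d\<close> is good enough for integrability. At distance at least 1 from the singularity
  the constant is uniform in \<open>d\<close>, as the limit \<open>d \<rightarrow> 0\<close>
  demands. In \<open>gen\<close> the parameter \<open>B\<close> bounds the first three powers of
  \<open>1 / rho\<close> in either regime.\<close>

lemma eta_bound:
  assumes d: "0 < d" "d \<le> 1"
  shows "norm (eta k d x) \<le> (k\<^sup>2 + 3 * \<bar>k\<bar> + 3) * inverse (d ^ 3) * inverse (rho d x) ^ 2"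
    and "norm x \<ge> 1 \<Longrightarrow> norm (eta k d x) \<le> (k\<^sup>2 + 3 * \<bar>k\<bar> + 3) * inverse (rho d x) ^ 2"
proof -
  let ?i = "inverse (rho d x)"
  have p: "?i > 0" using rho_pos[OF d(1), of x] by simp
  have nn: "norm (eta k d x) \<le> d\<^sup>2 * (3 * ?i ^ 5 + 3 * \<bar>k\<bar> * ?i ^ 4 + k\<^sup>2 * ?i ^ 3)"
  proof -
    have "norm (3 * hk k d 5 x - 3 * \<i> * of_real k * hk k d 4 x - of_real (k\<^sup>2) * hk k d 3 x)
      \<le> norm (3 * hk k d 5 x) + norm (3 * \<i> * of_real k * hk k d 4 x) + norm (of_real (k\<^sup>2) * hk k d 3 x)"
      by (rule order_trans[OF norm_triangle_ineq4 add_right_mono[OF norm_triangle_ineq4]])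
    also have "\<dots> = 3 * ?i ^ 5 + 3 * \<bar>k\<bar> * ?i ^ 4 + k\<^sup>2 * ?i ^ 3"
      using d by (simp add: norm_mult norm_hk norm_power)
    finally show ?thesis unfolding eta_def by (simp add: norm_mult norm_power mult_left_mono)
  qed
  have d1: "d\<^sup>2 \<le> 1" using d by (simp add: power_le_one)
  have gen: "d\<^sup>2 * (3 * ?i ^ 5 + 3 * \<bar>k\<bar> * ?i ^ 4 + k\<^sup>2 * ?i ^ 3) \<le> (k\<^sup>2 + 3 * \<bar>k\<bar> + 3) * B * ?i ^ 2"
    if B: "?i \<le> B" "?i ^ 2 \<le> B" "?i ^ 3 \<le> B" for B
  proof -
    have "?i ^ 3 = ?i * ?i ^ 2" "?i ^ 4 = ?i ^ 2 * ?i ^ 2" "?i ^ 5 = ?i ^ 3 * ?i ^ 2"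
      by (simp_all flip: power_Suc power_add add: numeral_eq_Suc)
    then have "3 * ?i ^ 5 + 3 * \<bar>k\<bar> * ?i ^ 4 + k\<^sup>2 * ?i ^ 3 = (3 * ?i ^ 3 + 3 * \<bar>k\<bar> * ?i ^ 2 + k\<^sup>2 * ?i) * ?i ^ 2"
      by (simp add: algebra_simps)
    also have "\<dots> \<le> (3 * B + 3 * \<bar>k\<bar> * B + k\<^sup>2 * B) * ?i ^ 2"
      using B by (intro mult_right_mono add_mono mult_left_mono) auto
    also have "\<dots> = (k\<^sup>2 + 3 * \<bar>k\<bar> + 3) * B * ?i ^ 2" by (simp add: algebra_simps)
    finally have le: "3 * ?i ^ 5 + 3 * \<bar>k\<bar> * ?i ^ 4 + k\<^sup>2 * ?i ^ 3 \<le> (k\<^sup>2 + 3 * \<bar>k\<bar> + 3) * B * ?i ^ 2" .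
    have "d\<^sup>2 * (3 * ?i ^ 5 + 3 * \<bar>k\<bar> * ?i ^ 4 + k\<^sup>2 * ?i ^ 3) \<le> 1 * (3 * ?i ^ 5 + 3 * \<bar>k\<bar> * ?i ^ 4 + k\<^sup>2 * ?i ^ 3)"
      using p d1 by (intro mult_right_mono) (auto intro!: add_nonneg_nonneg)
    from order_trans[OF this[unfolded mult_1] le] show ?thesis .
  qed
  have mono: "?i ^ n \<le> inverse (d ^ 3)" if "n \<le> 3" for n
  proof -
    have "?i \<le> inverse d" using rho_ge(1)[OF d(1), of x] d by (intro le_imp_inverse_le) auto
    then have "?i ^ n \<le> inverse d ^ n" using p by (intro power_mono) auto
    also have "\<dots> \<le> inverse d ^ 3" using d that by (intro power_increasing) (auto simp: one_le_inverse)
    finally show ?thesis by (simp add: power_inverse)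
  qed
  show "norm (eta k d x) \<le> (k\<^sup>2 + 3 * \<bar>k\<bar> + 3) * inverse (d ^ 3) * ?i ^ 2"
    using nn gen[of "inverse (d ^ 3)"] mono[of 1] mono[of 2] mono[of 3] by simp
  assume "norm x \<ge> 1"
  then have "rho d x \<ge> 1" using rho_ge(2)[OF d(1), of x] by linarith
  then have "?i \<le> 1" by (simp add: inverse_le_1_iff)
  then have "?i ^ n \<le> 1" for n using p by (intro power_le_one) auto
  then show "norm (eta k d x) \<le> (k\<^sup>2 + 3 * \<bar>k\<bar> + 3) * ?i ^ 2"
    using nn gen[of 1] \<open>?i \<le> 1\<close> by simp
qed

lemma hk_bound: "d > 0 \<Longrightarrow> norm (hk k d n x) \<le> inverse d ^ n"
  unfolding norm_hk by (intro power_mono le_imp_inverse_le rho_ge) (auto simp: rho_pos less_imp_le)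

text \<open>The factor \<open>x $ i\<close> is at most \<open>rho\<close>, so the gradient decays
  like \<open>1 / rho\<close>, as the kernel does. The second factor \<open>1 / rho\<close> comes
  from the differentiated cutoff.\<close>

lemma partial_hk_bound:
  assumes d: "0 < d" "d \<le> 1"
  shows "norm (partial i (hk k d 1) x) \<le> (\<bar>k\<bar> + 1) * inverse d * inverse (rho d x)"
proof -
  let ?i = "inverse (rho d x)"
  have p: "rho d x > 0" by (rule rho_pos[OF d(1)])
  have x: "\<bar>x $ i\<bar> \<le> rho d x" using component_le_norm_cart[of x i] rho_ge(2)[OF d(1), of x] by linarith
  have "norm (partial i (hk k d 1) x) \<le> \<bar>x $ i\<bar> * (\<bar>k\<bar> * ?i ^ 2 + ?i ^ 3)"
  proof -
    have "norm (\<i> * of_real k * hk k d 2 x + (-1) * hk k d 3 x) \<le> \<bar>k\<bar> * ?i ^ 2 + ?i ^ 3"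
      by (rule order_trans[OF norm_triangle_ineq]) (simp add: norm_mult norm_hk d)
    then show ?thesis
      using mult_left_mono[of _ _ "\<bar>x $ i\<bar>"] by (simp add: partial_hk[OF d(1)] norm_mult numeral_2_eq_2 numeral_3_eq_3)
  qed
  also have "\<dots> \<le> rho d x * (\<bar>k\<bar> * ?i ^ 2 + ?i ^ 3)"
    using p x by (intro mult_right_mono add_nonneg_nonneg mult_nonneg_nonneg) auto
  also have "\<dots> = (\<bar>k\<bar> + ?i) * ?i"
    using p by (simp add: field_simps power2_eq_square power3_eq_cube)
  also have "\<dots> \<le> ((\<bar>k\<bar> + 1) * inverse d) * ?i"
  proof (rule mult_right_mono)
    have "?i \<le> inverse d" using rho_ge(1)[OF d(1), of x] d by (intro le_imp_inverse_le) auto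
    moreover have "\<bar>k\<bar> * 1 \<le> \<bar>k\<bar> * inverse d" using d by (intro mult_left_mono) (auto simp: one_le_inverse)
    ultimately show "\<bar>k\<bar> + ?i \<le> (\<bar>k\<bar> + 1) * inverse d" by (simp add: distrib_right)
  qed (use p in simp)
  finally show ?thesis .
qed

text \<open>Test the equation against a regularised fundamental solution times a dilated cutoff. In the error terms the
  factor \<open>1/n\<close> of the differentiated cutoff is at most a multiple of \<open>1/\<rho>\<close> on the support, so they are dominated by
  \<open>|u|/\<rho>\<^sup>2\<close> and vanish in the limit.\<close>

lemma regularised_representation:
  fixes u f :: "real ^ 3 \<Rightarrow> complex"
  assumes u: "u \<in> L2" and f: "f \<in> L2" and fs: "\<And>x. norm x > R \<Longrightarrow> f x = 0"
    and eq: "\<And>\<phi>. \<phi> \<in> test_functions \<Longrightarrow> (LINT x|lborel. u x * (lap \<phi> x + of_real (k\<^sup>2) * \<phi> x)) = - (LINT x|lborel. f x * \<phi> x)"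
    and d: "0 < d" "d \<le> 1"
  shows "(LINT x|lborel. u x * eta k d (x - y)) = (LINT x|lborel. f x * hk k d 1 (x - y))"
proof -
  note [measurable] = L2_measurable[OF u] L2_measurable[OF f]
  obtain r :: "real ^ 3 \<Rightarrow> real"
    where r: "(\<lambda>x. complex_of_real (r x)) \<in> test_functions" "\<And>x. norm x \<ge> 1 \<Longrightarrow> r x = 0" "r 0 > 0"
    using exists_mollifier by metis
  define q where "q x = complex_of_real (r x) * of_real (inverse (r 0))" for x
  have q: "q \<in> test_functions" unfolding q_def[abs_def] by (intro test_functions_mult r) auto
  have q0: "q 0 = 1" using r(3) by (simp add: q_def flip: of_real_mult)
  have qs: "q x = 0" if "norm x \<ge> 1" for x using r(2)[OF that] by (simp add: q_def)
  note sq = test_functions_smooth[OF q]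
  have pt: "partial i q \<in> test_functions" for i by (rule test_functions_partial[OF q])
  have ps: "partial i q x = 0" "lap q x = 0" if "norm x > 1" for i x
  proof -
    have p: "partial i q x = 0" if "norm x > 1" for i x
      by (rule partial_eq_0_norm[OF _ that]) (simp add: qs)
    show "partial i q x = 0" by (rule p[OF that])
    show "lap q x = 0" unfolding lap_def using partial_eq_0_norm[OF p that] by simp
  qed
  have lt: "lap q \<in> test_functions"
  proof (rule test_functionsI)
    show "smooth (lap q)" by (rule smooth_lap[OF sq])
  qed (rule ps(2))
  obtain M0 where M0: "\<And>x. norm (q x) \<le> M0" using test_functions_bounded[OF q] by blast
  have "\<forall>i. \<exists>M. \<forall>x. norm (partial i q x) \<le> M" using test_functions_bounded[OF pt] by metis
  then obtain M1 where M1: "\<And>i x. norm (partial i q x) \<le> M1 i" by metis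
  obtain M2 where M2: "\<And>x. norm (lap q x) \<le> M2" using test_functions_bounded[OF lt] by blast
  have Mnn: "M0 \<ge> 0" "M1 i \<ge> 0" "M2 \<ge> 0" for i
    using M0[of 0] M1[of i 0] M2[of 0] norm_ge_zero order_trans by blast+
  let ?P = "\<lambda>x. hk k d 1 (x - y)"
  let ?c = "\<lambda>n x. q (inverse (real (Suc n)) *\<^sub>R x)"
  have sh: "smooth (hk k d 1 :: real ^ 3 \<Rightarrow> complex)" by (rule smooth_hk[OF d(1)])
  have sP: "smooth ?P" using smooth_affine[OF sh, of 1 "- y"] by simp
  have pP: "partial i ?P = (\<lambda>x. partial i (hk k d 1) (x - y))" for i
    using lap_affine(1)[OF sh, of i 1 "- y"] by simp
  have lP: "lap ?P x + of_real (k\<^sup>2) * ?P x = - eta k d (x - y)" for x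
    using lap_affine(2)[OF sh, of 1 "- y" x] lap_hk[OF d(1), of k "x - y"] by simp
  have sc: "smooth (?c n)" and ct: "?c n \<in> test_functions" for n
    using smooth_affine[OF sq, of "inverse (real (Suc n))" 0] test_functions_affine[OF q, of "inverse (real (Suc n))" 0] by auto
  have pc: "partial i (?c n) = (\<lambda>x. of_real (inverse (real (Suc n))) * partial i q (inverse (real (Suc n)) *\<^sub>R x))" for i n
    using lap_affine(1)[OF sq, of i "inverse (real (Suc n))" 0] by simp
  have lc: "lap (?c n) x = of_real ((inverse (real (Suc n)))\<^sup>2) * lap q (inverse (real (Suc n)) *\<^sub>R x)" for n x
    using lap_affine(2)[OF sq, of "inverse (real (Suc n))" 0] by simp
  \<comment> \<open>The terms of the product rule in which the cutoff is differentiated.\<close>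
  define er where "er n x = 2 * (\<Sum>i\<in>UNIV. partial i (?c n) x * partial i ?P x) + lap (?c n) x * ?P x" for n x
  have [measurable]: "partial i q \<in> borel_measurable borel" "lap q \<in> borel_measurable borel" "q \<in> borel_measurable borel" for i
    using pt lt q by (auto intro!: smooth_measurable test_functions_smooth)
  have [measurable]: "(\<lambda>x. partial i (hk k d 1) (x - y)) \<in> borel_measurable borel" for i :: 3
    using smooth_measurable[OF smooth_partial[OF sh]] by measurable
  have erm[measurable]: "er n \<in> borel_measurable borel" for n
    unfolding er_def pc lc pP by measurable
  \<comment> \<open>The last factor arises on the support of the cutoff: there
    \<open>norm x \<le> n + 1\<close>, hence
    \<open>rho d (x - y) \<le> (n + 1) * (1 + d + norm y)\<close>.\<close>
  define K where "K = (2 * (\<Sum>i\<in>UNIV. M1 i) * ((\<bar>k\<bar> + 1) * inverse d) + M2) * (1 + d + norm y)"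
  \<comment> \<open>The first bound is uniform in \<open>n\<close> and gives the dominating
    function; the second tends to 0 for fixed \<open>x\<close>.\<close>
  have erb: "norm (er n x) \<le> K * inverse (rho d (x - y)) ^ 2" and erl: "norm (er n x) \<le> K * inverse (rho d (x - y)) * inverse (real (Suc n))" for n x
  proof -
    let ?n = "inverse (real (Suc n))" and ?i = "inverse (rho d (x - y))"
    have i0: "?i > 0" using rho_pos[OF d(1), of "x - y"] by simp
    have nn: "norm (complex_of_real ?n) = ?n" by (simp only: norm_of_real) simp
    have K1: "K \<ge> 0" unfolding K_def using d Mnn by (intro mult_nonneg_nonneg add_nonneg_nonneg sum_nonneg) auto
    have "norm (er n x) \<le> (2 * (\<Sum>i\<in>UNIV. M1 i) * ((\<bar>k\<bar> + 1) * inverse d) + M2) * ?i * ?n"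
    proof -
      have "norm (partial i (?c n) x * partial i ?P x) \<le> (?n * M1 i) * ((\<bar>k\<bar> + 1) * inverse d * ?i)" for i
        unfolding norm_mult pc pP nn
        by (intro mult_mono partial_hk_bound d M1 mult_nonneg_nonneg Mnn) auto
      then have "norm (\<Sum>i\<in>UNIV. partial i (?c n) x * partial i ?P x) \<le> (\<Sum>i\<in>UNIV. (?n * M1 i) * ((\<bar>k\<bar> + 1) * inverse d * ?i))"
        by (intro sum_norm_le)
      also have "\<dots> = ?n * (\<Sum>i\<in>UNIV. M1 i) * ((\<bar>k\<bar> + 1) * inverse d * ?i)"
        by (simp only: sum_distrib_left sum_distrib_right)
      finally have a: "norm (2 * (\<Sum>i\<in>UNIV. partial i (?c n) x * partial i ?P x)) \<le> 2 * (?n * (\<Sum>i\<in>UNIV. M1 i) * ((\<bar>k\<bar> + 1) * inverse d * ?i))"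
        by (simp add: norm_mult)
      have b: "norm (lap (?c n) x * ?P x) \<le> (?n * M2) * ?i"
        unfolding norm_mult lc norm_hk[OF d(1)]
      proof (rule mult_mono)
        have "?n * ?n \<le> 1 * ?n" by (intro mult_right_mono) (auto simp: inverse_le_1_iff)
        then have "?n\<^sup>2 \<le> ?n" by (simp only: power2_eq_square mult_1)
        moreover have "norm (complex_of_real (?n\<^sup>2)) = ?n\<^sup>2" by (simp only: norm_of_real) simp
        ultimately show "norm (complex_of_real (?n\<^sup>2)) * norm (lap q (?n *\<^sub>R x)) \<le> ?n * M2"
          using M2 Mnn by (intro mult_mono) (auto simp: norm_power norm_divide)
      qed (use i0 Mnn in auto)
      have "norm (er n x) \<le> norm (2 * (\<Sum>i\<in>UNIV. partial i (?c n) x * partial i ?P x)) + norm (lap (?c n) x * ?P x)"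
        unfolding er_def by (rule norm_triangle_ineq)
      also have "\<dots> \<le> 2 * (?n * (\<Sum>i\<in>UNIV. M1 i) * ((\<bar>k\<bar> + 1) * inverse d * ?i)) + (?n * M2) * ?i"
        by (rule add_mono[OF a b])
      finally show ?thesis by (simp only: algebra_simps)
    qed
    moreover have "(2 * (\<Sum>i\<in>UNIV. M1 i) * ((\<bar>k\<bar> + 1) * inverse d) + M2) \<le> K"
    proof -
      have "(2 * (\<Sum>i\<in>UNIV. M1 i) * ((\<bar>k\<bar> + 1) * inverse d) + M2) * 1 \<le> K"
        unfolding K_def using d Mnn by (intro mult_left_mono add_nonneg_nonneg mult_nonneg_nonneg sum_nonneg) auto
      then show ?thesis by simp
    qed
    ultimately show "norm (er n x) \<le> K * ?i * ?n"
      using i0 by (elim order_trans) (intro mult_right_mono, auto)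
    show "norm (er n x) \<le> K * ?i ^ 2"
    proof (cases "norm x > real (Suc n)")
      case True
      then have "norm (?n *\<^sub>R x) > 1" by (simp add: field_simps)
      then have "er n x = 0" unfolding er_def pc lc by (simp add: ps)
      then show ?thesis using K1 by simp
    next
      case False
      have "rho d (x - y) \<le> d + norm (x - y)" by (rule rho_le[OF d(1)])
      also have "\<dots> \<le> d + norm x + norm y" using norm_triangle_ineq4[of x y] by linarith
      also have "\<dots> \<le> real (Suc n) * (1 + d + norm y)"
      proof -
        have "1 * (d + norm y) \<le> real (Suc n) * (d + norm y)" using d by (intro mult_right_mono) auto
        then show ?thesis using False by (simp add: algebra_simps)
      qed
      finally have n: "?n \<le> (1 + d + norm y) * ?i"
        using rho_pos[OF d(1), of "x - y"] by (simp add: field_simps)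
      have "norm (er n x) \<le> (2 * (\<Sum>i\<in>UNIV. M1 i) * ((\<bar>k\<bar> + 1) * inverse d) + M2) * ?i * ?n" by fact
      also have "\<dots> \<le> (2 * (\<Sum>i\<in>UNIV. M1 i) * ((\<bar>k\<bar> + 1) * inverse d) + M2) * ?i * ((1 + d + norm y) * ?i)"
        using i0 d Mnn by (intro mult_left_mono n mult_nonneg_nonneg add_nonneg_nonneg sum_nonneg) auto
      also have "\<dots> = K * ?i ^ 2" by (simp add: K_def power2_eq_square mult_ac)
      finally show ?thesis .
    qed
  qed
  let ?w = "\<lambda>x. complex_of_real (inverse (rho d (x - y)) ^ 2)"
  have wi: "integrable lborel (\<lambda>x. norm (u x * ?w x))"
    by (rule integrable_norm[OF L2_mult_integrable[OF u inverse_rho_shift[OF d]]])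
  have wn: "norm (?w x) = inverse (rho d (x - y)) ^ 2" for x
    by (simp only: norm_of_real) simp
  have erb': "norm (u x * er n x) \<le> K * norm (u x * ?w x)" for n x
    unfolding norm_mult wn using mult_left_mono[OF erb, of "norm (u x)"] by (simp only: mult_ac norm_ge_zero)
  have eu: "integrable lborel (\<lambda>x. u x * er n x)" for n
    by (rule integrable_le_bound[OF integrable_mult_right[OF wi, of K] _ erb']) measurable
  let ?C = "(k\<^sup>2 + 3 * \<bar>k\<bar> + 3) * inverse (d ^ 3)"
  have qn: "(\<lambda>n. ?c n x) \<longlonglongrightarrow> 1" for x
  proof -
    have "(\<lambda>n. inverse (real (Suc n)) *\<^sub>R x) \<longlonglongrightarrow> 0 *\<^sub>R x" by (intro tendsto_intros LIMSEQ_inverse_real_of_nat)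
    then have "(\<lambda>n. ?c n x) \<longlonglongrightarrow> q 0"
      by (intro continuous_on_tendsto_compose[OF smooth_continuous[OF sq, of UNIV]]) auto
    then show ?thesis by (simp add: q0)
  qed
  have eib: "norm (u x * (?c n x * eta k d (x - y))) \<le> M0 * ?C * norm (u x * ?w x)" for n x
  proof -
    have "norm (?c n x * eta k d (x - y)) \<le> M0 * (?C * inverse (rho d (x - y)) ^ 2)"
      unfolding norm_mult using Mnn by (intro mult_mono M0 eta_bound d) auto
    from mult_left_mono[OF this, of "norm (u x)"] show ?thesis
      unfolding norm_mult wn by (simp add: mult_ac)
  qed
  have iw: "integrable lborel (\<lambda>x. M0 * ?C * norm (u x * ?w x))" by (rule integrable_mult_right[OF wi])
  have ei: "integrable lborel (\<lambda>x. u x * (?c n x * eta k d (x - y)))" for n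
    by (rule integrable_le_bound[OF iw _ eib]) measurable
  have main: "(LINT x|lborel. u x * er n x) - (LINT x|lborel. u x * (?c n x * eta k d (x - y))) = - (LINT x|lborel. f x * (?c n x * ?P x))" for n
  proof -
    have "(\<lambda>x. ?c n x * ?P x) \<in> test_functions" by (rule test_functions_mult[OF ct sP])
    from eq[OF this] have "(LINT x|lborel. u x * (lap (\<lambda>x. ?c n x * ?P x) x + of_real (k\<^sup>2) * (?c n x * ?P x))) = - (LINT x|lborel. f x * (?c n x * ?P x))" .
    moreover have "lap (\<lambda>x. ?c n x * ?P x) x + of_real (k\<^sup>2) * (?c n x * ?P x) = er n x - ?c n x * eta k d (x - y)" for x
    proof -
      have "lap (\<lambda>x. ?c n x * ?P x) x + of_real (k\<^sup>2) * (?c n x * ?P x) = er n x + ?c n x * (lap ?P x + of_real (k\<^sup>2) * ?P x)"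
        unfolding lap_mult[OF sc sP] er_def by (simp add: algebra_simps)
      then show ?thesis unfolding lP by simp
    qed
    ultimately show ?thesis using eu[of n] ei[of n] by (simp add: right_diff_distrib)
  qed
  have l1: "(\<lambda>n. LINT x|lborel. u x * er n x) \<longlonglongrightarrow> (LINT x::real^3|lborel. 0)"
  proof (rule integral_dominated_convergence[OF _ _ integrable_mult_right[OF wi, of K]])
    show "AE x in lborel. norm (u x * er n x) \<le> K * norm (u x * ?w x)" for n
      by (rule AE_I2) (rule erb')
    have "(\<lambda>n. er n x) \<longlonglongrightarrow> 0" for x
    proof (rule Lim_null_comparison[OF always_eventually])
      show "\<forall>n. norm (er n x) \<le> K * inverse (rho d (x - y)) * inverse (real (Suc n))" using erl by blast
      show "(\<lambda>n. K * inverse (rho d (x - y)) * inverse (real (Suc n))) \<longlonglongrightarrow> 0"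
        by (rule tendsto_mult_right_zero[OF LIMSEQ_inverse_real_of_nat])
    qed
    then show "AE x in lborel. (\<lambda>n. u x * er n x) \<longlonglongrightarrow> 0"
      by (intro AE_I2 tendsto_mult_right_zero)
  qed auto
  have l2: "(\<lambda>n. LINT x|lborel. u x * (?c n x * eta k d (x - y))) \<longlonglongrightarrow> (LINT x|lborel. u x * eta k d (x - y))"
  proof (rule integral_dominated_convergence[OF _ _ iw])
    have "(\<lambda>n. u x * (?c n x * eta k d (x - y))) \<longlonglongrightarrow> u x * (1 * eta k d (x - y))" for x
      by (intro tendsto_intros qn)
    then show "AE x in lborel. (\<lambda>n. u x * (?c n x * eta k d (x - y))) \<longlonglongrightarrow> u x * eta k d (x - y)" by simp
    show "AE x in lborel. norm (u x * (?c n x * eta k d (x - y))) \<le> M0 * ?C * norm (u x * ?w x)" for n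
      by (rule AE_I2) (rule eib)
  qed auto
  have l3: "(\<lambda>n. LINT x|lborel. f x * (?c n x * ?P x)) \<longlonglongrightarrow> (LINT x|lborel. f x * ?P x)"
  proof (rule integral_dominated_convergence[OF _ _ integrable_mult_right[OF L2_indicator_cball_integrable[OF f, of R], of "M0 * inverse d"]])
    have "(\<lambda>n. f x * (?c n x * ?P x)) \<longlonglongrightarrow> f x * (1 * ?P x)" for x
      by (intro tendsto_intros qn)
    then show "AE x in lborel. (\<lambda>n. f x * (?c n x * ?P x)) \<longlonglongrightarrow> f x * ?P x" by simp
    show "AE x in lborel. norm (f x * (?c n x * ?P x)) \<le> M0 * inverse d * (norm (f x) * indicator (cball 0 R) x)" for n
    proof (rule AE_I2)
      fix x
      have "norm (?c n x * ?P x) \<le> M0 * inverse d"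
        unfolding norm_mult using Mnn hk_bound[OF d(1), of k 1 "x - y"] by (intro mult_mono M0) auto
      from mult_left_mono[OF this, of "norm (f x)"]
      show "norm (f x * (?c n x * ?P x)) \<le> M0 * inverse d * (norm (f x) * indicator (cball 0 R) x)"
        using fs[of x] by (cases "norm x \<le> R") (auto simp: norm_mult mult_ac)
    qed
  qed auto
  have "(\<lambda>n. (LINT x|lborel. u x * er n x) - (LINT x|lborel. u x * (?c n x * eta k d (x - y)))) \<longlonglongrightarrow> 0 - (LINT x|lborel. u x * eta k d (x - y))"
    using tendsto_diff[OF l1 l2] by simp
  moreover have "(\<lambda>n. (LINT x|lborel. u x * er n x) - (LINT x|lborel. u x * (?c n x * eta k d (x - y)))) \<longlonglongrightarrow> - (LINT x|lborel. f x * ?P x)"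
    unfolding main by (rule tendsto_minus[OF l3])
  ultimately have "0 - (LINT x|lborel. u x * eta k d (x - y)) = - (LINT x|lborel. f x * ?P x)"
    by (rule LIMSEQ_unique)
  then show ?thesis by simp
qed

text \<open>The limit of the total mass of \<open>eta\<close>; its value \<open>4\<pi>\<close> is irrelevant, only positivity matters.\<close>

definition mass :: real where
  "mass = (LINT z::real^3|lborel. 3 * inverse (rho 1 z) ^ 5)"

text \<open>The potential of \<open>f\<close> without the factor \<open>1 / (4\<pi>)\<close>:
  outgoing for \<open>k > 0\<close>, incoming for \<open>k < 0\<close>. It is evaluated for sources
  and points \<open>y\<close> that are at least 1 apart, so the value of \<open>inverse\<close> at 0
  has no influence there.\<close>

definition far :: "real \<Rightarrow> (real ^ 3 \<Rightarrow> complex) \<Rightarrow> real ^ 3 \<Rightarrow> complex" where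
  "far k f y = (LINT x|lborel. f x * (exp (\<i> * of_real (k * norm (x - y))) * of_real (inverse (norm (x - y)))))"

section \<open>The representation in the limit of vanishing regularisation\<close>

lemma integral_norm_le:
  fixes f :: "'a \<Rightarrow> 'b::{banach, second_countable_topology}"
  assumes g: "integrable M g" and f: "f \<in> borel_measurable M" and le: "\<And>x. norm (f x) \<le> g x"
  shows "norm (integral\<^sup>L M f) \<le> integral\<^sup>L M g"
proof -
  have "norm (integral\<^sup>L M f) \<le> (LINT x|M. norm (f x))" by (rule integral_norm_bound)
  also have "\<dots> \<le> integral\<^sup>L M g"
    by (rule integral_mono[OF integrable_norm[OF integrable_le_bound[OF g f le]] g le])
  finally show ?thesis .
qed

lemma inverse_rho_le_1: "inverse (rho 1 x) \<le> 1" "inverse (rho 1 x) > 0"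
  using rho_ge(1)[of 1 x] by (auto simp: inverse_le_1_iff)

lemma inverse_rho_5_integrable: "integrable lborel (\<lambda>z::real^3. inverse (rho 1 z) ^ 5)"
proof (rule integrable_le_bound)
  show "integrable lborel (\<lambda>z::real^3. inverse (rho 1 z) ^ 4)" by (rule inverse_rho_integrable) auto
  show "norm (inverse (rho 1 z) ^ 5) \<le> inverse (rho 1 z) ^ 4" for z :: "real ^ 3"
    using inverse_rho_le_1[of z] power_decreasing[of 4 5 "inverse (rho 1 z)"] by simp
qed measurable

lemma mass_pos: "mass > 0"
proof -
  have i: "integrable lborel (\<lambda>z::real^3. 3 * inverse (rho 1 z) ^ 5)"
    by (rule integrable_mult_right[OF inverse_rho_5_integrable])
  have nn: "3 * inverse (rho 1 z) ^ 5 > 0" for z :: "real ^ 3" using inverse_rho_le_1(2)[of z] by simp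
  have "mass \<noteq> 0"
  proof
    assume "mass = 0"
    then have "AE z::real^3 in lborel. 3 * inverse (rho 1 z) ^ 5 = 0"
      unfolding mass_def using integral_nonneg_eq_0_iff_AE[OF i] nn by (auto simp: less_imp_le)
    then have "AE z::real^3 in lborel. False" by eventually_elim (use nn in \<open>simp add: less_le\<close>)
    then have "emeasure lborel (UNIV :: (real^3) set) = 0" using AE_iff_null[of "lborel :: (real^3) measure" "\<lambda>_. False"] by (auto simp: null_sets_def)
    then show False by simp
  qed
  moreover have "mass \<ge> 0" unfolding mass_def using nn by (intro integral_nonneg_AE) (auto simp: less_imp_le)
  ultimately show ?thesis by simp
qed

lemma rho_scale: "d > 0 \<Longrightarrow> rho d (d *\<^sub>R z) = d * rho 1 z"
proof -
  assume d: "d > 0"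
  have "d\<^sup>2 + (d * norm z)\<^sup>2 = d\<^sup>2 * (1 + (norm z)\<^sup>2)" by (simp add: power_mult_distrib distrib_left)
  then show ?thesis using d by (simp add: rho_def real_sqrt_mult)
qed

text \<open>The profile of \<open>eta\<close> at scale \<open>d\<close>, see
  \<open>eta_scale\<close>. At \<open>d = 0\<close> only its first term survives, and that is the
  integrand of \<open>mass\<close>.\<close>

definition theta :: "real \<Rightarrow> real \<Rightarrow> real ^ 3 \<Rightarrow> complex" where
  "theta k d z = exp (\<i> * of_real (k * (d * rho 1 z))) * (3 * of_real (inverse (rho 1 z)) ^ 5
     - 3 * \<i> * of_real k * of_real d * of_real (inverse (rho 1 z)) ^ 4 - of_real (k\<^sup>2) * of_real (d\<^sup>2) * of_real (inverse (rho 1 z)) ^ 3)"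

lemma eta_scale:
  assumes d: "d > 0"
  shows "of_real (d ^ 3) * eta k d (d *\<^sub>R z) = theta k d z"
proof -
  have e: "complex_of_real d * inverse (complex_of_real d) = 1" using d by simp
  have "complex_of_real d ^ 5 * inverse (of_real d) ^ 5 = (of_real d * inverse (of_real d)) ^ 5"
    "complex_of_real d ^ 5 * inverse (of_real d) ^ 4 = of_real d * (of_real d * inverse (of_real d)) ^ 4"
    "complex_of_real d ^ 5 * inverse (of_real d) ^ 3 = (of_real d)\<^sup>2 * (of_real d * inverse (of_real d)) ^ 3"
    by (simp_all only: power_mult_distrib) (simp_all flip: power_Suc power_add mult.assoc)
  then have p: "complex_of_real d ^ 5 * inverse (of_real d) ^ 5 = 1" "complex_of_real d ^ 5 * inverse (of_real d) ^ 4 = of_real d"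
    "complex_of_real d ^ 5 * inverse (of_real d) ^ 3 = (of_real d)\<^sup>2"
    by (simp_all add: e)
  let ?s = "complex_of_real (rho 1 z)" and ?E = "exp (\<i> * of_real (k * (d * rho 1 z)))"
  have "of_real (d ^ 3) * eta k d (d *\<^sub>R z) = ?E * (3 * (of_real d ^ 5 * inverse (of_real d) ^ 5) * inverse ?s ^ 5
     - 3 * \<i> * of_real k * (of_real d ^ 5 * inverse (of_real d) ^ 4) * inverse ?s ^ 4
     - of_real (k\<^sup>2) * (of_real d ^ 5 * inverse (of_real d) ^ 3) * inverse ?s ^ 3)"
  proof -
    have "complex_of_real (d ^ 3) * of_real (d\<^sup>2) = of_real d ^ 5" by (simp flip: power_add)
    then have "of_real (d ^ 3) * eta k d (d *\<^sub>R z) = of_real d ^ 5 * (3 * hk k d 5 (d *\<^sub>R z) - 3 * \<i> * of_real k * hk k d 4 (d *\<^sub>R z) - of_real (k\<^sup>2) * hk k d 3 (d *\<^sub>R z))"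
      unfolding eta_def by (simp add: mult.assoc[symmetric])
    then show ?thesis
      unfolding hk_def rho_scale[OF d] by (simp add: power_mult_distrib algebra_simps)
  qed
  then show ?thesis unfolding p by (simp add: theta_def mult_ac)
qed

text \<open>In terms of \<open>t = d * rho 1 z\<close> the three terms become
  \<open>3 + 3 |k| t + k^2 t^2\<close> times the integrable \<open>1 / rho^5\<close>. The slower
  decay of the last two is harmless because \<open>t\<close> stays bounded where a compactly
  supported factor is nonzero.\<close>

lemma theta_bound:
  assumes d: "d > 0"
  shows "norm (theta k d z) \<le> (k\<^sup>2 + 3 * \<bar>k\<bar> + 3) * (1 + (d * rho 1 z)\<^sup>2) * inverse (rho 1 z) ^ 5"
proof -
  let ?i = "inverse (rho 1 z)" and ?t = "d * rho 1 z"
  have i: "?i > 0" by (rule inverse_rho_le_1)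
  have s: "rho 1 z > 0" by (rule rho_pos) simp
  have "norm (theta k d z) \<le> 3 * ?i ^ 5 + 3 * \<bar>k\<bar> * d * ?i ^ 4 + k\<^sup>2 * d\<^sup>2 * ?i ^ 3"
  proof -
    have "norm (theta k d z) = norm (3 * of_real ?i ^ 5
     - 3 * \<i> * of_real k * of_real d * of_real ?i ^ 4 - of_real (k\<^sup>2) * of_real (d\<^sup>2) * complex_of_real ?i ^ 3)"
      by (simp add: theta_def norm_mult)
    also have "\<dots> \<le> norm (3 * complex_of_real ?i ^ 5) + norm (3 * \<i> * of_real k * of_real d * of_real ?i ^ 4) + norm (of_real (k\<^sup>2) * of_real (d\<^sup>2) * complex_of_real ?i ^ 3)"
      by (rule order_trans[OF norm_triangle_ineq4 add_right_mono[OF norm_triangle_ineq4]])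
    also have "\<dots> = 3 * ?i ^ 5 + 3 * \<bar>k\<bar> * d * ?i ^ 4 + k\<^sup>2 * d\<^sup>2 * ?i ^ 3"
      using s d by (simp add: norm_mult norm_power norm_inverse)
    finally show ?thesis .
  qed
  also have "\<dots> = (3 + 3 * \<bar>k\<bar> * ?t + k\<^sup>2 * ?t\<^sup>2) * ?i ^ 5"
  proof -
    have "?i ^ 4 = rho 1 z * ?i ^ 5" "?i ^ 3 = (rho 1 z)\<^sup>2 * ?i ^ 5"
      using s by (simp_all add: field_simps eval_nat_numeral)
    then show ?thesis by (simp add: algebra_simps power_mult_distrib)
  qed
  also have "\<dots> \<le> ((k\<^sup>2 + 3 * \<bar>k\<bar> + 3) * (1 + ?t\<^sup>2)) * ?i ^ 5"
  proof (rule mult_right_mono)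
    have "2 * ?t \<le> 1 + ?t\<^sup>2"
      using zero_le_power2[of "?t - 1"] by (simp add: power2_eq_square algebra_simps)
    moreover have "?t \<ge> 0" using d s by simp
    ultimately have t: "?t \<le> 1 + ?t\<^sup>2" by linarith
    have "3 * \<bar>k\<bar> * ?t \<le> 3 * \<bar>k\<bar> * (1 + ?t\<^sup>2)" by (intro mult_left_mono t) auto
    moreover have "(k\<^sup>2 + 3 * \<bar>k\<bar> + 3) * (1 + ?t\<^sup>2) = k\<^sup>2 + k\<^sup>2 * ?t\<^sup>2 + 3 * \<bar>k\<bar> * (1 + ?t\<^sup>2) + 3 + 3 * ?t\<^sup>2"
      by (simp only: distrib_left distrib_right mult_1_right)
    ultimately show "3 + 3 * \<bar>k\<bar> * ?t + k\<^sup>2 * ?t\<^sup>2 \<le> (k\<^sup>2 + 3 * \<bar>k\<bar> + 3) * (1 + ?t\<^sup>2)"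
      using zero_le_power2[of k] zero_le_power2[of ?t] by linarith
  qed (use i in simp)
  finally show ?thesis .
qed

lemma theta_tendsto:
  assumes "d \<longlonglongrightarrow> 0"
  shows "(\<lambda>n. theta k (d n) z) \<longlonglongrightarrow> of_real (3 * inverse (rho 1 z) ^ 5)"
proof -
  have "(\<lambda>n. theta k (d n) z) \<longlonglongrightarrow> theta k 0 z"
    unfolding theta_def by (intro tendsto_intros assms)
  then show ?thesis by (simp add: theta_def)
qed

text \<open>Makes weights with different centres and different regularisations comparable. The shift
  costs \<open>norm x \<le> norm w + L\<close>, and additive constants are absorbed by means of
  \<open>a \<le> rho d w\<close>. With \<open>w = x - y\<close> this removes the dependence on
  \<open>y\<close> in a bounded set.\<close>

lemma inverse_rho_sq_shift:
  assumes d: "d > 0" and a: "0 < a" "a \<le> rho d w" and L: "norm (x - w) \<le> L"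
  shows "inverse (rho d w) ^ 2 \<le> ((1 + 2 * L\<^sup>2) / a\<^sup>2 + 2) * inverse (rho 1 x) ^ 2"
proof -
  have p: "rho d w > 0" "rho 1 x > 0" using rho_pos[OF d] rho_pos[of 1] by auto
  have "norm x \<le> norm w + L" using L norm_triangle_ineq[of w "x - w"] by simp
  then have "(norm x)\<^sup>2 \<le> (norm w + L)\<^sup>2" by (intro power_mono) auto
  also have "\<dots> \<le> 2 * (norm w)\<^sup>2 + 2 * L\<^sup>2" using zero_le_power2[of "norm w - L"] by (simp add: power2_eq_square algebra_simps)
  finally have 1: "(rho 1 x)\<^sup>2 \<le> (1 + 2 * L\<^sup>2) + 2 * (norm w)\<^sup>2" by (simp add: rho_sq)
  have "a\<^sup>2 \<le> (rho d w)\<^sup>2" using a by (intro power_mono) auto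
  then have "(1 + 2 * L\<^sup>2) * 1 \<le> (1 + 2 * L\<^sup>2) * ((rho d w)\<^sup>2 / a\<^sup>2)"
    using a by (intro mult_left_mono) (auto simp: field_simps)
  moreover have "(norm w)\<^sup>2 \<le> (rho d w)\<^sup>2" by (simp add: rho_sq)
  ultimately have "(rho 1 x)\<^sup>2 \<le> ((1 + 2 * L\<^sup>2) / a\<^sup>2 + 2) * (rho d w)\<^sup>2"
    using 1 by (simp add: algebra_simps)
  then show ?thesis using p by (simp add: field_simps power2_eq_square)
qed

text \<open>\<open>eta\<close> is an approximate identity of total mass tending to
  \<open>mass\<close>. Fubini moves it onto \<open>\<phi>\<close>, and the substitution
  \<open>y = x - d z\<close> gives pointwise convergence. As \<open>u\<close> is only in L2, the
  functions \<open>\<Phi> n\<close> must also be bounded by a multiple of \<open>1 / rho^2\<close>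
  uniformly in \<open>n\<close>.\<close>

lemma regularised_delta_tendsto:
  fixes u :: "real ^ 3 \<Rightarrow> complex"
  assumes u: "u \<in> L2" and \<phi>: "\<phi> \<in> test_functions" and d: "\<And>n. 0 < d n" "\<And>n. d n \<le> 1" "d \<longlonglongrightarrow> 0"
  shows "(\<lambda>n. LINT y|lborel. \<phi> y * (LINT x|lborel. u x * eta k (d n) (x - y))) \<longlonglongrightarrow> of_real mass * (LINT x|lborel. u x * \<phi> x)"
proof -
  note [measurable] = L2_measurable[OF u] smooth_measurable[OF test_functions_smooth[OF \<phi>]]
  obtain L0 where L0: "L0 > 0" "\<And>x. norm x \<ge> L0 \<Longrightarrow> \<phi> x = 0" using test_functions_support[OF \<phi>] by blast
  define L where "L = L0"
  have L: "L > 0" "\<And>x. \<phi> x \<noteq> 0 \<Longrightarrow> norm x \<le> L" unfolding L_def using L0 by force+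
  obtain M where M: "M > 0" "\<And>x. norm (\<phi> x) \<le> M" using test_functions_bounded[OF \<phi>] by blast
  let ?C = "k\<^sup>2 + 3 * \<bar>k\<bar> + 3"
  have C0: "?C > 0" by (simp add: add_nonneg_pos)
  let ?w = "\<lambda>x::real^3. inverse (rho 1 x) ^ 2"
  have uw: "integrable lborel (\<lambda>x. norm (u x) * ?w x)"
    using integrable_norm[OF L2_mult_integrable[OF u inverse_rho_L2[of 1]]] inverse_rho_le_1(2)
    by (simp add: norm_mult norm_power norm_inverse rho_def add_nonneg_nonneg)
  define \<Phi> where "\<Phi> n x = (LINT y|lborel. \<phi> y * eta k (d n) (x - y))" for n x
  have Fub: "(LINT y|lborel. \<phi> y * (LINT x|lborel. u x * eta k (d n) (x - y))) = (LINT x|lborel. u x * \<Phi> n x)" for n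
  proof -
    \<comment> \<open>Fubini is applied for fixed \<open>n\<close>, so this constant may grow as
      \<open>d n\<close> tends to 0. Its last factor is \<open>inverse_rho_sq_shift\<close> with
      \<open>a = d n\<close>.\<close>
    let ?K = "?C * inverse (d n ^ 3) * ((1 + 2 * L\<^sup>2) / (d n)\<^sup>2 + 2)"
    have I0: "integrable (lborel \<Otimes>\<^sub>M lborel) (\<lambda>(y, x). norm (\<phi> y) * (?K * (norm (u x) * ?w x)))"
    proof (rule lborel_pair.Fubini_integrable)
      show "integrable lborel (\<lambda>y. LINT x|lborel. norm (case (y, x) of (y, x) \<Rightarrow> norm (\<phi> y) * (?K * (norm (u x) * ?w x))))"
        using integrable_norm[OF test_functions_integrable[OF \<phi>]] by (simp add: abs_mult)
      show "AE y in lborel. integrable lborel (\<lambda>x. case (y, x) of (y, x) \<Rightarrow> norm (\<phi> y) * (?K * (norm (u x) * ?w x)))"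
        using uw by auto
    qed measurable
    have I: "integrable (lborel \<Otimes>\<^sub>M lborel) (\<lambda>(y, x). \<phi> y * (u x * eta k (d n) (x - y)))"
    proof (rule integrable_le_bound[OF I0])
      fix p :: "(real ^ 3) \<times> (real ^ 3)"
      obtain y x where p: "p = (y, x)" by (cases p)
      show "norm (case p of (y, x) \<Rightarrow> \<phi> y * (u x * eta k (d n) (x - y))) \<le> (case p of (y, x) \<Rightarrow> norm (\<phi> y) * (?K * (norm (u x) * ?w x)))"
      proof (cases "\<phi> y = 0")
        case False
        have "norm (eta k (d n) (x - y)) \<le> ?C * inverse (d n ^ 3) * inverse (rho (d n) (x - y)) ^ 2"
          by (rule eta_bound(1)[OF d(1,2)])
        also have "\<dots> \<le> ?C * inverse (d n ^ 3) * (((1 + 2 * L\<^sup>2) / (d n)\<^sup>2 + 2) * ?w x)"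
          using L(2)[OF False] C0 d(1)[of n] rho_ge(1)[OF d(1)]
          by (intro mult_left_mono inverse_rho_sq_shift) auto
        finally have "norm (u x) * norm (eta k (d n) (x - y)) \<le> norm (u x) * (?C * inverse (d n ^ 3) * (((1 + 2 * L\<^sup>2) / (d n)\<^sup>2 + 2) * ?w x))"
          by (rule mult_left_mono) simp
        then have "norm (\<phi> y) * (norm (u x) * norm (eta k (d n) (x - y))) \<le> norm (\<phi> y) * (norm (u x) * (?C * inverse (d n ^ 3) * (((1 + 2 * L\<^sup>2) / (d n)\<^sup>2 + 2) * ?w x)))"
          by (rule mult_left_mono) simp
        then show ?thesis by (simp only: p prod.case norm_mult mult_ac)
      qed (simp add: p)
    qed measurable
    have "(LINT y|lborel. \<phi> y * (LINT x|lborel. u x * eta k (d n) (x - y))) = (LINT y|lborel. LINT x|lborel. \<phi> y * (u x * eta k (d n) (x - y)))"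
      by simp
    also have "\<dots> = (LINT x|lborel. LINT y|lborel. \<phi> y * (u x * eta k (d n) (x - y)))"
      by (rule lborel_pair.Fubini_integral[OF I, symmetric])
    also have "\<dots> = (LINT x|lborel. u x * \<Phi> n x)"
      unfolding \<Phi>_def by (subst integral_mult_right_zero[symmetric]) (simp only: mult.left_commute)
    finally show ?thesis .
  qed
  have eb: "integrable lborel (\<lambda>y. \<phi> y * eta k (d n) (x - y))" for n x
  proof (rule integrable_le_bound)
    let ?B = "?C * inverse (d n ^ 3) * inverse (d n) ^ 2"
    show "integrable lborel (\<lambda>y. norm (\<phi> y) * ?B)"
      by (rule integrable_mult_left[OF integrable_norm[OF test_functions_integrable[OF \<phi>]]])
    show "norm (\<phi> y * eta k (d n) (x - y)) \<le> norm (\<phi> y) * ?B" for y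
    proof -
      have "inverse (rho (d n) (x - y)) ^ 2 \<le> inverse (d n) ^ 2"
        using rho_pos[OF d(1)[of n], of "x - y"] rho_ge(1)[OF d(1)[of n], of "x - y"] d(1)[of n]
        by (intro power_mono le_imp_inverse_le) auto
      then have "norm (eta k (d n) (x - y)) \<le> ?B"
        using C0 d(1)[of n] by (intro order_trans[OF eta_bound(1)[OF d(1,2)]] mult_left_mono) auto
      then show ?thesis unfolding norm_mult by (rule mult_left_mono) simp
    qed
  qed measurable
  have scaled: "\<Phi> n x = (LINT z|lborel. \<phi> (x + - d n *\<^sub>R z) * theta k (d n) z)" for n x
  proof -
    have "\<Phi> n x = of_real (d n ^ 3) * (LINT z|lborel. \<phi> (x + - d n *\<^sub>R z) * eta k (d n) (x - (x + - d n *\<^sub>R z)))"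
      unfolding \<Phi>_def using d(1)[of n]
      by (subst integral_affine[OF _ eb, of "- d n" n x x]) (auto simp: scaleR_conv_of_real)
    also have "\<dots> = (LINT z|lborel. \<phi> (x + - d n *\<^sub>R z) * (of_real (d n ^ 3) * eta k (d n) (d n *\<^sub>R z)))"
      by (subst integral_mult_right_zero[symmetric]) (simp add: mult.left_commute)
    finally show ?thesis unfolding eta_scale[OF d(1)] .
  qed
  have tm[measurable]: "theta k (d n) \<in> borel_measurable borel" for n
    unfolding theta_def by measurable
  have ptb: "norm (\<phi> (x + - d n *\<^sub>R z) * theta k (d n) z) \<le> M * (?C * (2 + (norm x + L)\<^sup>2)) * inverse (rho 1 z) ^ 5" for n x z
  proof (cases "\<phi> (x + - d n *\<^sub>R z) = 0")
    case False
    have "norm (d n *\<^sub>R z) \<le> norm x + L"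
      using L(2)[OF False] norm_triangle_ineq4[of x "x + - d n *\<^sub>R z"] by simp
    then have "(norm (d n *\<^sub>R z))\<^sup>2 \<le> (norm x + L)\<^sup>2" by (intro power_mono) auto
    moreover have "(d n)\<^sup>2 \<le> 1" using d(1,2)[of n] by (simp add: power_le_one less_imp_le)
    moreover have "(d n * rho 1 z)\<^sup>2 = (d n)\<^sup>2 + (norm (d n *\<^sub>R z))\<^sup>2"
      unfolding rho_scale[OF d(1), symmetric] rho_sq ..
    ultimately have "1 + (d n * rho 1 z)\<^sup>2 \<le> 2 + (norm x + L)\<^sup>2" by linarith
    then have "norm (theta k (d n) z) \<le> ?C * (2 + (norm x + L)\<^sup>2) * inverse (rho 1 z) ^ 5"
      using C0 inverse_rho_le_1(2)[of z]
      by (intro order_trans[OF theta_bound[OF d(1)]] mult_right_mono mult_left_mono) auto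
    then have "norm (\<phi> (x + - d n *\<^sub>R z)) * norm (theta k (d n) z) \<le> M * (?C * (2 + (norm x + L)\<^sup>2) * inverse (rho 1 z) ^ 5)"
      using M by (intro mult_mono) auto
    then show ?thesis by (simp only: norm_mult mult.assoc)
  next
    case True
    have "0 \<le> M * (?C * (2 + (norm x + L)\<^sup>2)) * inverse (rho 1 z) ^ 5"
      using M(1) C0 inverse_rho_le_1(2)[of z] by (intro mult_nonneg_nonneg) auto
    with True show ?thesis by simp
  qed
  have pint: "integrable lborel (\<lambda>z::real^3. M * (?C * (2 + (norm x + L)\<^sup>2)) * inverse (rho 1 z) ^ 5)" for x :: "real ^ 3"
    by (rule integrable_mult_right[OF inverse_rho_5_integrable])
  have lim: "(\<lambda>n. \<Phi> n x) \<longlonglongrightarrow> of_real mass * \<phi> x" for x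
  proof -
    have "(\<lambda>n. \<Phi> n x) \<longlonglongrightarrow> (LINT z::real^3|lborel. \<phi> x * of_real (3 * inverse (rho 1 z) ^ 5))"
      unfolding scaled
    proof (rule integral_dominated_convergence[OF _ _ pint])
      have "(\<lambda>n. \<phi> (x + - d n *\<^sub>R z) * theta k (d n) z) \<longlonglongrightarrow> \<phi> (x + - 0 *\<^sub>R z) * of_real (3 * inverse (rho 1 z) ^ 5)" for z
        by (intro tendsto_mult theta_tendsto d continuous_on_tendsto_compose[OF smooth_continuous[OF test_functions_smooth[OF \<phi>], of UNIV]]
            tendsto_intros) auto
      then show "AE z in lborel. (\<lambda>n. \<phi> (x + - d n *\<^sub>R z) * theta k (d n) z) \<longlonglongrightarrow> \<phi> x * of_real (3 * inverse (rho 1 z) ^ 5)"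
        by simp
      show "AE z in lborel. norm (\<phi> (x + - d n *\<^sub>R z) * theta k (d n) z) \<le> M * (?C * (2 + (norm x + L)\<^sup>2)) * inverse (rho 1 z) ^ 5" for n
        by (rule AE_I2) (rule ptb)
    qed measurable
    also have "(LINT z::real^3|lborel. \<phi> x * of_real (3 * inverse (rho 1 z) ^ 5)) = of_real mass * \<phi> x"
      unfolding mass_def integral_mult_right_zero integral_complex_of_real by (simp only: mult.commute)
    finally show ?thesis .
  qed
  define S where "S = (LINT z::real^3|lborel. inverse (rho 1 z) ^ 5)"
  define W where "W = (LINT y|lborel. norm (\<phi> y))"
  have SW: "S \<ge> 0" "W \<ge> 0"
    unfolding S_def W_def by (auto intro!: integral_nonneg_AE simp: rho_def add_nonneg_nonneg)
  \<comment> \<open>One summand for each region. For \<open>norm x \<le> L + 1\<close> the rescaled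
    integral is bounded by a constant, and \<open>(1 + (L + 1)^2) / rho^2\<close> is at least 1.
    Beyond, \<open>x\<close> has distance at least 1 from the support of \<open>\<phi>\<close>, so
    the \<open>d\<close>-uniform bound of \<open>eta\<close> applies, with \<open>a = 1\<close> in
    the shift lemma.\<close>
  define B where "B = M * (?C * (2 + (2 * L + 1)\<^sup>2)) * S * (1 + (L + 1)\<^sup>2) + W * (?C * ((1 + 2 * L\<^sup>2) / 1\<^sup>2 + 2))"
  have bound: "norm (\<Phi> n x) \<le> B * ?w x" for n x
  proof (cases "norm x \<le> L + 1")
    case True
    have "norm (\<Phi> n x) \<le> (LINT z::real^3|lborel. M * (?C * (2 + (norm x + L)\<^sup>2)) * inverse (rho 1 z) ^ 5)"
      unfolding scaled by (rule integral_norm_le[OF pint _ ptb]) measurable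
    also have "\<dots> = M * (?C * (2 + (norm x + L)\<^sup>2)) * S" by (simp add: S_def)
    also have "\<dots> \<le> M * (?C * (2 + (2 * L + 1)\<^sup>2)) * S"
      using True M(1) C0 SW L(1) by (intro mult_right_mono mult_left_mono add_left_mono power_mono) auto
    also have "\<dots> \<le> M * (?C * (2 + (2 * L + 1)\<^sup>2)) * S * ((1 + (L + 1)\<^sup>2) * ?w x)"
    proof -
      have "(rho 1 x)\<^sup>2 \<le> 1 + (L + 1)\<^sup>2"
        unfolding rho_sq using True L(1) by (auto intro!: power_mono)
      then have "1 \<le> (1 + (L + 1)\<^sup>2) * ?w x"
        using rho_pos[of 1 x] by (simp add: power_inverse field_simps)
      then have "M * (?C * (2 + (2 * L + 1)\<^sup>2)) * S * 1 \<le> M * (?C * (2 + (2 * L + 1)\<^sup>2)) * S * ((1 + (L + 1)\<^sup>2) * ?w x)"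
        using M(1) C0 SW by (intro mult_left_mono mult_nonneg_nonneg) auto
      then show ?thesis by simp
    qed
    also have "\<dots> \<le> B * ?w x"
      unfolding B_def mult.assoc[symmetric] using SW C0
      by (intro mult_right_mono) auto
    finally show ?thesis .
  next
    case False
    let ?D = "?C * ((1 + 2 * L\<^sup>2) / 1\<^sup>2 + 2) * ?w x"
    have D: "norm (\<phi> y * eta k (d n) (x - y)) \<le> norm (\<phi> y) * ?D" for y
    proof (cases "\<phi> y = 0")
      case ne: False
      have far: "norm (x - y) \<ge> 1" using False L(2)[OF ne] norm_triangle_ineq2[of x y] by linarith
      have "norm (eta k (d n) (x - y)) \<le> ?C * inverse (rho (d n) (x - y)) ^ 2"
        by (rule eta_bound(2)[OF d(1,2) far])
      also have "\<dots> \<le> ?C * (((1 + 2 * L\<^sup>2) / 1\<^sup>2 + 2) * ?w x)"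
        using L(2)[OF ne] C0 far rho_ge(2)[OF d(1)[of n], of "x - y"]
        by (intro mult_left_mono inverse_rho_sq_shift d(1)) auto
      finally show ?thesis unfolding norm_mult by (intro mult_left_mono) (auto simp: mult.assoc)
    qed simp
    have i: "integrable lborel (\<lambda>y. norm (\<phi> y) * ?D)"
      by (rule integrable_mult_left[OF integrable_norm[OF test_functions_integrable[OF \<phi>]]])
    have "norm (\<Phi> n x) \<le> (LINT y|lborel. norm (\<phi> y) * ?D)"
      unfolding \<Phi>_def by (rule integral_norm_le[OF i _ D]) measurable
    also have "\<dots> = W * (?C * ((1 + 2 * L\<^sup>2) / 1\<^sup>2 + 2)) * ?w x"
      unfolding W_def integral_mult_left_zero by (simp only: mult.assoc)
    also have "\<dots> \<le> B * ?w x"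
      unfolding B_def using SW C0 M(1) by (intro mult_right_mono) auto
    finally show ?thesis .
  qed
  have "(\<lambda>n. LINT x|lborel. u x * \<Phi> n x) \<longlonglongrightarrow> (LINT x|lborel. u x * (of_real mass * \<phi> x))"
  proof (rule integral_dominated_convergence[OF _ _ integrable_mult_right[OF uw, of B]])
    show "AE x in lborel. (\<lambda>n. u x * \<Phi> n x) \<longlonglongrightarrow> u x * (of_real mass * \<phi> x)"
      by (intro AE_I2 tendsto_mult tendsto_const lim)
    show "AE x in lborel. norm (u x * \<Phi> n x) \<le> B * (norm (u x) * ?w x)" for n
    proof (rule AE_I2)
      fix x show "norm (u x * \<Phi> n x) \<le> B * (norm (u x) * ?w x)"
        unfolding norm_mult using mult_left_mono[OF bound[of n x], of "norm (u x)"] by (simp only: mult_ac norm_ge_zero)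
    qed
    show "(\<lambda>x. u x * \<Phi> n x) \<in> borel_measurable lborel" for n
      unfolding \<Phi>_def by measurable
  qed measurable
  then show ?thesis unfolding Fub by (simp add: mult.left_commute)
qed

text \<open>By \<open>sep\<close> the points \<open>y\<close> keep distance at least 1 from the
  support of \<open>f\<close>. The kernels are then bounded by 1, and both limits are dominated
  convergence away from the singularity.\<close>

lemma regularised_kernel_tendsto:
  fixes f :: "real ^ 3 \<Rightarrow> complex"
  assumes f: "f \<in> L2" and fs: "\<And>x. norm x > R \<Longrightarrow> f x = 0" and \<phi>: "\<phi> \<in> test_functions"
    and sep: "\<And>y. \<phi> y \<noteq> 0 \<Longrightarrow> norm y \<ge> R + 1" and d: "\<And>n. 0 < d n" "d \<longlonglongrightarrow> 0"
  shows "(\<lambda>n. LINT y|lborel. \<phi> y * (LINT x|lborel. f x * hk k (d n) 1 (x - y))) \<longlonglongrightarrow> (LINT y|lborel. \<phi> y * far k f y)"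
proof -
  note [measurable] = L2_measurable[OF f] smooth_measurable[OF test_functions_smooth[OF \<phi>]]
  have fi: "integrable lborel (\<lambda>x. norm (f x))"
  proof (rule integrable_le_bound[OF L2_indicator_cball_integrable[OF f, of R]])
    show "norm (norm (f x)) \<le> norm (f x) * indicator (cball 0 R) x" for x
      using fs[of x] by (cases "norm x \<le> R") auto
  qed measurable
  define F where "F = (LINT x|lborel. norm (f x))"
  have far1: "norm (x - y) \<ge> 1" if "\<phi> y \<noteq> 0" "f x \<noteq> 0" for x y
  proof -
    have "norm x \<le> R" using fs[of x] that(2) by force
    then show ?thesis using sep[OF that(1)] norm_triangle_ineq3[of x y] by linarith
  qed
  have b: "norm (f x * hk k (d n) 1 (x - y)) \<le> norm (f x)" if "\<phi> y \<noteq> 0" for x y n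
  proof (cases "f x = 0")
    case False
    have "rho (d n) (x - y) \<ge> 1" using far1[OF that False] rho_ge(2)[OF d(1)[of n], of "x - y"] by linarith
    then have "norm (hk k (d n) 1 (x - y)) \<le> 1" by (simp add: norm_hk[OF d(1)] inverse_le_1_iff)
    then show ?thesis unfolding norm_mult by (intro mult_right_le_one_le) auto
  qed simp
  have l: "(\<lambda>n. LINT x|lborel. f x * hk k (d n) 1 (x - y)) \<longlonglongrightarrow> far k f y" if y: "\<phi> y \<noteq> 0" for y
    unfolding far_def
  proof (rule integral_dominated_convergence[OF _ _ fi])
    have "(\<lambda>n. f x * hk k (d n) 1 (x - y)) \<longlonglongrightarrow> f x * (exp (\<i> * of_real (k * norm (x - y))) * of_real (inverse (norm (x - y))))" for x
    proof (cases "f x = 0")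
      case False
      have "(\<lambda>n. rho (d n) (x - y)) \<longlonglongrightarrow> sqrt (0\<^sup>2 + (norm (x - y))\<^sup>2)"
        unfolding rho_def by (intro tendsto_intros d)
      then have r: "(\<lambda>n. rho (d n) (x - y)) \<longlonglongrightarrow> norm (x - y)" by simp
      have "norm (x - y) \<noteq> 0" using far1[OF y False] by linarith
      then show ?thesis unfolding hk_def power_one_right
        by (intro tendsto_intros r)
    qed simp
    then show "AE x in lborel. (\<lambda>n. f x * hk k (d n) 1 (x - y)) \<longlonglongrightarrow> f x * (exp (\<i> * of_real (k * norm (x - y))) * of_real (inverse (norm (x - y))))"
      by simp
    show "AE x in lborel. norm (f x * hk k (d n) 1 (x - y)) \<le> norm (f x)" for n
      by (rule AE_I2) (rule b[OF y])
  qed measurable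
  show ?thesis
  proof (rule integral_dominated_convergence[OF _ _ integrable_mult_left[OF integrable_norm[OF test_functions_integrable[OF \<phi>]], of F]])
    show "AE y in lborel. (\<lambda>n. \<phi> y * (LINT x|lborel. f x * hk k (d n) 1 (x - y))) \<longlonglongrightarrow> \<phi> y * far k f y"
    proof (rule AE_I2)
      fix y show "(\<lambda>n. \<phi> y * (LINT x|lborel. f x * hk k (d n) 1 (x - y))) \<longlonglongrightarrow> \<phi> y * far k f y"
        using l[of y] by (cases "\<phi> y = 0") (auto intro!: tendsto_mult)
    qed
    show "AE y in lborel. norm (\<phi> y * (LINT x|lborel. f x * hk k (d n) 1 (x - y))) \<le> norm (\<phi> y) * F" for n
    proof (rule AE_I2)
      fix y
      show "norm (\<phi> y * (LINT x|lborel. f x * hk k (d n) 1 (x - y))) \<le> norm (\<phi> y) * F"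
      proof (cases "\<phi> y = 0")
        case False
        have "norm (LINT x|lborel. f x * hk k (d n) 1 (x - y)) \<le> F"
          unfolding F_def
          by (rule integral_norm_le[OF fi _ b[OF False]]) measurable
        then show ?thesis unfolding norm_mult by (rule mult_left_mono) simp
      qed simp
    qed
    show "(\<lambda>y. \<phi> y * far k f y) \<in> borel_measurable lborel" unfolding far_def by measurable
  qed measurable
qed

text \<open>The equation contains \<open>k\<close> only through its square, whereas
  \<open>far\<close> depends on its sign. A single \<open>u\<close> therefore has two
  representations.\<close>

theorem helmholtz_representation:
  fixes u f :: "real ^ 3 \<Rightarrow> complex"
  assumes u: "u \<in> L2" and f: "f \<in> L2" and fs: "\<And>x. norm x > R \<Longrightarrow> f x = 0"
    and eq: "\<And>\<phi>. \<phi> \<in> test_functions \<Longrightarrow> (LINT x|lborel. u x * (lap \<phi> x + of_real (k\<^sup>2) * \<phi> x)) = - (LINT x|lborel. f x * \<phi> x)"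
    and \<phi>: "\<phi> \<in> test_functions" and sep: "\<And>y. \<phi> y \<noteq> 0 \<Longrightarrow> norm y \<ge> R + 1"
  shows "of_real mass * (LINT x|lborel. u x * \<phi> x) = (LINT y|lborel. \<phi> y * far k f y)"
proof -
  define d where "d n = inverse (real (Suc n))" for n
  have d: "0 < d n" "d n \<le> 1" for n by (auto simp: d_def inverse_le_1_iff)
  have d0: "d \<longlonglongrightarrow> 0" unfolding d_def by (rule LIMSEQ_inverse_real_of_nat)
  have e: "(LINT x|lborel. u x * eta k (d n) (x - y)) = (LINT x|lborel. f x * hk k (d n) 1 (x - y))" for n y
    by (rule regularised_representation[OF u f fs eq d])
  show ?thesis
    using regularised_delta_tendsto[OF u \<phi> d d0, of k] regularised_kernel_tendsto[OF f fs \<phi> sep d(1) d0, of k]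
    unfolding e by (rule LIMSEQ_unique)
qed

section \<open>Rellich's theorem\<close>

text \<open>The mollification of \<open>u\<close> at \<open>t\<close> is the pairing of
  \<open>u\<close> with a test function supported within distance 1 of \<open>t\<close>, so it
  vanishes for \<open>norm t \<ge> A + 1\<close>. On that set \<open>u\<close> is therefore its own
  approximation error.\<close>

lemma L2_zero_outside:
  fixes u :: "real ^ 'n \<Rightarrow> complex"
  assumes u: "u \<in> L2"
    and z: "\<And>\<phi>. \<phi> \<in> test_functions \<Longrightarrow> (\<And>y. \<phi> y \<noteq> 0 \<Longrightarrow> norm y \<ge> A) \<Longrightarrow> (LINT x|lborel. u x * \<phi> x) = 0"
  shows "AE x in lborel. norm x \<ge> A + 1 \<longrightarrow> u x = 0"
proof -
  note [measurable] = L2_measurable[OF u]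
  obtain m :: "nat \<Rightarrow> real ^ 'n \<Rightarrow> complex"
    where m: "\<And>n. m n \<in> test_functions" and m1: "\<And>n x. norm x \<ge> 1 \<Longrightarrow> m n x = 0"
      and lim: "\<And>u. u \<in> L2 \<Longrightarrow> (\<lambda>n. sqn (\<lambda>t. conv u (m n) t - u t)) \<longlonglongrightarrow> 0"
    by (rule exists_mollifiers) (rule that; assumption)
  let ?U = "{x :: real ^ 'n. norm x \<ge> A + 1}"
  let ?v = "\<lambda>x. indicator ?U x * u x"
  have vL: "?v \<in> L2"
    by (rule L2_bounded_mult[OF u, of _ 1]) (auto simp: indicator_def)
  have c0: "conv u (m n) t = 0" if "norm t \<ge> A + 1" for n t
    unfolding conv_def
  proof (rule z[OF test_functions_reflect[OF m]])
    fix y assume "m n (t - y) \<noteq> 0"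
    then have "norm (t - y) < 1" using m1 not_le by blast
    then show "A \<le> norm y" using that norm_triangle_ineq2[of t y] by linarith
  qed
  have "sqn ?v \<le> sqn (\<lambda>t. conv u (m n) t - u t)" for n
    unfolding sqn_def
  proof (rule integral_mono)
    show "(norm (?v x))\<^sup>2 \<le> (norm (conv u (m n) x - u x))\<^sup>2" for x
      using c0[of x n] by (cases "norm x \<ge> A + 1") auto
  qed (intro L2_integrable vL L2_diff conv_L2 u m)+
  then have "sqn ?v \<le> 0"
    by (intro LIMSEQ_le_const[OF lim[OF u]]) auto
  then have "sqn ?v = 0" using sqn_nonneg[of ?v] by linarith
  from sqn_eq_0[OF vL this] show ?thesis by eventually_elim (auto simp: indicator_def split: if_splits)
qed

text \<open>Dominated convergence for the difference quotients. Cauchy's inequality turns the bound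
  \<open>w\<close> on the functions into the bound \<open>w / \<delta>\<close> on their derivatives,
  hence on the quotients.\<close>

lemma holomorphic_parametric_integral:
  fixes g :: "complex \<Rightarrow> 'a \<Rightarrow> complex"
  assumes hol: "\<And>x. (\<lambda>s. g s x) holomorphic_on ball 0 r" and m: "\<And>s. s \<in> ball 0 r \<Longrightarrow> g s \<in> borel_measurable M"
    and w: "integrable M w" and b: "\<And>s x. s \<in> ball 0 r \<Longrightarrow> norm (g s x) \<le> w x"
  shows "(\<lambda>s. LINT x|M. g s x) holomorphic_on ball 0 r"
proof (rule holomorphic_onI)
  fix s0 :: complex assume s0: "s0 \<in> ball 0 r"
  \<comment> \<open>A third of the distance to the boundary, so that closed discs of radius
    \<open>\<delta>\<close> around points of \<open>ball s0 \<delta>\<close> remain inside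
    \<open>ball 0 r\<close>.\<close>
  define \<delta> where "\<delta> = (r - norm s0) / 3"
  have \<delta>: "\<delta> > 0" using s0 by (simp add: \<delta>_def)
  have sub: "cball s \<delta> \<subseteq> ball 0 r" if "s \<in> ball s0 \<delta>" for s
  proof
    fix z assume "z \<in> cball s \<delta>"
    then have "norm z \<le> norm s0 + norm (s - s0) + norm (z - s)" "norm (z - s) \<le> \<delta>" "norm (s - s0) < \<delta>"
      using that norm_triangle_ineq[of s0 "s - s0"] norm_triangle_ineq[of s "z - s"]
      by (auto simp: dist_norm norm_minus_commute)
    then show "z \<in> ball 0 r" using s0 by (simp add: \<delta>_def field_simps)
  qed
  have s0b: "s0 \<in> ball s0 \<delta>" using \<delta> by simp
  have cb: "s \<in> ball 0 r" if "s \<in> ball s0 \<delta>" for s using sub[OF that] \<delta> by force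
  have der: "((\<lambda>s. g s x) has_field_derivative deriv (\<lambda>s. g s x) s) (at s)" if "s \<in> ball 0 r" for s x
    by (rule holomorphic_derivI[OF hol open_ball that])
  have db: "norm (deriv (\<lambda>s. g s x) s) \<le> w x / \<delta>" if s: "s \<in> ball s0 \<delta>" for s x
  proof -
    have "norm ((deriv ^^ 1) (\<lambda>s. g s x) s) \<le> fact 1 * w x / \<delta> ^ 1"
    proof (rule Cauchy_inequality)
      show "(\<lambda>s. g s x) holomorphic_on ball s \<delta>"
        by (rule holomorphic_on_subset[OF hol]) (use sub[OF s] in force)
      show "continuous_on (cball s \<delta>) (\<lambda>s. g s x)"
        by (rule continuous_on_subset[OF holomorphic_on_imp_continuous_on[OF hol] sub[OF s]])
      show "norm (g z x) \<le> w x" if "norm (s - z) = \<delta>" for z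
        by (rule b) (use sub[OF s] that in \<open>auto simp: dist_norm\<close>)
    qed (rule \<delta>)
    then show ?thesis by simp
  qed
  have lip: "norm (g s x - g s0 x) \<le> w x / \<delta> * norm (s - s0)" if "s \<in> ball s0 \<delta>" for s x
    by (rule field_differentiable_bound[of "ball s0 \<delta>" "\<lambda>s. g s x" "deriv (\<lambda>s. g s x)"])
       (use that s0b in \<open>auto intro!: db has_field_derivative_at_within der cb simp del: mem_ball\<close>)
  have gi: "integrable M (g s)" if "s \<in> ball 0 r" for s
    by (rule integrable_le_bound[OF w m[OF that] b[OF that]])
  have "((\<lambda>s. LINT x|M. g s x) has_field_derivative (LINT x|M. deriv (\<lambda>s. g s x) s0)) (at s0)"
    unfolding has_field_derivative_iff
  proof (rule iffD2[OF tendsto_at_iff_sequentially], intro allI impI, unfold comp_def)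
    fix S :: "nat \<Rightarrow> complex" assume S0: "\<forall>n. S n \<in> UNIV - {s0}" and S: "S \<longlonglongrightarrow> s0"
    obtain N where N: "\<And>n. n \<ge> N \<Longrightarrow> S n \<in> ball s0 \<delta>"
      using topological_tendstoD[OF S open_ball s0b] by (auto simp: eventually_sequentially)
    let ?S = "\<lambda>n. S (n + N)"
    have SB: "?S n \<in> ball s0 \<delta>" "?S n \<noteq> s0" for n using N[of "n + N"] S0 by auto
    have at: "filterlim ?S (at s0) sequentially"
      using LIMSEQ_ignore_initial_segment[OF S, of N] SB(2) by (simp add: filterlim_at)
    have qm: "(\<lambda>x. (g (?S n) x - g s0 x) / (?S n - s0)) \<in> borel_measurable M" for n
      using m[OF cb[OF SB(1)]] m[OF s0] by measurable
    have ql: "(\<lambda>n. (g (?S n) x - g s0 x) / (?S n - s0)) \<longlonglongrightarrow> deriv (\<lambda>s. g s x) s0" for x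
      using der[OF s0, of x, unfolded has_field_derivative_iff] at by (rule filterlim_compose)
    have "(\<lambda>n. LINT x|M. (g (?S n) x - g s0 x) / (?S n - s0)) \<longlonglongrightarrow> (LINT x|M. deriv (\<lambda>s. g s x) s0)"
    proof (rule integral_dominated_convergence)
      show "integrable M (\<lambda>x. w x / \<delta>)" using w by simp
      show "AE x in M. (\<lambda>n. (g (?S n) x - g s0 x) / (?S n - s0)) \<longlonglongrightarrow> deriv (\<lambda>s. g s x) s0"
        by (rule AE_I2) (rule ql)
      show "AE x in M. norm ((g (?S n) x - g s0 x) / (?S n - s0)) \<le> w x / \<delta>" for n
      proof (rule AE_I2)
        fix x
        have "norm (?S n - s0) > 0" using SB(2) by simp
        then show "norm ((g (?S n) x - g s0 x) / (?S n - s0)) \<le> w x / \<delta>"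
          using lip[OF SB(1), of n x] by (simp add: norm_divide divide_le_eq)
      qed
      show "(\<lambda>x. deriv (\<lambda>s. g s x) s0) \<in> borel_measurable M"
        by (rule borel_measurable_LIMSEQ_metric[OF qm ql])
    qed (rule qm)
    moreover have "(LINT x|M. (g (?S n) x - g s0 x) / (?S n - s0)) = ((LINT x|M. g (?S n) x) - (LINT x|M. g s0 x)) / (?S n - s0)" for n
      by (subst integral_divide_zero) (use gi[OF cb[OF SB(1)]] gi[OF s0] in simp)
    ultimately have "(\<lambda>n. ((LINT x|M. g (?S n) x) - (LINT x|M. g s0 x)) / (?S n - s0)) \<longlonglongrightarrow> (LINT x|M. deriv (\<lambda>s. g s x) s0)"
      by (simp only:)
    then show "(\<lambda>n. ((LINT x|M. g (S n) x) - (LINT x|M. g s0 x)) / (S n - s0)) \<longlonglongrightarrow> (LINT x|M. deriv (\<lambda>s. g s x) s0)"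
      by (rule LIMSEQ_offset)
  qed
  then show "(\<lambda>s. LINT x|M. g s x) field_differentiable at s0 within ball 0 r"
    by (auto simp: field_differentiable_def intro: has_field_derivative_at_within)
qed

text \<open>On the negative imaginary axis \<open>exp (2\<i>k/s)\<close> decays faster than every power of \<open>s\<close>, so \<open>B\<close> has no zero of finite
  order at the origin.\<close>

lemma essential_singularity_zero:
  fixes A B :: "complex \<Rightarrow> complex"
  assumes r: "r > 0" and k: "k > 0" and A: "A holomorphic_on ball 0 r" and B: "B holomorphic_on ball 0 r"
    and eq: "\<And>t. 0 < t \<Longrightarrow> t < r \<Longrightarrow> A (of_real t) * exp (2 * \<i> * of_real k / of_real t) = B (of_real t)"
    and z: "z \<in> ball 0 r"
  shows "B z = 0"
proof -
  let ?U = "ball 0 r - {0} :: complex set"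
  have e: "A w * exp (2 * \<i> * of_real k / w) - B w = 0" if w: "w \<in> ?U" for w
  \<comment> \<open>The exponential is holomorphic away from 0 and the punctured disc is connected,
    so the relation spreads from the real segment to the imaginary axis.\<close>
  proof (rule analytic_continuation[of "\<lambda>w. A w * exp (2 * \<i> * of_real k / w) - B w" ?U "of_real ` {0<..<r}" "of_real (r / 2)"])
    show "(\<lambda>w. A w * exp (2 * \<i> * of_real k / w) - B w) holomorphic_on ?U"
      by (intro holomorphic_intros holomorphic_on_subset[OF A] holomorphic_on_subset[OF B]) auto
    show "connected ?U" by (rule connected_punctured_ball) simp
    show "complex_of_real ` {0<..<r} \<subseteq> ?U" by auto
    show "complex_of_real (r / 2) islimpt complex_of_real ` {0<..<r}"
    proof (rule islimpt_isCont_image)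
      show "(r / 2) islimpt {0<..<r}" by (rule interior_limit_point) (use r in \<open>simp add: interior_open\<close>)
      show "\<forall>\<^sub>F x in at (r / 2). complex_of_real x \<noteq> complex_of_real (r / 2)"
        unfolding of_real_eq_iff by (simp add: eventually_at_filter)
    qed auto
  qed (use r w eq in auto)
  \<comment> \<open>Here \<open>2 * \<i> * k / s\<close> is real and tends to minus infinity. The
    offset 2 keeps every point strictly inside the disc.\<close>
  let ?s = "\<lambda>m::nat. - \<i> * of_real (r / (real m + 2))"
  have sU: "?s m \<in> ?U" for m
  proof -
    have n: "norm (?s m) = r / (real m + 2)"
      by (simp only: norm_mult norm_minus_cancel norm_ii norm_of_real mult_1) (use r in simp)
    have "r / (real m + 2) < r" "r / (real m + 2) > 0" using r by (auto simp: field_simps add_pos_nonneg)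
    then show ?thesis using n by (simp only: Diff_iff mem_ball_0 singleton_iff) (metis less_irrefl norm_zero)
  qed
  have ex: "exp (2 * \<i> * of_real k / ?s m) = of_real (exp (- (2 * k / r) * (real m + 2)))" for m
  proof -
    have "2 * \<i> * of_real k / ?s m = of_real (- (2 * k / r) * (real m + 2))"
      using r by (simp add: field_simps)
    then show ?thesis by (simp only: exp_of_real)
  qed
  have s0: "?s \<longlonglongrightarrow> 0"
  proof -
    have "(\<lambda>m. r / (real m + 2)) \<longlonglongrightarrow> 0" by real_asymp
    then have "(\<lambda>m. - \<i> * complex_of_real (r / (real m + 2))) \<longlonglongrightarrow> - \<i> * of_real 0" by (intro tendsto_intros)
    then show ?thesis by simp
  qed
  have Acont: "(\<lambda>m. A (?s m)) \<longlonglongrightarrow> A 0"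
    by (rule continuous_on_tendsto_compose[OF holomorphic_on_imp_continuous_on[OF A] s0]) (use r sU in auto)
  have Bs: "B (?s m) = A (?s m) * of_real (exp (- (2 * k / r) * (real m + 2)))" for m
    using e[OF sU[of m]] unfolding ex by (simp only: right_minus_eq)
  have c: "2 * k / r > 0" using k r by simp
  have pexp: "(\<lambda>m. (real m + 2) ^ n * exp (- (2 * k / r) * (real m + 2))) \<longlonglongrightarrow> 0" for n
  proof -
    have "filterlim (\<lambda>m. (2 * k / r) * (real m + 2)) at_top sequentially" using c by real_asymp
    from filterlim_compose[OF tendsto_power_div_exp_0[of n] this]
    have "(\<lambda>m. inverse ((2 * k / r) ^ n) * (((2 * k / r) * (real m + 2)) ^ n / exp ((2 * k / r) * (real m + 2)))) \<longlonglongrightarrow> 0"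
      by (rule tendsto_mult_right_zero)
    moreover have "inverse ((2 * k / r) ^ n) * (((2 * k / r) * (real m + 2)) ^ n / exp ((2 * k / r) * (real m + 2))) = (real m + 2) ^ n * exp (- (2 * k / r) * (real m + 2))" for m
    proof -
      have "inverse (q ^ n) * ((q * X) ^ n / exp (q * X)) = X ^ n * exp (- q * X)" if "q \<noteq> 0" for q X :: real
        using that by (simp add: power_mult_distrib exp_minus divide_inverse mult.assoc[symmetric])
      moreover have "2 * k / r \<noteq> 0" using k r by simp
      ultimately show ?thesis .
    qed
    ultimately show ?thesis by (simp only:)
  qed
  have Blim: "(\<lambda>m. of_real ((real m + 2) ^ n) * B (?s m)) \<longlonglongrightarrow> 0" for n
  proof -
    have "(\<lambda>m. A (?s m) * of_real ((real m + 2) ^ n * exp (- (2 * k / r) * (real m + 2)))) \<longlonglongrightarrow> A 0 * of_real 0"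
      by (intro tendsto_intros Acont pexp)
    moreover have "of_real ((real m + 2) ^ n) * B (?s m) = A (?s m) * of_real ((real m + 2) ^ n * exp (- (2 * k / r) * (real m + 2)))" for m
      unfolding Bs of_real_mult by (simp only: mult.left_commute)
    ultimately show ?thesis by (simp only: of_real_0 mult_zero_right)
  qed
  have Bcont: "(\<lambda>m. B (?s m)) \<longlonglongrightarrow> B 0"
    by (rule continuous_on_tendsto_compose[OF holomorphic_on_imp_continuous_on[OF B] s0]) (use r sU in auto)
  have B0: "B 0 = 0" using LIMSEQ_unique[OF Bcont] Blim[of 0] by simp
  have "B constant_on ball 0 r"
  proof (rule ccontr)
    assume nc: "\<not> B constant_on ball 0 r"
    have c0: "(0 :: complex) \<in> ball 0 r" using r by simp
    \<comment> \<open>At a zero of order \<open>n\<close>, multiplying by \<open>(m + 2) ^ n\<close>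
      exactly compensates \<open>?s m ^ n\<close> and leaves the nonzero limit
      \<open>(- \<i> * r) ^ n * g 0\<close>, against \<open>Blim\<close>.\<close>
    obtain g \<delta> n where n: "0 < n" and \<delta>: "0 < \<delta>" "ball (0 :: complex) \<delta> \<subseteq> ball 0 r" and g: "g holomorphic_on ball 0 \<delta>"
      and fac: "\<And>w. w \<in> ball 0 \<delta> \<Longrightarrow> B w = (w - 0) ^ n * g w" and g0: "\<And>w. w \<in> ball 0 \<delta> \<Longrightarrow> g w \<noteq> 0"
      by (rule holomorphic_factor_zero_nonconstant[OF B open_ball connected_ball c0 B0 nc]) (rule that, assumption+)
    have ev: "\<forall>\<^sub>F m in sequentially. ?s m \<in> ball 0 \<delta>"
      using topological_tendstoD[OF s0 open_ball, of 0 \<delta>] \<delta> by simp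
    have gl: "(\<lambda>m. g (?s m)) \<longlonglongrightarrow> g 0"
      by (rule continuous_on_tendsto_compose[OF holomorphic_on_imp_continuous_on[OF g] s0]) (use \<delta> ev in auto)
    have "(\<lambda>m. (- \<i> * of_real r) ^ n * g (?s m)) \<longlonglongrightarrow> (- \<i> * of_real r) ^ n * g 0"
      by (intro tendsto_intros gl)
    moreover have "\<forall>\<^sub>F m in sequentially. of_real ((real m + 2) ^ n) * B (?s m) = (- \<i> * of_real r) ^ n * g (?s m)"
      using ev
    proof eventually_elim
      case (elim m)
      have "(real m + 2) * (r / (real m + 2)) = r" using of_nat_0_le_iff[of m] by (simp add: field_simps)
      then have "complex_of_real (real m + 2) * of_real (r / (real m + 2)) = of_real r"
        by (simp only: of_real_mult[symmetric])
      then have "complex_of_real (real m + 2) * ?s m = - \<i> * of_real r" by (simp only: mult.left_commute)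
      then have "of_real ((real m + 2) ^ n) * (?s m) ^ n = (- \<i> * of_real r) ^ n"
        by (simp only: of_real_power power_mult_distrib[symmetric])
      then show ?case using fac[OF elim] by (simp add: mult.assoc[symmetric])
    qed
    ultimately have "(\<lambda>m. of_real ((real m + 2) ^ n) * B (?s m)) \<longlonglongrightarrow> (- \<i> * of_real r) ^ n * g 0"
      by (simp add: tendsto_cong)
    from LIMSEQ_unique[OF this Blim] show False using r g0[of 0] \<delta> by simp
  qed
  then show ?thesis using z r B0 unfolding constant_on_def by (metis centre_in_ball)
qed

text \<open>With \<open>y = \<omega>/s\<close> one has \<open>|x - y| = far_root/s\<close>, and \<open>(far_root - 1)/s\<close> is written without division by \<open>s\<close>, so that the kernel is
  \<open>s exp (\<i>k/s)\<close> times a function holomorphic in \<open>s\<close> near the origin.\<close>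

definition far_root :: "real ^ 3 \<Rightarrow> complex \<Rightarrow> real ^ 3 \<Rightarrow> complex" where
  "far_root \<omega> s x = csqrt (1 - 2 * s * of_real (\<omega> \<bullet> x) + s\<^sup>2 * of_real ((norm x)\<^sup>2))"

definition far_kernel :: "real \<Rightarrow> real ^ 3 \<Rightarrow> complex \<Rightarrow> real ^ 3 \<Rightarrow> complex" where
  "far_kernel k \<omega> s x = exp (\<i> * of_real k * ((- 2 * of_real (\<omega> \<bullet> x) + s * of_real ((norm x)\<^sup>2)) / (far_root \<omega> s x + 1))) / far_root \<omega> s x"

text \<open>Here \<open>norm s * norm x \<le> 1 / 4\<close>, so the radicand differs from 1 by at
  most \<open>1/2 + 1/16\<close>. It stays off the branch cut of \<open>csqrt\<close>, and the
  denominators \<open>far_root\<close> and \<open>far_root + 1\<close> stay away from 0.\<close>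

lemma far_root_estimate:
  assumes \<omega>: "norm \<omega> = 1" and R: "R > 0" and x: "norm x \<le> R" and s: "norm s < 1 / (4 * R)"
  shows "Re (1 - 2 * s * of_real (\<omega> \<bullet> x) + s\<^sup>2 * of_real ((norm x)\<^sup>2)) \<ge> 1 / 4"
    and "norm (far_root \<omega> s x) \<ge> 1 / 2" and "Re (far_root \<omega> s x) \<ge> 0"
proof -
  let ?Z = "1 - 2 * s * of_real (\<omega> \<bullet> x) + s\<^sup>2 * complex_of_real ((norm x)\<^sup>2)"
  have sx: "norm s * norm x \<le> 1 / 4"
  proof -
    have "norm s * norm x \<le> (1 / (4 * R)) * R" using s x R by (intro mult_mono) auto
    then show ?thesis using R by simp
  qed
  have ox: "\<bar>\<omega> \<bullet> x\<bar> \<le> norm x" using Cauchy_Schwarz_ineq2[of \<omega> x] \<omega> by simp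
  have "norm (2 * s * of_real (\<omega> \<bullet> x)) \<le> 2 * (norm s * norm x)"
    using ox by (simp add: norm_mult mult_left_mono)
  then have a: "norm (2 * s * complex_of_real (\<omega> \<bullet> x)) \<le> 1 / 2" using sx by linarith
  have "norm (s\<^sup>2 * complex_of_real ((norm x)\<^sup>2)) = (norm s * norm x)\<^sup>2"
    by (simp add: norm_mult norm_power power_mult_distrib)
  also have "\<dots> \<le> (1 / 4)\<^sup>2" using sx by (intro power_mono) auto
  finally have b: "norm (s\<^sup>2 * complex_of_real ((norm x)\<^sup>2)) \<le> 1 / 16" by (simp add: power2_eq_square)
  have "Re ?Z = 1 - Re (2 * s * complex_of_real (\<omega> \<bullet> x)) + Re (s\<^sup>2 * complex_of_real ((norm x)\<^sup>2))"
    by simp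
  then show Z: "Re ?Z \<ge> 1 / 4"
    using a b abs_Re_le_cmod[of "2 * s * complex_of_real (\<omega> \<bullet> x)"] abs_Re_le_cmod[of "s\<^sup>2 * complex_of_real ((norm x)\<^sup>2)"]
    by linarith
  have "(norm (far_root \<omega> s x))\<^sup>2 = norm ?Z" by (simp only: far_root_def norm_power[symmetric] power2_csqrt)
  then have "(norm (far_root \<omega> s x))\<^sup>2 \<ge> (1 / 2)\<^sup>2" using Z complex_Re_le_cmod[of ?Z] by (simp add: power2_eq_square)
  then show "norm (far_root \<omega> s x) \<ge> 1 / 2" by (rule power2_le_imp_le) simp
  show "Re (far_root \<omega> s x) \<ge> 0" unfolding far_root_def using csqrt_principal by (metis less_imp_le order_refl)
qed

lemma far_kernel_bound:
  assumes \<omega>: "norm \<omega> = 1" and R: "R > 0" and x: "norm x \<le> R" and s: "norm s < 1 / (4 * R)"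
  shows "norm (far_kernel k \<omega> s x) \<le> 2 * exp (\<bar>k\<bar> * (3 * R))"
proof -
  let ?p = "far_root \<omega> s x" and ?n = "- 2 * of_real (\<omega> \<bullet> x) + s * complex_of_real ((norm x)\<^sup>2)"
  note e = far_root_estimate[OF assms]
  have p1: "norm (?p + 1) \<ge> 1" using e(3) complex_Re_le_cmod[of "?p + 1"] by simp
  have ox: "\<bar>\<omega> \<bullet> x\<bar> \<le> R" using Cauchy_Schwarz_ineq2[of \<omega> x] \<omega> x by simp
  have "norm ?n \<le> 2 * \<bar>\<omega> \<bullet> x\<bar> + norm s * (norm x)\<^sup>2"
    by (rule order_trans[OF norm_triangle_ineq]) (simp add: norm_mult norm_power)
  also have "norm s * (norm x)\<^sup>2 \<le> (1 / (4 * R)) * R\<^sup>2" using s x R by (intro mult_mono power_mono) auto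
  also have "(1 / (4 * R)) * R\<^sup>2 = R / 4" using R by (simp add: power2_eq_square)
  finally have "norm ?n \<le> 3 * R" using ox R by linarith
  then have "norm (?n / (?p + 1)) \<le> 3 * R / 1"
    unfolding norm_divide using p1 R by (intro frac_le) auto
  then have "\<bar>k\<bar> * norm (?n / (?p + 1)) \<le> \<bar>k\<bar> * (3 * R)" by (intro mult_left_mono) auto
  moreover have "norm (\<i> * of_real k * z) = \<bar>k\<bar> * norm z" for z by (simp add: norm_mult)
  ultimately have "norm (\<i> * of_real k * (?n / (?p + 1))) \<le> \<bar>k\<bar> * (3 * R)" by (simp only:)
  then have "norm (exp (\<i> * of_real k * (?n / (?p + 1)))) \<le> exp (\<bar>k\<bar> * (3 * R))"
    using norm_exp[of "\<i> * of_real k * (?n / (?p + 1))"] by (meson exp_le_cancel_iff order_trans)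
  then have "norm (far_kernel k \<omega> s x) \<le> exp (\<bar>k\<bar> * (3 * R)) / (1 / 2)"
    unfolding far_kernel_def norm_divide using e(2) by (intro frac_le) auto
  then show ?thesis by simp
qed

lemma far_kernel_holomorphic:
  assumes \<omega>: "norm \<omega> = 1" and R: "R > 0" and x: "norm x \<le> R"
  shows "(\<lambda>s. far_kernel k \<omega> s x) holomorphic_on ball 0 (1 / (4 * R))"
proof -
  have r: "far_root \<omega> s x \<noteq> 0" "far_root \<omega> s x + 1 \<noteq> 0"
    "1 - 2 * s * of_real (\<omega> \<bullet> x) + s\<^sup>2 * of_real ((norm x)\<^sup>2) \<notin> \<real>\<^sub>\<le>\<^sub>0"
    if "s \<in> ball 0 (1 / (4 * R))" for s
  proof -
    have s: "norm s < 1 / (4 * R)" using that by simp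
    note e = far_root_estimate[OF \<omega> R x s]
    show "far_root \<omega> s x \<noteq> 0" using e(2) by auto
    show "far_root \<omega> s x + 1 \<noteq> 0"
    proof
      assume "far_root \<omega> s x + 1 = 0"
      then have "Re (far_root \<omega> s x) + 1 = 0" by (metis one_complex.simps(1) plus_complex.simps(1) zero_complex.simps(1))
      with e(3) show False by linarith
    qed
    show "1 - 2 * s * of_real (\<omega> \<bullet> x) + s\<^sup>2 * of_real ((norm x)\<^sup>2) \<notin> \<real>\<^sub>\<le>\<^sub>0"
      using e(1) by (auto simp: complex_nonpos_Reals_iff)
  qed
  have h: "(\<lambda>s. far_root \<omega> s x) holomorphic_on ball 0 (1 / (4 * R))"
    unfolding far_root_def by (intro holomorphic_intros) (rule r(3))
  show ?thesis
    unfolding far_kernel_def by (intro holomorphic_intros h) (use r in blast)+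
qed

lemma far_kernel_eq:
  assumes \<omega>: "norm \<omega> = 1" and R: "R > 0" and x: "norm x \<le> R" and t: "0 < t" "t < 1 / (4 * R)"
  shows "exp (\<i> * of_real (k * norm (x - inverse t *\<^sub>R \<omega>))) * of_real (inverse (norm (x - inverse t *\<^sub>R \<omega>)))
    = of_real t * exp (\<i> * of_real (k / t)) * far_kernel k \<omega> (of_real t) x"
proof -
  let ?y = "inverse t *\<^sub>R \<omega>"
  define p where "p = t * norm (x - ?y)"
  have p0: "p \<ge> 0" using t by (simp add: p_def)
  have p2: "p\<^sup>2 = 1 - 2 * t * (\<omega> \<bullet> x) + t\<^sup>2 * (norm x)\<^sup>2"
  proof -
    have "(norm (x - ?y))\<^sup>2 = (norm x)\<^sup>2 - 2 * (x \<bullet> ?y) + (norm ?y)\<^sup>2"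
      by (simp add: power2_norm_eq_inner inner_diff_left inner_diff_right inner_commute algebra_simps del: norm_scaleR inner_scaleR_left inner_scaleR_right)
    also have "\<dots> = (norm x)\<^sup>2 - 2 * (inverse t * (\<omega> \<bullet> x)) + (inverse t)\<^sup>2"
      using \<omega> t by (simp add: inner_commute power_mult_distrib)
    finally have "p\<^sup>2 = t\<^sup>2 * ((norm x)\<^sup>2 - 2 * (inverse t * (\<omega> \<bullet> x)) + (inverse t)\<^sup>2)"
      by (simp add: p_def power_mult_distrib)
    moreover have "t\<^sup>2 * (N - 2 * (inverse t * c) + (inverse t)\<^sup>2) = t\<^sup>2 * N - 2 * t * (t * inverse t) * c + (t * inverse t)\<^sup>2" for N c
      by (simp add: power2_eq_square algebra_simps)
    moreover have "t * inverse t = 1" using t by simp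
    ultimately show ?thesis by simp
  qed
  have root: "far_root \<omega> (of_real t) x = of_real p"
  proof -
    have "far_root \<omega> (of_real t) x = csqrt (of_real (p\<^sup>2))" by (simp add: far_root_def p2)
    also have "\<dots> = of_real (sqrt (p\<^sup>2))" by (rule of_real_sqrt[symmetric]) simp
    finally show ?thesis using p0 by simp
  qed
  have ps: "norm (complex_of_real t) < 1 / (4 * R)" using t by simp
  have ppos: "p > 0" using far_root_estimate(2)[OF \<omega> R x ps] p0 unfolding root by auto
  \<comment> \<open>The rationalised form of \<open>(p - 1) / t\<close>: the product
    \<open>(p - 1) * (p + 1)\<close> has \<open>t\<close> as a factor.\<close>
  define q where "q = (- 2 * (\<omega> \<bullet> x) + t * (norm x)\<^sup>2) / (p + 1)"
  have q: "q = (p - 1) / t"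
  proof -
    have "t * (- 2 * (\<omega> \<bullet> x) + t * (norm x)\<^sup>2) = (p - 1) * (p + 1)"
      using p2 by (simp add: algebra_simps power2_eq_square)
    then show ?thesis unfolding q_def using t p0 by (simp add: field_simps)
  qed
  have n: "norm (x - ?y) = p / t" using t by (simp add: p_def)
  have "far_kernel k \<omega> (of_real t) x = exp (\<i> * of_real k * of_real q) / of_real p"
    unfolding far_kernel_def root q_def by simp
  moreover have "exp (\<i> * of_real (k / t)) * exp (\<i> * of_real k * of_real q) = exp (\<i> * of_real (k * (p / t)))"
  proof -
    have "\<i> * of_real (k / t) + \<i> * of_real k * of_real q = \<i> * of_real (k / t + k * q)" by (simp add: distrib_left)
    also have "k / t + k * q = k * (p / t)" unfolding q using t by (simp add: field_simps)
    finally show ?thesis by (simp only: exp_add[symmetric])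
  qed
  moreover have "complex_of_real (inverse (p / t)) = of_real t / of_real p" using t ppos by simp
  ultimately show ?thesis unfolding n by (simp add: mult_ac)
qed

lemma far_kernel_measurable [measurable]: "far_kernel k \<omega> s \<in> borel_measurable borel"
proof -
  have [measurable]: "csqrt \<in> borel_measurable borel"
  proof -
    \<comment> \<open>\<open>csqrt\<close> is discontinuous across its cut, so measurability is read
      off from its real and imaginary parts.\<close>
    have "csqrt = (\<lambda>z. Complex (sqrt ((norm z + Re z) / 2)) ((if Im z = 0 then 1 else sgn (Im z)) * sqrt ((norm z - Re z) / 2)))"
      by (rule ext) (simp add: csqrt.ctr)
    moreover have "\<dots> \<in> borel_measurable borel"
      unfolding Complex_eq by measurable
    ultimately show ?thesis by simp
  qed
  show ?thesis unfolding far_kernel_def far_root_def by measurable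
qed

lemma far_continuous:
  fixes f :: "real ^ 3 \<Rightarrow> complex"
  assumes f: "f \<in> L2" and fs: "\<And>x. norm x > R \<Longrightarrow> f x = 0"
  shows "continuous_on {y. norm y \<ge> R + 1} (far k f)"
    and "norm y \<ge> R + 1 \<Longrightarrow> norm (far k f y) \<le> (LINT x|lborel. norm (f x))"
proof -
  note [measurable] = L2_measurable[OF f]
  have fi: "integrable lborel (\<lambda>x. norm (f x))"
  proof (rule integrable_le_bound[OF L2_indicator_cball_integrable[OF f, of R]])
    show "norm (norm (f x)) \<le> norm (f x) * indicator (cball 0 R) x" for x
      using fs[of x] by (cases "norm x \<le> R") auto
  qed measurable
  let ?g = "\<lambda>y x. f x * (exp (\<i> * of_real (k * norm (x - y))) * of_real (inverse (norm (x - y))))"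
  have far1: "norm (x - y) \<ge> 1" if "norm y \<ge> R + 1" "f x \<noteq> 0" for x y
  proof -
    have "norm x \<le> R" using fs[of x] that(2) by force
    then show ?thesis using that(1) norm_triangle_ineq3[of x y] by linarith
  qed
  have b: "norm (?g y x) \<le> norm (f x)" if "norm y \<ge> R + 1" for x y
  proof (cases "f x = 0")
    case False
    then have "norm (x - y) \<ge> 1" using far1 that by blast
    then have "norm (exp (\<i> * of_real (k * norm (x - y))) * complex_of_real (inverse (norm (x - y)))) \<le> 1"
      by (simp add: norm_mult norm_inverse inverse_le_1_iff del: of_real_mult)
    then show ?thesis unfolding norm_mult[of "f x"] by (intro mult_right_le_one_le) auto
  qed simp
  show "norm (far k f y) \<le> (LINT x|lborel. norm (f x))" if "norm y \<ge> R + 1"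
    unfolding far_def by (rule integral_norm_le[OF fi _ b[OF that]]) measurable
  show "continuous_on {y. norm y \<ge> R + 1} (far k f)"
    unfolding continuous_on_sequentially comp_def
  proof (intro allI ballI impI, elim conjE)
    fix Y a assume a: "a \<in> {y :: real ^ 3. norm y \<ge> R + 1}" and Y: "\<forall>n. Y n \<in> {y. norm y \<ge> R + 1}" and l: "Y \<longlonglongrightarrow> a"
    show "(\<lambda>n. far k f (Y n)) \<longlonglongrightarrow> far k f a"
      unfolding far_def
    proof (rule integral_dominated_convergence[OF _ _ fi])
      have "(\<lambda>n. ?g (Y n) x) \<longlonglongrightarrow> ?g a x" for x
      proof (cases "f x = 0")
        case False
        have "norm (x - a) \<noteq> 0" using far1[OF _ False, of a] a by auto
        then show ?thesis by (intro tendsto_intros l)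
      qed simp
      then show "AE x in lborel. (\<lambda>n. ?g (Y n) x) \<longlonglongrightarrow> ?g a x" by simp
      show "AE x in lborel. norm (?g (Y n) x) \<le> norm (f x)" for n
        by (rule AE_I2, rule b) (use Y in auto)
    qed measurable
  qed
qed

text \<open>Weak equality of the outgoing and the incoming potential becomes pointwise equality by
  continuity. It can then be examined along one ray at a time, where it is a relation between two
  holomorphic functions of the inverse distance.\<close>

theorem rellich:
  fixes u f :: "real ^ 3 \<Rightarrow> complex"
  assumes u: "u \<in> L2" and f: "f \<in> L2" and fs: "\<And>x. norm x > R \<Longrightarrow> f x = 0" and R: "R > 0" and k: "k > 0"
    and eq: "\<And>\<phi>. \<phi> \<in> test_functions \<Longrightarrow> (LINT x|lborel. u x * (lap \<phi> x + of_real (k\<^sup>2) * \<phi> x)) = - (LINT x|lborel. f x * \<phi> x)"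
  obtains A where "A \<ge> 0" "AE x in lborel. norm x \<ge> A \<longrightarrow> u x = 0"
proof -
  note [measurable] = L2_measurable[OF f]
  have rep: "of_real mass * (LINT x|lborel. u x * \<phi> x) = (LINT y|lborel. \<phi> y * far \<kappa> f y)"
    if "\<phi> \<in> test_functions" "\<And>y. \<phi> y \<noteq> 0 \<Longrightarrow> norm y \<ge> R + 1" "\<kappa>\<^sup>2 = k\<^sup>2" for \<phi> \<kappa>
    by (rule helmholtz_representation[OF u f fs _ that(1,2)]) (use eq that(3) in auto)
  have fi: "integrable lborel (\<lambda>x. norm (f x))"
  proof (rule integrable_le_bound[OF L2_indicator_cball_integrable[OF f, of R]])
    show "norm (norm (f x)) \<le> norm (f x) * indicator (cball 0 R) x" for x
      using fs[of x] by (cases "norm x \<le> R") auto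
  qed measurable
  define F where "F = (LINT x|lborel. norm (f x))"
  have farm: "far \<kappa> f \<in> borel_measurable borel" for \<kappa> unfolding far_def by measurable
  have fint: "integrable lborel (\<lambda>y. \<phi> y * far \<kappa> f y)"
    if \<phi>: "\<phi> \<in> test_functions" "\<And>y. \<phi> y \<noteq> 0 \<Longrightarrow> norm y \<ge> R + 1" for \<phi> \<kappa>
  proof (rule integrable_le_bound[OF integrable_mult_left[OF integrable_norm[OF test_functions_integrable[OF \<phi>(1)]], of F]])
    show "(\<lambda>y. \<phi> y * far \<kappa> f y) \<in> borel_measurable lborel"
      using farm smooth_measurable[OF test_functions_smooth[OF \<phi>(1)]] by measurable
    show "norm (\<phi> y * far \<kappa> f y) \<le> norm (\<phi> y) * F" for y
      using far_continuous(2)[OF f fs, where y=y and k=\<kappa>] \<phi>(2)[of y]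
      by (cases "\<phi> y = 0") (auto simp: norm_mult F_def intro!: mult_left_mono)
  qed
  define D where "D y = far k f y - far (- k) f y" for y
  have D0: "(LINT y|lborel. \<phi> y * D y) = 0" and Di: "integrable lborel (\<lambda>y. \<phi> y * D y)"
    if \<phi>: "\<phi> \<in> test_functions" "\<And>y. \<phi> y \<noteq> 0 \<Longrightarrow> norm y \<ge> R + 1" for \<phi>
    using rep[OF \<phi>, of k] rep[OF \<phi>, of "- k"] fint[OF \<phi>, of k] fint[OF \<phi>, of "- k"]
    by (auto simp: D_def right_diff_distrib)
  have Dc: "continuous_on {y. norm y \<ge> R + 1} D"
    unfolding D_def by (intro continuous_intros far_continuous(1)[OF f fs])
  \<comment> \<open>An averaging kernel concentrated near \<open>y\<close> reproduces
    \<open>D y\<close> up to half its size, but its pairing with \<open>D\<close> is 0. Strict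
    inequality leaves room for the kernel inside the region where the representation holds.\<close>
  have Dz: "D y = 0" if y: "norm y > R + 1" for y
  proof (rule ccontr)
    assume "D y \<noteq> 0"
    define \<epsilon> where "\<epsilon> = norm (D y) / 2"
    have \<epsilon>: "\<epsilon> > 0" using \<open>D y \<noteq> 0\<close> by (simp add: \<epsilon>_def)
    obtain \<delta> where \<delta>: "\<delta> > 0" and cl: "\<And>z. norm z \<ge> R + 1 \<Longrightarrow> dist z y < \<delta> \<Longrightarrow> dist (D z) (D y) < \<epsilon>"
      using Dc \<epsilon> y unfolding continuous_on_iff by (metis (mono_tags, lifting) less_imp_le mem_Collect_eq)
    obtain m :: "nat \<Rightarrow> real ^ 3 \<Rightarrow> complex" and e :: "nat \<Rightarrow> real"
      where m: "\<And>n. m n \<in> test_functions" and me: "\<And>n x. norm x \<ge> e n \<Longrightarrow> m n x = 0" and e0: "e \<longlonglongrightarrow> 0"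
        and mn: "\<And>n x. m n x = of_real (norm (m n x))" and m1: "\<And>n. (LINT x|lborel. m n x) = 1"
      by (rule exists_mollifiers) (rule that; assumption)
    have "min \<delta> (norm y - (R + 1)) > 0" using \<delta> y by simp
    from order_tendstoD(2)[OF e0 this] obtain n where n: "e n < min \<delta> (norm y - (R + 1))"
      by (auto simp: eventually_sequentially)
    let ?\<phi> = "\<lambda>z. m n (y - z)"
    have \<phi>: "?\<phi> \<in> test_functions" by (rule test_functions_reflect[OF m])
    have near: "norm (y - z) < e n" if "?\<phi> z \<noteq> 0" for z using me[of n "y - z"] that by force
    have sep: "norm z \<ge> R + 1" if "?\<phi> z \<noteq> 0" for z
      using near[OF that] n norm_triangle_ineq2[of y z] by linarith
    have i1: "(LINT z|lborel. ?\<phi> z) = 1"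
      using integral_translate(2)[OF test_functions_integrable[OF m[of n]], of y] m1[of n] by simp
    have i2: "(LINT z|lborel. norm (?\<phi> z)) = 1"
    proof -
      have "complex_of_real (LINT z|lborel. norm (?\<phi> z)) = (LINT z|lborel. ?\<phi> z)"
        unfolding integral_complex_of_real[symmetric] by (simp only: mn[symmetric])
      then show ?thesis using i1 by simp
    qed
    have "D y = (LINT z|lborel. ?\<phi> z * D y) - (LINT z|lborel. ?\<phi> z * D z)"
      using D0[OF \<phi> sep] i1 by simp
    also have "\<dots> = (LINT z|lborel. ?\<phi> z * (D y - D z))"
      using Di[OF \<phi> sep] test_functions_integrable[OF \<phi>] by (simp add: right_diff_distrib)
    finally have "norm (D y) = norm (LINT z|lborel. ?\<phi> z * (D y - D z))" by simp
    also have "\<dots> \<le> (LINT z|lborel. norm (?\<phi> z) * \<epsilon>)"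
    proof (rule integral_norm_le)
      show "integrable lborel (\<lambda>z. norm (?\<phi> z) * \<epsilon>)"
        by (rule integrable_mult_left[OF integrable_norm[OF test_functions_integrable[OF \<phi>]]])
      show "(\<lambda>z. ?\<phi> z * (D y - D z)) \<in> borel_measurable lborel"
        unfolding D_def using farm[of k] farm[of "- k"] smooth_measurable[OF test_functions_smooth[OF \<phi>]] by measurable
      show "norm (?\<phi> z * (D y - D z)) \<le> norm (?\<phi> z) * \<epsilon>" for z
      proof (cases "?\<phi> z = 0")
        case False
        have "dist (D z) (D y) < \<epsilon>"
          using near[OF False] n by (intro cl sep False) (auto simp: dist_norm norm_minus_commute)
        then show ?thesis unfolding norm_mult by (intro mult_left_mono) (auto simp: dist_norm norm_minus_commute)
      qed simp
    qed
    also have "\<dots> = \<epsilon>" using i2 by simp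
    finally show False using \<epsilon> by (simp add: \<epsilon>_def)
  qed
  \<comment> \<open>The first bound makes the kernels holomorphic in \<open>s\<close>; the second
    places \<open>inverse t *\<^sub>R \<omega>\<close> beyond radius \<open>R + 1\<close>, where
    \<open>Dz\<close> applies.\<close>
  define r where "r = min (1 / (4 * R)) (1 / (R + 1))"
  have r: "r > 0" "r \<le> 1 / (4 * R)" "r \<le> 1 / (R + 1)" using R by (auto simp: r_def)
  have zero: "far (- k) f y = 0" if y: "norm y > 1 / r" for y
  proof -
    have y0: "norm y > 0" using y r by (meson divide_pos_pos less_trans zero_less_one)
    define \<omega> where "\<omega> = inverse (norm y) *\<^sub>R y"
    have \<omega>: "norm \<omega> = 1" using y0 by (simp add: \<omega>_def)
    define A where "A \<kappa> s = (LINT x|lborel. f x * far_kernel \<kappa> \<omega> s x)" for \<kappa> s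
    have hol: "A \<kappa> holomorphic_on ball 0 r" for \<kappa>
      unfolding A_def
    proof (rule holomorphic_parametric_integral)
      show "(\<lambda>s. f x * far_kernel \<kappa> \<omega> s x) holomorphic_on ball 0 r" for x
      proof (cases "norm x \<le> R")
        case True
        have "(\<lambda>s. far_kernel \<kappa> \<omega> s x) holomorphic_on ball 0 r"
          by (rule holomorphic_on_subset[OF far_kernel_holomorphic[OF \<omega> R True]]) (use r in auto)
        then show ?thesis by (intro holomorphic_intros)
      qed (simp add: fs)
      show "integrable lborel (\<lambda>x. norm (f x) * (2 * exp (\<bar>\<kappa>\<bar> * (3 * R))))"
        by (rule integrable_mult_left[OF fi])
      show "norm (f x * far_kernel \<kappa> \<omega> s x) \<le> norm (f x) * (2 * exp (\<bar>\<kappa>\<bar> * (3 * R)))" if "s \<in> ball 0 r" for s x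
      proof (cases "norm x \<le> R")
        case True
        have "norm s < 1 / (4 * R)" using that r by simp
        from far_kernel_bound[OF \<omega> R True this, of \<kappa>] show ?thesis
          unfolding norm_mult by (rule mult_left_mono) simp
      qed (simp add: fs)
    qed measurable
    have farA: "far \<kappa> f (inverse t *\<^sub>R \<omega>) = of_real t * exp (\<i> * of_real (\<kappa> / t)) * A \<kappa> (of_real t)"
      if t: "0 < t" "t < r" for \<kappa> t
    proof -
      have "far \<kappa> f (inverse t *\<^sub>R \<omega>) = (LINT x|lborel. (of_real t * exp (\<i> * of_real (\<kappa> / t))) * (f x * far_kernel \<kappa> \<omega> (of_real t) x))"
        unfolding far_def
      proof (rule Bochner_Integration.integral_cong[OF refl])
        fix x
        show "f x * (exp (\<i> * of_real (\<kappa> * norm (x - inverse t *\<^sub>R \<omega>))) * of_real (inverse (norm (x - inverse t *\<^sub>R \<omega>))))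
          = (of_real t * exp (\<i> * of_real (\<kappa> / t))) * (f x * far_kernel \<kappa> \<omega> (of_real t) x)"
        proof (cases "norm x \<le> R")
          case True
          have "t < 1 / (4 * R)" using t r by linarith
          from far_kernel_eq[OF \<omega> R True t(1) this, of \<kappa>] show ?thesis by (simp only: mult_ac)
        qed (simp add: fs)
      qed
      then show ?thesis by (simp add: A_def)
    qed
    have Az: "A (- k) z = 0" if "z \<in> ball 0 r" for z
    proof (rule essential_singularity_zero[OF r(1) k hol hol _ that])
      fix t :: real assume t: "0 < t" "t < r"
      have "t < 1 / (R + 1)" using t r by linarith
      then have "R + 1 < inverse t" using t R by (simp add: field_simps)
      then have "norm (inverse t *\<^sub>R \<omega>) > R + 1" using \<omega> t by simp
      from Dz[OF this] have "of_real t * exp (\<i> * of_real (k / t)) * A k (of_real t) = of_real t * exp (\<i> * of_real (- k / t)) * A (- k) (of_real t)"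
        unfolding D_def farA[OF t] by simp
      then have "exp (\<i> * of_real (k / t)) * A k (of_real t) = exp (\<i> * of_real (- k / t)) * A (- k) (of_real t)"
        using t by (simp add: mult.assoc)
      note h = this
      have e1: "exp (2 * \<i> * of_real k / of_real t) = exp (\<i> * of_real (k / t)) * exp (\<i> * of_real (k / t))"
        unfolding exp_add[symmetric] by (simp add: algebra_simps)
      have e2: "exp (\<i> * of_real (k / t)) * exp (\<i> * of_real (- k / t)) = 1"
        unfolding exp_add[symmetric] by simp
      have "A k (of_real t) * exp (2 * \<i> * of_real k / of_real t) = exp (\<i> * of_real (k / t)) * (exp (\<i> * of_real (k / t)) * A k (of_real t))"
        unfolding e1 by (simp only: mult_ac)
      also have "\<dots> = (exp (\<i> * of_real (k / t)) * exp (\<i> * of_real (- k / t))) * A (- k) (of_real t)"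
        unfolding h by (simp only: mult.assoc)
      finally show "A k (of_real t) * exp (2 * \<i> * of_real k / of_real t) = A (- k) (of_real t)"
        unfolding e2 by simp
    qed
    have t: "0 < inverse (norm y)" "inverse (norm y) < r"
      using y y0 r(1) by (auto simp: field_simps)
    have "complex_of_real (inverse (norm y)) \<in> ball 0 r"
      unfolding mem_ball_0 norm_of_real using t by linarith
    then have "far (- k) f (inverse (inverse (norm y)) *\<^sub>R \<omega>) = 0"
      unfolding farA[OF t] by (simp only: Az mult_zero_right)
    moreover have "inverse (inverse (norm y)) *\<^sub>R \<omega> = y" using y0 by (simp add: \<omega>_def)
    ultimately show ?thesis by simp
  qed
  \<comment> \<open>The sum exceeds both \<open>R + 1\<close>, as the representation requires, and
    \<open>1 / r\<close>, as \<open>zero\<close> requires; the final 1 is the loss in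
    \<open>L2_zero_outside\<close>.\<close>
  have "AE x in lborel. norm x \<ge> (1 / r + 1 + R + 1) + 1 \<longrightarrow> u x = 0"
  proof (rule L2_zero_outside[OF u])
    fix \<phi> :: "real ^ 3 \<Rightarrow> complex" assume \<phi>: "\<phi> \<in> test_functions" "\<And>y. \<phi> y \<noteq> 0 \<Longrightarrow> norm y \<ge> 1 / r + 1 + R + 1"
    have "norm y \<ge> R + 1" "norm y > 1 / r" if "\<phi> y \<noteq> 0" for y
    proof -
      have "1 / r > 0" using r by simp
      then show "norm y \<ge> R + 1" "norm y > 1 / r" using \<phi>(2)[OF that] R by linarith+
    qed
    then have "of_real mass * (LINT x|lborel. u x * \<phi> x) = (LINT y|lborel. \<phi> y * far (- k) f y)" "\<And>y. \<phi> y * far (- k) f y = 0"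
      using rep[OF \<phi>(1), of "- k"] zero by auto
    then show "(LINT x|lborel. u x * \<phi> x) = 0" using mass_pos by simp
  qed
  moreover have "(1 / r + 1 + R + 1) + 1 \<ge> 0" using r R by simp
  ultimately show thesis using that by blast
qed

section \<open>Absence of eigenvalues\<close>

lemma partials_two: "partials [i, i] \<phi> = partial i (partial i \<phi>)"
  by simp

text \<open>Membership in \<open>sobolev 2\<close> provides witnesses for the choices in
  \<open>weak_partials\<close>, so the chosen functions do have the defining property.\<close>

lemma sobolev_weak_lap:
  assumes "u \<in> sobolev 2"
  shows "laplacian u \<in> L2" "weak_lap u (laplacian u)"
proof -
  have u: "u \<in> L2" using assms by (simp add: sobolev_def)
  have ex: "\<exists>v. v \<in> L2 \<and> has_weak_partials [i, i] u v" for i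
    using assms unfolding sobolev_def by (auto dest: spec[of _ "[i, i]"])
  have wL: "weak_partials [i, i] u \<in> L2" and ww: "has_weak_partials [i, i] u (weak_partials [i, i] u)" for i
    using someI_ex[OF ex[of i]] by (auto simp: weak_partials_def)
  show "laplacian u \<in> L2"
    unfolding laplacian_def by (rule L2_sum) (auto intro: wL)
  show "weak_lap u (laplacian u)"
    unfolding weak_lap_def
  proof
    fix \<phi> :: "real ^ 'a \<Rightarrow> complex" assume \<phi>: "\<phi> \<in> test_functions"
    have t: "partial i (partial i \<phi>) \<in> test_functions" for i by (intro test_functions_partial \<phi>)
    have "(LINT x|lborel. u x * lap \<phi> x) = (\<Sum>i\<in>UNIV. LINT x|lborel. u x * partial i (partial i \<phi>) x)"
      unfolding lap_def sum_distrib_left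
      by (rule Bochner_Integration.integral_sum) (rule L2_mult_integrable[OF u test_functions_L2[OF t]])
    also have "\<dots> = (\<Sum>i\<in>UNIV. LINT x|lborel. weak_partials [i, i] u x * \<phi> x)"
      using ww \<phi> unfolding has_weak_partials_def partials_two by (intro sum.cong refl) auto
    also have "\<dots> = (LINT x|lborel. laplacian u x * \<phi> x)"
      unfolding laplacian_def sum_distrib_right
      by (rule Bochner_Integration.integral_sum[symmetric]) (rule L2_mult_integrable[OF wL test_functions_L2[OF \<phi>]])
    finally show "(LINT x|lborel. u x * lap \<phi> x) = (LINT x|lborel. laplacian u x * \<phi> x)" .
  qed
qed

theorem lemma2p3:
  fixes \<Omega> :: "(real ^ 3) set" and \<epsilon> :: real
  assumes "open \<Omega>" and "bounded \<Omega>" and "connected \<Omega>" and "0 \<in> \<Omega>"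
    and "0 < \<epsilon>" and "\<epsilon> < 1"
  shows "point_spectrum (H_op \<Omega> \<epsilon>) = {}"
proof (rule equals0I)
  fix \<mu> assume "\<mu> \<in> point_spectrum (H_op \<Omega> \<epsilon>)"
  then obtain u where us: "u \<in> sobolev 2" and nz: "\<not> (AE x in lborel. u x = 0)"
    and ev: "AE x in lborel. - (complex_of_real (coeff_b \<Omega> \<epsilon> x) * laplacian u x) = \<mu> * u x"
    unfolding point_spectrum_def H_op_def by auto
  let ?b = "coeff_b \<Omega> \<epsilon>"
  define g where "g = laplacian u"
  have u: "u \<in> L2" using us by (simp add: sobolev_def)
  have g: "g \<in> L2" and w: "weak_lap u g" using sobolev_weak_lap[OF us] by (auto simp: g_def)
  note [measurable] = L2_measurable[OF u] L2_measurable[OF g]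
  have S: "scaled_domain \<Omega> \<epsilon> = (\<lambda>y. \<epsilon> *\<^sub>R y) ` \<Omega>" by (auto simp: scaled_domain_def)
  have "open (scaled_domain \<Omega> \<epsilon>)" unfolding S by (rule open_scaling) (use assms in auto)
  then have [measurable]: "scaled_domain \<Omega> \<epsilon> \<in> sets borel" by simp
  have bm[measurable]: "?b \<in> borel_measurable borel" unfolding coeff_b_def by measurable
  have bounds: "\<epsilon>\<^sup>2 \<le> ?b x" "?b x \<le> 1" "?b x > 0" for x
    using assms(5,6) by (auto simp: coeff_b_def indicator_def power_le_one)
  have "bounded (scaled_domain \<Omega> \<epsilon>)" unfolding S by (rule bounded_scaling[OF assms(2)])
  then obtain R where R: "R > 0" and sR: "\<forall>x\<in>scaled_domain \<Omega> \<epsilon>. norm x \<le> R"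
    unfolding bounded_pos by blast
  have b1: "?b x = 1" if "norm x > R" for x
    using sR that by (auto simp: coeff_b_def indicator_def)
  have gu: "AE x in lborel. g x = - (\<mu> * of_real (inverse (?b x))) * u x"
    using ev
  proof eventually_elim
    case (elim x)
    then show ?case using bounds(3)[of x] by (simp add: g_def field_simps) (metis minus_mult_right neg_equal_iff_equal add.inverse_inverse)
  qed
  \<comment> \<open>Integrates to the squared norm of \<open>u\<close> in the weighted space with
    measure \<open>dx / b\<close>. Since \<open>b * g = - \<mu> * u\<close>, the energy is
    \<open>- \<mu>\<close> times this positive number, so \<open>weak_lap_energy\<close> determines
    the sign and the reality of \<open>\<mu>\<close>.\<close>
  let ?h = "\<lambda>x. inverse (?b x) * (norm (u x))\<^sup>2"
  have hi: "integrable lborel ?h"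
  proof (rule integrable_le_bound)
    show "integrable lborel (\<lambda>x. inverse (\<epsilon>\<^sup>2) * (norm (u x))\<^sup>2)" using L2_integrable[OF u] by simp
    show "norm (?h x) \<le> inverse (\<epsilon>\<^sup>2) * (norm (u x))\<^sup>2" for x
      using bounds[of x] assms(5) by (auto simp: abs_mult intro!: mult_right_mono le_imp_inverse_le)
  qed measurable
  define J where "J = (LINT x|lborel. ?h x)"
  have J: "J > 0"
  proof -
    have "J \<noteq> 0"
    proof
      assume "J = 0"
      then have "AE x in lborel. ?h x = 0"
        unfolding J_def using integral_nonneg_eq_0_iff_AE[OF hi] bounds(3) by (auto simp: less_imp_le)
      then have "AE x in lborel. u x = 0"
        by eventually_elim (use bounds(3) in \<open>auto simp: less_le\<close>)
      with nz show False by simp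
    qed
    moreover have "J \<ge> 0" unfolding J_def using bounds(3) by (intro integral_nonneg_AE AE_I2) (simp add: less_imp_le)
    ultimately show ?thesis by simp
  qed
  have energy: "(LINT x|lborel. g x * cnj (u x)) = - \<mu> * of_real J"
  proof -
    have "(LINT x|lborel. g x * cnj (u x)) = (LINT x|lborel. - \<mu> * of_real (?h x))"
    proof (rule integral_cong_AE)
      show "AE x in lborel. g x * cnj (u x) = - \<mu> * of_real (?h x)"
        using gu by eventually_elim (simp add: mult.assoc complex_norm_square[symmetric])
      show "(\<lambda>x. g x * cnj (u x)) \<in> borel_measurable lborel"
        using L2_measurable[OF L2_cnj[OF u]] by measurable
    qed measurable
    then show ?thesis unfolding J_def by (simp only: integral_mult_right_zero integral_complex_of_real)
  qed
  have \<mu>: "Im \<mu> = 0" "Re \<mu> \<ge> 0"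
    using weak_lap_energy[OF u g w] J unfolding energy by (auto simp: zero_le_mult_iff)
  define k where "k = sqrt (Re \<mu>)"
  have k2: "of_real (k\<^sup>2) = \<mu>" using \<mu> by (simp add: k_def complex_eq_iff)
  \<comment> \<open>The eigenvalue equation holds only almost everywhere. The indicator makes
    \<open>f\<close> vanish at every point outside the ball, as \<open>rellich\<close> demands, and
    changes it on a null set only.\<close>
  define f where "f x = complex_of_real (indicator (cball 0 R) x) * (- (g x + \<mu> * u x))" for x
  have fe: "AE x in lborel. g x + \<mu> * u x = - f x"
    using gu
  proof eventually_elim
    case (elim x)
    then show ?case using b1[of x] by (cases "norm x \<le> R") (auto simp: f_def)
  qed
  have f: "f \<in> L2"
    unfolding f_def
    by (rule L2_bounded_mult[of _ _ 1]) (use L2_cmult[OF L2_add[OF g L2_cmult[OF u, of \<mu>]], of "-1"] in \<open>auto simp: indicator_def\<close>)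
  have fs: "f x = 0" if "norm x > R" for x using that by (simp add: f_def)
  note [measurable] = L2_measurable[OF f]
  have eq: "(LINT x|lborel. u x * (lap \<phi> x + of_real (k\<^sup>2) * \<phi> x)) = - (LINT x|lborel. f x * \<phi> x)"
    if \<phi>: "\<phi> \<in> test_functions" for \<phi>
  proof -
    note [measurable] = smooth_measurable[OF test_functions_smooth[OF \<phi>]]
    have lL: "lap \<phi> \<in> L2"
      unfolding lap_def[abs_def] by (rule L2_sum) (auto intro: test_functions_L2 test_functions_partial \<phi>)
    have pL: "\<phi> \<in> L2" by (rule test_functions_L2[OF \<phi>])
    have "(LINT x|lborel. u x * (lap \<phi> x + of_real (k\<^sup>2) * \<phi> x)) = (LINT x|lborel. u x * lap \<phi> x + \<mu> * (u x * \<phi> x))"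
      unfolding k2 by (simp add: algebra_simps)
    also have "\<dots> = (LINT x|lborel. g x * \<phi> x) + \<mu> * (LINT x|lborel. u x * \<phi> x)"
      using L2_mult_integrable[OF u lL] L2_mult_integrable[OF u pL] w \<phi> by (simp add: weak_lap_def)
    also have "\<dots> = (LINT x|lborel. (g x + \<mu> * u x) * \<phi> x)"
      using L2_mult_integrable[OF u pL] L2_mult_integrable[OF g pL] by (simp add: distrib_right mult.assoc)
    also have "\<dots> = (LINT x|lborel. - (f x * \<phi> x))"
    proof (rule integral_cong_AE)
      show "AE x in lborel. (g x + \<mu> * u x) * \<phi> x = - (f x * \<phi> x)"
        using fe by eventually_elim simp
    qed measurable
    finally show ?thesis by simp
  qed
  show False
  proof (cases "k = 0")
    case True
    then have "\<mu> = 0" using k2 by simp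
    have "AE x in lborel. f x = 0" using fe gu by eventually_elim (simp add: \<open>\<mu> = 0\<close>)
    have z: "(LINT x|lborel. u x * \<phi> x) = 0" if \<phi>: "\<phi> \<in> test_functions" for \<phi>
    proof -
      note [measurable] = smooth_measurable[OF test_functions_smooth[OF \<phi>]]
      have eq0: "(LINT x|lborel. u x * (lap \<psi> x + of_real (0\<^sup>2) * \<psi> x)) = - (LINT x|lborel. 0 * \<psi> x)"
        if \<psi>: "\<psi> \<in> test_functions" for \<psi>
      proof -
        note [measurable] = smooth_measurable[OF test_functions_smooth[OF \<psi>]]
        have "(LINT x|lborel. f x * \<psi> x) = (LINT x|lborel. 0 * \<psi> x)"
          by (rule integral_cong_AE) (use \<open>AE x in lborel. f x = 0\<close> in auto)
        then show ?thesis using eq[OF \<psi>] True by simp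
      qed
      have "of_real mass * (LINT x|lborel. u x * \<phi> x) = (LINT y|lborel. \<phi> y * far 0 (\<lambda>_. 0) y)"
      \<comment> \<open>For a source that is identically 0 the radius \<open>- 1\<close> is
        admissible, and then \<open>sep\<close> holds for every test function. The value
        \<open>A = - 1\<close> in \<open>L2_zero_outside\<close> below likewise covers the whole
        space.\<close>
      proof (rule helmholtz_representation[of u "\<lambda>_. 0" "- 1", OF u _ _ eq0 \<phi>])
        show "(\<lambda>_. 0) \<in> L2" by (rule L2_bounded_support[of _ 0 0]) auto
      qed auto
      then show ?thesis using mass_pos by (simp add: far_def)
    qed
    have "AE x in lborel. norm x \<ge> - 1 + 1 \<longrightarrow> u x = 0"
      by (rule L2_zero_outside[OF u z])
    with nz show False by simp
  next
    case False
    then have "k > 0" using \<mu> by (simp add: k_def less_le)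
    obtain A where A: "A \<ge> 0" "AE x in lborel. norm x \<ge> A \<longrightarrow> u x = 0"
      using rellich[OF u f fs R \<open>k > 0\<close> eq] by blast
    \<comment> \<open>The only information on \<open>b\<close> that unique continuation receives is
      its lower bound \<open>\<epsilon>^2\<close>.\<close>
    have "AE x in lborel. norm (g x) \<le> (norm \<mu> * inverse (\<epsilon>\<^sup>2)) * norm (u x)"
      using gu
    proof eventually_elim
      case (elim x)
      have "inverse (?b x) \<le> inverse (\<epsilon>\<^sup>2)" using bounds[of x] assms(5) by (intro le_imp_inverse_le) auto
      then have "norm \<mu> * inverse (?b x) * norm (u x) \<le> norm \<mu> * inverse (\<epsilon>\<^sup>2) * norm (u x)"
        by (intro mult_right_mono mult_left_mono) auto
      moreover have "norm (g x) = norm \<mu> * inverse (?b x) * norm (u x)"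
        using bounds(3)[of x] unfolding elim norm_mult norm_minus_cancel norm_of_real by simp
      ultimately show ?case by simp
    qed
    from compact_support_unique_continuation[OF u g w this A(2,1)] have "AE x in lborel. u x = 0"
      by simp
    with nz show False by simp
  qed
qed

end
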